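(* Let $d\ge1$, $0<s<1$ and $t>0$ be fixed, and let $$p_s(t,x,y)=\frac1{(2\pi)^d}\int_{[-\pi,\pi]^d}e^{-t\Phi(\xi)^s}e^{i(x-y)\cdot\xi}\,d\xi,\qquad \Phi(\xi)=\sum_{j=1}^d(2-2\cos\xi_j),$$ be the fractional diffusion kernel on the standard lattice $\mathbb Z^d$. Then, for $x,y\in\mathbb Z^d$, $$\lim_{|x-y|\to\infty}|x-y|^{\,d+2s}\,p_s(t,x,y)=-\frac{t}{(2\pi)^d}\,A_{s,d},$$ where $$A_{s,d}=\lim_{N\to\infty}\int_{\mathbb R^d}|\eta|^{2s}\,\chi\Bigl(\frac\eta N\Bigr)e^{i\omega\cdot\eta}\,d\eta .$$
   Context: The standard lattice $\mathbb Z^d$ carries unit vertex measure and unit edge weights between nearest neighbours, with Laplacian $\Delta u(x)=\sum_{y\sim x}(u(y)-u(x))$; $p_s(t,x,y)=(e^{-t(-\Delta)^s}\delta_y)(x)$ is the kernel of the semigroup generated by $-(-\Delta)^s$. $|\cdot|$ is the Euclidean norm. In the definition of $A_{s,d}$, $\omega\in\mathbb S^{d-1}$ is any unit vector and $\chi\in C_c^\infty(\mathbb R^d)$ is any radial function with $\chi(\eta)=1$ for $|\eta|\le\frac12$ and $\chi(\eta)=0$ for $|\eta|\ge1$; the limit exists, is finite, and depends only on $d$ and $s$ (not on $\chi$ or $\omega$). *)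

theory Defs
  imports "HOL-Analysis.Analysis"
begin

text \<open>The lattice of dimension d is the type \<open>int ^ 'n\<close> with \<open>d = CARD('n)\<close>.\<close>

definition lattice_embed :: "int ^ 'n \<Rightarrow> real ^ 'n" where
  "lattice_embed x = (\<chi> i. real_of_int (x $ i))"

text \<open>The symbol of \<open>- \<Delta>\<close>, where \<open>\<Delta> u(x)\<close> is the sum of \<open>u(y) - u(x)\<close> over the nearest
  neighbours \<open>y\<close> of \<open>x\<close>.\<close>

definition laplace_symbol :: "real ^ 'n \<Rightarrow> real" where
  "laplace_symbol \<xi> = (\<Sum>j\<in>UNIV. 2 - 2 * cos (\<xi> $ j))"

definition frac_kernel :: "real \<Rightarrow> real \<Rightarrow> int ^ 'n \<Rightarrow> int ^ 'n \<Rightarrow> complex" where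
  "frac_kernel s t x y =
     1 / (2 * of_real pi) ^ CARD('n) *
     (LINT \<xi> : cbox (\<chi> i. - pi) (\<chi> i. pi) | lborel.
        of_real (exp (- t * laplace_symbol \<xi> powr s)) *
        exp (\<i> * of_real (lattice_embed (x - y) \<bullet> \<xi>)))"

text \<open>Convergence along this filter is uniform over all pairs at distance at least R, as R grows.\<close>

definition at_infinite_distance :: "((int ^ 'n) \<times> (int ^ 'n)) filter" where
  "at_infinite_distance = filtercomap (\<lambda>(x, y). norm (lattice_embed (x - y))) at_top"

text \<open>Class C^k in finite dimension, through iterated directional derivatives.\<close>

fun C_k :: "nat \<Rightarrow> ('a::euclidean_space \<Rightarrow> 'b::real_normed_vector) \<Rightarrow> bool" where
  "C_k 0 f \<longleftrightarrow> continuous_on UNIV f"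
| "C_k (Suc k) f \<longleftrightarrow>
     (\<forall>x. f differentiable (at x)) \<and> (\<forall>v. C_k k (\<lambda>x. frechet_derivative f (at x) v))"

definition smooth_compact_support :: "('a::euclidean_space \<Rightarrow> 'b::real_normed_vector) \<Rightarrow> bool" where
  "smooth_compact_support f \<longleftrightarrow> (\<forall>k. C_k k f) \<and> compact (closure {x. f x \<noteq> 0})"

definition radial_cutoff :: "('a::euclidean_space \<Rightarrow> complex) \<Rightarrow> bool" where
  "radial_cutoff \<phi> \<longleftrightarrow>
     smooth_compact_support \<phi> \<and>
     (\<forall>x y. norm x = norm y \<longrightarrow> \<phi> x = \<phi> y) \<and>
     (\<forall>x. norm x \<le> 1 / 2 \<longrightarrow> \<phi> x = 1) \<and>
     (\<forall>x. norm x \<ge> 1 \<longrightarrow> \<phi> x = 0)"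

definition cutoff_integral ::
    "real \<Rightarrow> (real ^ 'n \<Rightarrow> complex) \<Rightarrow> real ^ 'n \<Rightarrow> real \<Rightarrow> complex" where
  "cutoff_integral s \<phi> \<omega> N =
     (LINT \<eta> | lborel.
        of_real (norm \<eta> powr (2 * s)) * \<phi> (\<eta> /\<^sub>R N) * exp (\<i> * of_real (\<omega> \<bullet> \<eta>)))"

end

theory Submission
  imports Defs "HOL-Probability.Probability"
begin

text \<open>
  Write \<open>\<Phi>\<close> for the symbol of \<open>-\<Delta>\<close>, \<open>d\<close> for the dimension and \<open>R = |x - y|\<close>. The kernel of the
  semigroup is the Fourier coefficient of \<open>exp (-t \<Phi>\<^sup>s)\<close>. Its tail comes from the singularity of
  \<open>\<Phi>\<^sup>s\<close> at the origin, where \<open>\<Phi>\<^sup>s\<close> looks like \<open>|\<xi>|\<^bsup>2s\<^esup>\<close>. No derivative of \<open>\<Phi>\<^sup>s\<close> is ever taken: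
  the singularity is resolved by the subordination formula
  \<open>\<lambda>\<^sup>s = 1/\<kappa> \<integral> (1 - e\<^bsup>-u\<lambda>\<^esup>) u\<^bsup>-1-s\<^esup> du\<close> over \<open>u > 0\<close>, which turns statements about \<open>\<Phi>\<^sup>s\<close> and
  \<open>|\<eta>|\<^bsup>2s\<^esup>\<close> into statements about heat kernels (\<open>powr_integral_subordination\<close>).

  Off the origin, the Fourier coefficient of \<open>\<Phi>\<^sup>s\<close> at \<open>x\<close> is \<open>-1/\<kappa> \<integral> h\<^sub>u(x) u\<^bsup>-1-s\<^esup> du\<close> with the
  lattice heat kernel \<open>h\<close>. In the diffusive scaling \<open>u = R\<^sup>2 \<tau>\<close> the local limit theorem
  (\<open>lattice_local_limit\<close>) gives \<open>R\<^sup>d h\<^sub>u(x) \<rightarrow> g(\<tau>) = (\<pi>/\<tau>)\<^bsup>d/2\<^esup> e\<^bsup>-1/(4\<tau>)\<^esup>\<close>, up to the factor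
  \<open>(2\<pi>)\<^sup>d\<close>, and \<open>R\<^sup>d h\<^sub>u(x) \<le> C min 1 \<tau>\<close> (\<open>scaled_lattice_heat_bound\<close>) allows passing to the limit
  under the integral. Hence \<open>R\<^bsup>d+2s\<^esup>\<close> times the coefficient tends to
  \<open>A = -1/\<kappa> \<integral> g(\<tau>) \<tau>\<^bsup>-1-s\<^esup> d\<tau>\<close>, again up to \<open>(2\<pi>)\<^sup>d\<close>.

  The same constant appears in the continuum. Subordination of \<open>|\<eta>|\<^bsup>2s\<^esup>\<close> turns the cutoff integral
  into an integral over \<open>u\<close> of \<open>\<integral> (1 - e\<^bsup>-u|\<eta>|^2\<^esup>) \<phi>(\<eta>/N) e\<^bsup>i\<omega>\<eta>\<^esup> d\<eta>\<close>. As \<open>N\<close> grows the term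
  without the Gaussian vanishes, because the Fourier transform of \<open>\<phi>\<close> decays rapidly, and the other
  term tends to \<open>-g(u)\<close>; the limit is \<open>A\<close> for every cutoff and every direction
  (\<open>cutoff_integral_tendsto\<close>).

  It remains to pass from \<open>\<Phi>\<^sup>s\<close> to \<open>exp (-t \<Phi>\<^sup>s)\<close>. The Fourier series of \<open>\<Phi>\<^sup>s\<close> converges absolutely
  (\<open>symbol_powr_absolutely_convergent\<close>), so powers of \<open>\<Phi>\<^sup>s\<close> correspond to convolution powers of its
  coefficient sequence \<open>F\<close>. A sequence with tail \<open>a R\<^bsup>-d-2s\<^esup>\<close> convolved with one with tail
  \<open>b R\<^bsup>-d-2s\<^esup>\<close> has tail coefficient \<open>a \<Sum> G + b \<Sum> F\<close>: one of the two factors must be far out, the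
  other contributes its sum (\<open>tail_coefficient_convolve\<close>). Since \<open>\<Sum> F = \<Phi>(0)\<^sup>s = 0\<close>, every power
  beyond the first has vanishing tail coefficient, and only the linear term \<open>-t \<Phi>\<^sup>s\<close> of the
  exponential series survives.
\<close>

section \<open>Integration on Euclidean space\<close>

abbreviation wave :: "real \<Rightarrow> complex" where
  "wave y \<equiv> exp (\<i> * of_real y)"

lemma lborel_integral_prod_Basis:
  fixes f :: "'a::euclidean_space \<Rightarrow> real \<Rightarrow> complex"
  assumes int: "\<And>b. b \<in> Basis \<Longrightarrow> integrable lborel (f b)"
  shows "integrable lborel (\<lambda>x::'a. \<Prod>b\<in>Basis. f b (x \<bullet> b))"
    and "(LBINT x. (\<Prod>b\<in>Basis. f b (x \<bullet> b))) = (\<Prod>b\<in>Basis. LBINT x. f b x)"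
proof -
  interpret product_sigma_finite "\<lambda>_::'a. lborel :: real measure" ..
  have m: "f b \<in> borel_measurable borel" if "b \<in> Basis" for b
    using borel_measurable_integrable[OF int[OF that]] by simp
  have M: "(\<lambda>x::'a. \<Prod>b\<in>Basis. f b (x \<bullet> b)) \<in> borel_measurable borel"
    using m by (intro borel_measurable_prod measurable_compose[OF _ m]) auto
  have T: "(\<lambda>g. \<Sum>b\<in>Basis. g b *\<^sub>R b) \<in> measurable (\<Pi>\<^sub>M b\<in>Basis. lborel) (borel :: 'a measure)"
    by measurable
  have eq: "(\<Prod>b\<in>Basis. f b ((\<Sum>c\<in>Basis. g c *\<^sub>R c) \<bullet> b)) = (\<Prod>b\<in>Basis. f b (g b))" for g :: "'a \<Rightarrow> real"
    by (intro prod.cong refl) simp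
  show "integrable lborel (\<lambda>x::'a. \<Prod>b\<in>Basis. f b (x \<bullet> b))"
    unfolding lborel_eq[where 'a='a] integrable_distr_eq[OF T M] eq
    by (rule product_integrable_prod) (use int in auto)
  show "(LBINT x. (\<Prod>b\<in>Basis. f b (x \<bullet> b))) = (\<Prod>b\<in>Basis. LBINT x. f b x)"
    unfolding lborel_eq[where 'a='a] integral_distr[OF T M] eq
    by (rule product_integral_prod) (use int in auto)
qed

lemma prod_Basis_vec: "(\<Prod>b\<in>(Basis :: (real^'n) set). g b) = (\<Prod>j\<in>UNIV. g (axis j 1))"
proof -
  have "(Basis :: (real^'n) set) = range (\<lambda>j. axis j 1)"
    by (auto simp: Basis_vec_def)
  moreover have "inj (\<lambda>j::'n. axis j (1::real))"
    by (auto simp: inj_on_def axis_eq_axis)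
  ultimately show ?thesis by (metis (no_types, lifting) prod.reindex_cong)
qed

lemma lborel_integral_prod_vec:
  fixes f :: "'n::finite \<Rightarrow> real \<Rightarrow> complex"
  assumes int: "\<And>j. integrable lborel (f j)"
  shows "integrable lborel (\<lambda>x::real^'n. \<Prod>j\<in>UNIV. f j (x $ j))"
    and "(LBINT x. (\<Prod>j\<in>UNIV. f j ((x::real^'n) $ j))) = (\<Prod>j\<in>UNIV. LBINT x. f j x)"
proof -
  define F where "F b = f (THE j. b = axis j (1::real))" for b :: "real^'n"
  have F: "F (axis j 1) = f j" for j
    unfolding F_def by (rule arg_cong[where f=f]) (auto simp: axis_eq_axis)
  have i: "integrable lborel (F b)" if "b \<in> Basis" for b
    using that int F by (auto simp: Basis_vec_def)
  note * = lborel_integral_prod_Basis[of F, OF i]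
  show "integrable lborel (\<lambda>x::real^'n. \<Prod>j\<in>UNIV. f j (x $ j))"
    using *(1) by (simp add: prod_Basis_vec F inner_axis)
  show "(LBINT x. (\<Prod>j\<in>UNIV. f j ((x::real^'n) $ j))) = (\<Prod>j\<in>UNIV. LBINT x. f j x)"
    using *(2) by (simp add: prod_Basis_vec F inner_axis)
qed

lemma integrable_scaleR_nonzero_iff:
  fixes f :: "'a \<Rightarrow> 'b::{banach, second_countable_topology}"
  assumes c: "c \<noteq> 0"
  shows "integrable M (\<lambda>x. c *\<^sub>R f x) \<longleftrightarrow> integrable M f"
proof
  assume "integrable M (\<lambda>x. c *\<^sub>R f x)"
  then have "integrable M (\<lambda>x. inverse c *\<^sub>R (c *\<^sub>R f x))" by (rule integrable_scaleR_right)
  then show "integrable M f" using c by simp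
qed simp

lemma lborel_integral_scaleR:
  fixes f :: "'a::euclidean_space \<Rightarrow> 'b::{banach, second_countable_topology}"
  assumes c: "c > 0" and [measurable]: "f \<in> borel_measurable borel"
  shows "integrable lborel (\<lambda>x. f (c *\<^sub>R x)) \<longleftrightarrow> integrable lborel f"
    and "(LBINT x. f x) = c ^ DIM('a) *\<^sub>R (LBINT x. f (c *\<^sub>R x))"
proof -
  have eq: "(lborel :: 'a measure) = density (distr lborel borel (\<lambda>x. c *\<^sub>R x)) (\<lambda>_. ennreal (c ^ DIM('a)))"
    using lborel_affine[of c "0::'a"] c by simp
  have "integrable lborel f \<longleftrightarrow> integrable lborel (\<lambda>x. c ^ DIM('a) *\<^sub>R f (c *\<^sub>R x))"
    using c by (subst eq) (simp add: integrable_density integrable_distr_eq)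
  also have "\<dots> \<longleftrightarrow> integrable lborel (\<lambda>x. f (c *\<^sub>R x))"
    using c by (intro integrable_scaleR_nonzero_iff) simp
  finally show "integrable lborel (\<lambda>x. f (c *\<^sub>R x)) \<longleftrightarrow> integrable lborel f" ..
  show "(LBINT x. f x) = c ^ DIM('a) *\<^sub>R (LBINT x. f (c *\<^sub>R x))"
    using c by (subst eq) (simp add: integral_density integral_distr)
qed

text \<open>
  A filter pulled back from \<open>at_top\<close> has a countable basis, so sequences detect its limits. This is
  how dominated convergence enters for limits at infinite distance.
\<close>
lemma tendsto_filtercomap_at_top_sequentially:
  fixes f :: "'a \<Rightarrow> real"
  assumes "\<And>X. filterlim (\<lambda>n. f (X n)) at_top sequentially \<Longrightarrow> (\<lambda>n. g (X n)) \<longlonglongrightarrow> L"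
  shows "(g \<longlongrightarrow> L) (filtercomap f at_top)"
proof (rule topological_tendstoI, rule ccontr)
  fix S assume S: "open S" "L \<in> S"
  assume "\<not> (\<forall>\<^sub>F x in filtercomap f at_top. g x \<in> S)"
  then have "\<exists>x. f x \<ge> real n \<and> g x \<notin> S" for n
    by (auto simp: eventually_filtercomap eventually_at_top_linorder)
  then obtain X where X: "\<And>n. f (X n) \<ge> real n" "\<And>n. g (X n) \<notin> S" by metis
  have "filterlim (\<lambda>n. f (X n)) at_top sequentially"
    by (rule filterlim_at_top_mono[OF filterlim_real_sequentially]) (use X in auto)
  from topological_tendstoD[OF assms[OF this] S] X(2) show False by auto
qed

text \<open>
  A rescaling of the characteristic function of the standard normal distribution.
\<close>
lemma gaussian_fourier_1d:
  fixes a b :: real assumes a: "a > 0"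
  shows "integrable lborel (\<lambda>x::real. of_real (exp (- a * x\<^sup>2)) * wave (b * x) :: complex)"
    and "(LBINT x. of_real (exp (- a * x\<^sup>2)) * wave (b * x) :: complex)
       = of_real (sqrt (pi / a) * exp (- b\<^sup>2 / (4 * a)))"
proof -
  define r where "r = sqrt (2 * a)"
  have r: "r > 0" "r\<^sup>2 = 2 * a" using a by (auto simp: r_def)
  have i: "integrable lborel (\<lambda>x::real. std_normal_density x)"
    by (rule integrable_normal_density) simp
  have i2: "integrable lborel (\<lambda>x::real. std_normal_density x *\<^sub>R wave (b / r * x) :: complex)"
    by (rule Bochner_Integration.integrable_bound[OF i]) (auto simp: norm_mult)
  have i3: "integrable lborel (\<lambda>x::real. std_normal_density (r*x) *\<^sub>R wave (b / r * (r*x)) :: complex)"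
    using lborel_integrable_real_affine[OF i2, of r 0] r by simp
  have e: "std_normal_density (r*x) *\<^sub>R wave (b / r * (r*x)) =
     of_real (1 / sqrt (2*pi)) * (of_real (exp (- a * x\<^sup>2)) * wave (b * x) :: complex)" for x
    using r by (simp add: normal_density_def power_mult_distrib scaleR_conv_of_real mult_ac)
  have c: "complex_of_real (1 / sqrt (2*pi)) \<noteq> 0" by simp
  show "integrable lborel (\<lambda>x::real. of_real (exp (- a * x\<^sup>2)) * wave (b * x) :: complex)"
    using integrable_mult_right[of "complex_of_real (sqrt (2*pi))", OF i3[unfolded e]] 
    by (simp add: field_simps)
  have "complex_of_real (exp (- ((b/r)\<^sup>2) / 2)) = char std_normal_distribution (b / r)"
    by (simp add: char_std_normal_distribution)
  also have "\<dots> = (LBINT x. std_normal_density x *\<^sub>R wave (b / r * x))"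
    unfolding char_def by (subst integral_density) auto
  also have "\<dots> = r *\<^sub>R (LBINT x. std_normal_density (r*x) *\<^sub>R wave (b / r * (r*x)))"
    using lborel_integral_real_affine[of r "\<lambda>x. std_normal_density x *\<^sub>R wave (b / r * x) :: complex" 0] r
    by simp
  also have "\<dots> = of_real (r / sqrt (2*pi)) * (LBINT x. of_real (exp (- a * x\<^sup>2)) * wave (b * x))"
    unfolding e by (simp add: scaleR_conv_of_real)
  finally have *: "complex_of_real (exp (- ((b/r)\<^sup>2) / 2)) = \<dots>" .
  have "r / sqrt (2*pi) * sqrt (pi/a) = 1"
    using a unfolding r_def by (simp add: real_sqrt_mult real_sqrt_divide)
  then have "(LBINT x. of_real (exp (- a * x\<^sup>2)) * wave (b * x) :: complex)
     = of_real (sqrt (pi/a)) * (of_real (r / sqrt (2*pi)) * (LBINT x. of_real (exp (- a * x\<^sup>2)) * wave (b * x)))"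
    by (metis (no_types, lifting) mult.assoc mult.commute mult_1 of_real_1 of_real_mult)
  also have "\<dots> = of_real (sqrt (pi/a)) * of_real (exp (- ((b/r)\<^sup>2) / 2))" unfolding * ..
  finally show "(LBINT x. of_real (exp (- a * x\<^sup>2)) * wave (b * x) :: complex)
       = of_real (sqrt (pi / a) * exp (- b\<^sup>2 / (4 * a)))"
    using r a by (simp add: power_divide)
qed

lemma norm_vec_sq: "(norm (x::real^'n))\<^sup>2 = (\<Sum>j\<in>UNIV. (x$j)\<^sup>2)"
  by (simp only: power2_norm_eq_inner) (simp add: inner_vec_def power2_eq_square)

lemma gaussian_fourier:
  fixes z :: "real^'n" assumes a: "a > 0"
  shows "integrable lborel (\<lambda>x::real^'n. of_real (exp (- a * (norm x)\<^sup>2)) * wave (z \<bullet> x) :: complex)"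
    and "(LBINT x. of_real (exp (- a * (norm x)\<^sup>2)) * wave (z \<bullet> x) :: complex)
       = of_real (sqrt (pi / a) ^ CARD('n) * exp (- (norm z)\<^sup>2 / (4 * a)))"
proof -
  have e: "(\<Prod>j\<in>UNIV. of_real (exp (- a * (x$j)\<^sup>2)) * wave (z$j * x$j)) =
     (of_real (exp (- a * (norm x)\<^sup>2)) * wave (z \<bullet> x) :: complex)" for x :: "real^'n"
    by (simp add: norm_vec_sq inner_vec_def prod.distrib sum_distrib_left exp_sum flip: sum_negf of_real_prod)
  note * = lborel_integral_prod_vec[where f="\<lambda>j x. of_real (exp (- a * x\<^sup>2)) * wave (z$j * x)",
    OF gaussian_fourier_1d(1)[OF a]]
  show "integrable lborel (\<lambda>x::real^'n. of_real (exp (- a * (norm x)\<^sup>2)) * wave (z \<bullet> x) :: complex)"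
    using *(1) unfolding e .
  show "(LBINT x. of_real (exp (- a * (norm x)\<^sup>2)) * wave (z \<bullet> x) :: complex)
       = of_real (sqrt (pi / a) ^ CARD('n) * exp (- (norm z)\<^sup>2 / (4 * a)))"
    using *(2) unfolding e gaussian_fourier_1d(2)[OF a]
    by (simp add: prod.distrib norm_vec_sq sum_divide_distrib exp_sum flip: sum_negf of_real_prod)
qed

lemma integrable_gaussian:
  assumes a: "a > 0"
  shows "integrable lborel (\<lambda>x::real^'n. exp (- a * (norm x)\<^sup>2))"
    and "(LBINT x. exp (- a * (norm (x::real^'n))\<^sup>2)) = sqrt (pi / a) ^ CARD('n)"
  using gaussian_fourier[OF a, of "0::real^'n"] integral_complex_of_real[of lborel "\<lambda>x::real^'n. exp (- a * (norm x)\<^sup>2)"]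
  by (auto simp del: of_real_power of_real_mult simp: complex_of_real_integrable_eq)

lemma power_le_fact_exp: "x \<ge> 0 \<Longrightarrow> x ^ k \<le> fact k * exp (x::real)"
proof -
  assume x: "x \<ge> 0"
  have "x ^ k /\<^sub>R fact k \<le> (\<Sum>n. x ^ n /\<^sub>R fact n)"
    using x sum_le_suminf[OF summable_exp_generic[of x], of "{k}"] by auto
  then show ?thesis by (simp add: exp_def divide_simps mult.commute)
qed

text \<open>
  Half of the Gaussian absorbs the power: \<open>|x|\<^sup>k \<le> k! e\<^bsup>|x|\<^esup>\<close>, and completing the square bounds
  \<open>|x|\<close> by \<open>a/2 |x|\<^sup>2\<close> plus a constant.
\<close>
lemma integrable_power_gaussian:
  assumes a: "a > 0"
  shows "integrable lborel (\<lambda>x::real^'n. (norm x) ^ k * exp (- a * (norm x)\<^sup>2))"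
proof (rule Bochner_Integration.integrable_bound)
  show "integrable lborel (\<lambda>x::real^'n. (fact k * exp (1/(2*a))) * exp (- (a/2) * (norm x)\<^sup>2))"
    using integrable_gaussian(1)[of "a/2"] a by simp
  show "AE x in lborel. norm ((norm (x::real^'n)) ^ k * exp (- a * (norm x)\<^sup>2)) \<le> norm ((fact k * exp (1/(2*a))) * exp (- (a/2) * (norm x)\<^sup>2))"
  proof (rule AE_I2)
    fix x :: "real^'n"
    have "0 \<le> (a * norm x - 1)\<^sup>2 / (2 * a)" using a by simp
    also have "\<dots> = a/2 * (norm x)\<^sup>2 - norm x + 1/(2*a)" using a by (simp add: power2_eq_square field_simps)
    finally have "exp (norm x) \<le> exp (1/(2*a) + a/2 * (norm x)\<^sup>2)" by simp
    with power_le_fact_exp[of "norm x" k]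
    have "norm x ^ k \<le> fact k * exp (1/(2*a) + a/2 * (norm x)\<^sup>2)"
      by (smt (verit) fact_ge_zero mult_left_mono norm_ge_zero)
    then have "norm x ^ k * exp (- a * (norm x)\<^sup>2) \<le> fact k * exp (1/(2*a) + a/2 * (norm x)\<^sup>2) * exp (- a * (norm x)\<^sup>2)"
      by (rule mult_right_mono) simp
    also have "\<dots> = (fact k * exp (1/(2*a))) * exp (- (a/2) * (norm x)\<^sup>2)"
      by (simp add: mult.assoc flip: exp_add)
    finally show "norm ((norm x) ^ k * exp (- a * (norm x)\<^sup>2)) \<le> norm ((fact k * exp (1/(2*a))) * exp (- (a/2) * (norm x)\<^sup>2))"
      by simp
  qed
qed auto

section \<open>The heat kernel on the integers\<close>

abbreviation circle_symbol_exp :: "real \<Rightarrow> real \<Rightarrow> real" where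
  "circle_symbol_exp u \<theta> \<equiv> exp (- u * (2 - 2 * cos \<theta>))"

text \<open>Up to the factor \<open>2\<pi>\<close>, the transition probability at time \<open>u\<close> of the continuous-time
  nearest-neighbour walk on the integers.\<close>
definition circle_heat :: "real \<Rightarrow> int \<Rightarrow> complex" where
  "circle_heat u n = (LINT \<theta>:{-pi..pi}|lborel. of_real (circle_symbol_exp u \<theta>) * wave (of_int n * \<theta>))"

lemma integrable_circle:
  assumes "continuous_on UNIV (f :: real \<Rightarrow> complex)"
  shows "set_integrable lborel {-pi..pi} f"
  by (rule borel_integrable_atLeastAtMost') (use assms continuous_on_subset in blast)

lemma periodic_integration_by_parts:
  fixes f f' :: "real \<Rightarrow> real" and n :: int
  assumes d: "\<And>\<theta>. (f has_real_derivative f' \<theta>) (at \<theta>)" and c: "continuous_on UNIV f'" and p: "f (-pi) = f pi"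
  shows "(LINT \<theta>:{-pi..pi}|lborel. of_real (f' \<theta>) * wave (of_int n * \<theta>))
    = - \<i> * of_int n * (LINT \<theta>:{-pi..pi}|lborel. of_real (f \<theta>) * wave (of_int n * \<theta>))"
proof -
  define E where "E = (\<lambda>\<theta>::real. wave (of_int n * \<theta>) :: complex)"
  have dE: "(E has_vector_derivative (\<i> * of_int n * E \<theta>)) (at \<theta>)" for \<theta>
  proof -
    have "((\<lambda>z::complex. exp (\<i> * (of_int n * z))) has_field_derivative (\<i> * of_int n * exp (\<i> * (of_int n * of_real \<theta>)))) (at (of_real \<theta>))"
      by (auto intro!: derivative_eq_intros)
    from has_vector_derivative_real_field[OF this] show ?thesis
      by (simp add: E_def o_def)
  qed
  have df: "((\<lambda>x. complex_of_real (f x)) has_vector_derivative of_real (f' \<theta>)) (at \<theta>)" for \<theta>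
    using d[of \<theta>] by (intro has_vector_derivative_of_real) (simp add: has_real_derivative_iff_has_vector_derivative)
  have D: "((\<lambda>x. of_real (f x) * E x) has_vector_derivative (of_real (f \<theta>) * (\<i> * of_int n * E \<theta>) + of_real (f' \<theta>) * E \<theta>)) (at \<theta>)" for \<theta>
    by (rule has_vector_derivative_mult[OF df dE])
  have cf: "continuous_on UNIV f"
    using d by (meson DERIV_isCont continuous_at_imp_continuous_on)
  have cE: "continuous_on UNIV E" unfolding E_def by (intro continuous_intros)
  have per: "E (-pi) = E pi"
    by (simp add: E_def complex_eq_iff Re_exp Im_exp sin_zero_iff_int2)
  have i1: "set_integrable lborel {-pi..pi} (\<lambda>\<theta>. of_real (f \<theta>) * E \<theta>)"
    and i2: "set_integrable lborel {-pi..pi} (\<lambda>\<theta>. of_real (f' \<theta>) * E \<theta>)"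
    by (intro integrable_circle continuous_intros cf c cE)+
  have "(LBINT \<theta>. indicator {-pi..pi} \<theta> *\<^sub>R (of_real (f \<theta>) * (\<i> * of_int n * E \<theta>) + of_real (f' \<theta>) * E \<theta>)) =
     of_real (f pi) * E pi - of_real (f (-pi)) * E (-pi)"
    by (rule integral_FTC_Icc)
      (auto intro!: has_vector_derivative_at_within[OF D] continuous_intros continuous_on_subset[OF cf] continuous_on_subset[OF cE] continuous_on_subset[OF c])
  also have "\<dots> = 0" using per p by simp
  finally have "(LINT \<theta>:{-pi..pi}|lborel. (\<i> * of_int n) * (of_real (f \<theta>) * E \<theta>) + of_real (f' \<theta>) * E \<theta>) = 0"
    by (simp add: set_lebesgue_integral_def mult_ac)
  then have "(\<i> * of_int n) * (LINT \<theta>:{-pi..pi}|lborel. of_real (f \<theta>) * E \<theta>) + (LINT \<theta>:{-pi..pi}|lborel. of_real (f' \<theta>) * E \<theta>) = 0"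
    using i1 i2 by (subst (asm) set_integral_add) auto
  then show ?thesis by (simp add: E_def add_eq_0_iff)
qed

text \<open>
  The \<open>k\<close>-th derivative of \<open>exp (-u (2 - 2 cos \<theta>))\<close> is this exponential times a factor of the shape
  below. The constraint \<open>2a \<le> b + k\<close> expresses parabolic scaling: each power of \<open>u\<close> is worth two
  derivatives, and each sine gains \<open>u\<^bsup>-1/2\<^esup>\<close> against the exponential. The condition \<open>1 \<le> a\<close> keeps
  track of the factor \<open>u\<close> that makes the derivatives small for short times.
\<close>
inductive heat_deriv_factor :: "nat \<Rightarrow> (real \<Rightarrow> real \<Rightarrow> real) \<Rightarrow> bool" where
  monomial: "1 \<le> a \<Longrightarrow> 2 * a \<le> b + k \<Longrightarrow> heat_deriv_factor k (\<lambda>u \<theta>. c * u ^ a * sin \<theta> ^ b * cos \<theta> ^ e)"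
| add: "heat_deriv_factor k f \<Longrightarrow> heat_deriv_factor k g \<Longrightarrow> heat_deriv_factor k (\<lambda>u \<theta>. f u \<theta> + g u \<theta>)"

lemma heat_deriv_factor_continuous: "heat_deriv_factor k f \<Longrightarrow> continuous_on UNIV (f u)"
  by (induction rule: heat_deriv_factor.induct) (auto intro!: continuous_intros)

lemma heat_deriv_factor_periodic: "heat_deriv_factor k f \<Longrightarrow> f u (-pi) = f u pi"
  by (induction rule: heat_deriv_factor.induct) auto

text \<open>
  Differentiating a sine lowers \<open>b\<close> by one, differentiating a cosine raises it, and differentiating
  the exponential raises \<open>a\<close> and \<open>b\<close> by one each; all three are compatible with raising \<open>k\<close>.
\<close>
lemma heat_deriv_factor_derivative:
  assumes "heat_deriv_factor k f"
  shows "\<exists>g. heat_deriv_factor (Suc k) g \<and>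
    (\<forall>u \<theta>. ((\<lambda>\<theta>. f u \<theta> * circle_symbol_exp u \<theta>) has_real_derivative g u \<theta> * circle_symbol_exp u \<theta>) (at \<theta>))"
  using assms
proof (induction rule: heat_deriv_factor.induct)
  case (monomial a b k c e)
  define g where "g = (\<lambda>u \<theta>::real. ((c * real b) * u ^ a * sin \<theta> ^ (b - 1) * cos \<theta> ^ (e + 1) +
     (- c * real e) * u ^ a * sin \<theta> ^ (b + 1) * cos \<theta> ^ (e - 1)) + (- 2 * c) * u ^ (a + 1) * sin \<theta> ^ (b + 1) * cos \<theta> ^ e)"
  have "heat_deriv_factor (Suc k) g" unfolding g_def
    using monomial by (intro heat_deriv_factor.intros) auto
  moreover have "((\<lambda>\<theta>. (c * u ^ a * sin \<theta> ^ b * cos \<theta> ^ e) * circle_symbol_exp u \<theta>) has_real_derivative g u \<theta> * circle_symbol_exp u \<theta>) (at \<theta>)" for u \<theta>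
    unfolding g_def by (rule derivative_eq_intros refl)+ (simp add: algebra_simps)
  ultimately show ?case by blast
next
  case (add k f g)
  then obtain f' g' where "heat_deriv_factor (Suc k) f'" "heat_deriv_factor (Suc k) g'"
    and 1: "\<And>u \<theta>. ((\<lambda>\<theta>. f u \<theta> * circle_symbol_exp u \<theta>) has_real_derivative f' u \<theta> * circle_symbol_exp u \<theta>) (at \<theta>)"
    and 2: "\<And>u \<theta>. ((\<lambda>\<theta>. g u \<theta> * circle_symbol_exp u \<theta>) has_real_derivative g' u \<theta> * circle_symbol_exp u \<theta>) (at \<theta>)"
    by auto
  then have "heat_deriv_factor (Suc k) (\<lambda>u \<theta>. f' u \<theta> + g' u \<theta>)" by (intro heat_deriv_factor.add)
  moreover have "((\<lambda>\<theta>. (f u \<theta> + g u \<theta>) * circle_symbol_exp u \<theta>) has_real_derivative (f' u \<theta> + g' u \<theta>) * circle_symbol_exp u \<theta>) (at \<theta>)" for u \<theta>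
    using DERIV_add[OF 1[of u \<theta>] 2[of u \<theta>]] by (simp add: algebra_simps)
  ultimately show ?case by (intro exI[of _ "\<lambda>u \<theta>. f' u \<theta> + g' u \<theta>"]) blast
qed

lemma circle_heat_deriv_factor:
  "\<exists>g. heat_deriv_factor (Suc k) g \<and> (\<forall>u n. (- \<i> * of_int n) ^ Suc k * circle_heat u n =
     (LINT \<theta>:{-pi..pi}|lborel. of_real (g u \<theta> * circle_symbol_exp u \<theta>) * wave (of_int n * \<theta>)))"
proof (induction k)
  case 0
  define g where "g = (\<lambda>u \<theta>::real. (-2) * u ^ 1 * sin \<theta> ^ 1 * cos \<theta> ^ 0)"
  have d: "((\<lambda>\<theta>. circle_symbol_exp u \<theta>) has_real_derivative g u \<theta> * circle_symbol_exp u \<theta>) (at \<theta>)" for u \<theta>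
    unfolding g_def by (rule derivative_eq_intros refl)+ (simp add: algebra_simps)
  have "heat_deriv_factor (Suc 0) g" unfolding g_def by (rule heat_deriv_factor.monomial) auto
  moreover have "(- \<i> * of_int n) ^ Suc 0 * circle_heat u n =
     (LINT \<theta>:{-pi..pi}|lborel. of_real (g u \<theta> * circle_symbol_exp u \<theta>) * wave (of_int n * \<theta>))" for u n
    by (subst periodic_integration_by_parts[OF d]) (auto simp: circle_heat_def g_def intro!: continuous_intros)
  ultimately show ?case by blast
next
  case (Suc k)
  then obtain g where g: "heat_deriv_factor (Suc k) g" 
     "\<And>u n. (- \<i> * of_int n) ^ Suc k * circle_heat u n =
     (LINT \<theta>:{-pi..pi}|lborel. of_real (g u \<theta> * circle_symbol_exp u \<theta>) * wave (of_int n * \<theta>))" by blast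
  from heat_deriv_factor_derivative[OF g(1)] obtain g' where g': "heat_deriv_factor (Suc (Suc k)) g'"
    "\<And>u \<theta>. ((\<lambda>\<theta>. g u \<theta> * circle_symbol_exp u \<theta>) has_real_derivative g' u \<theta> * circle_symbol_exp u \<theta>) (at \<theta>)" by blast
  have "(- \<i> * of_int n) ^ Suc (Suc k) * circle_heat u n =
     (LINT \<theta>:{-pi..pi}|lborel. of_real (g' u \<theta> * circle_symbol_exp u \<theta>) * wave (of_int n * \<theta>))" for u n
  proof -
    have "(- \<i> * of_int n) ^ Suc (Suc k) * circle_heat u n = (- \<i> * of_int n) * ((- \<i> * of_int n) ^ Suc k * circle_heat u n)"
      by simp
    also have "\<dots> = (LINT \<theta>:{-pi..pi}|lborel. of_real (g' u \<theta> * circle_symbol_exp u \<theta>) * wave (of_int n * \<theta>))"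
      unfolding g(2)
      by (rule periodic_integration_by_parts[OF g'(2), symmetric])
        (auto intro!: continuous_intros heat_deriv_factor_continuous[OF g'(1)] simp: heat_deriv_factor_periodic[OF g(1)])
    finally show ?thesis .
  qed
  with g'(1) show ?case by blast
qed

text \<open>
  Since \<open>sin\<^sup>2 \<theta> \<le> 2 - 2 cos \<theta>\<close>, the quantity \<open>(\<surd>u |sin \<theta>|)\<^sup>b\<close> is bounded against the
  exponential. For \<open>u \<ge> 1\<close> this trades the sines for powers of \<open>u\<close>; for \<open>u \<le> 1\<close> a single factor \<open>u\<close>
  is kept and the rest is bounded by one.
\<close>
lemma heat_deriv_factor_bound:
  assumes "heat_deriv_factor (2 * m) f" and m: "m \<ge> 1"
  shows "\<exists>C\<ge>0. \<forall>u>0. \<forall>\<theta>. \<bar>f u \<theta> * circle_symbol_exp u \<theta>\<bar> \<le> C * (u * (1 + u) ^ (m - 1))"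
  using assms(1)
proof (induction "2 * m" f rule: heat_deriv_factor.induct)
  case (monomial a b c e)
  define B where "B = fact b * exp (1/4 :: real)"
  have B1: "B \<ge> 1" unfolding B_def
    using mult_mono[of 1 "fact b" 1 "exp (1/4::real)"] by (simp add: fact_ge_1)
  have key: "(sqrt u * \<bar>sin \<theta>\<bar>) ^ b * circle_symbol_exp u \<theta> \<le> B" if u: "u > 0" for u \<theta>
  proof -
    define y where "y = sqrt (u * (2 - 2 * cos \<theta>))"
    have l: "u * (2 - 2 * cos \<theta>) \<ge> 0" using u by simp
    have y: "y \<ge> 0" "y\<^sup>2 = u * (2 - 2 * cos \<theta>)" using l by (auto simp: y_def)
    have "(sin \<theta>)\<^sup>2 = (1 - cos \<theta>) * (1 + cos \<theta>)"
      using sin_cos_squared_add[of \<theta>] by (simp add: algebra_simps power2_eq_square)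
    also have "\<dots> \<le> (1 - cos \<theta>) * 2" by (intro mult_left_mono) auto
    finally have "sqrt (u * (sin \<theta>)\<^sup>2) \<le> y" unfolding y_def using u by (intro real_sqrt_le_mono mult_left_mono) auto
    then have "sqrt u * \<bar>sin \<theta>\<bar> \<le> y" by (simp add: real_sqrt_mult)
    then have "(sqrt u * \<bar>sin \<theta>\<bar>) ^ b \<le> y ^ b" using u by (intro power_mono) auto
    also have "\<dots> \<le> fact b * exp y" using y by (intro power_le_fact_exp)
    also have "\<dots> \<le> fact b * exp (1/4 + y\<^sup>2)"
    proof -
      have "0 \<le> (y - 1/2)\<^sup>2" by simp
      then have "y \<le> 1/4 + y\<^sup>2" by (simp add: power2_eq_square algebra_simps)
      then show ?thesis by simp
    qed
    finally have "(sqrt u * \<bar>sin \<theta>\<bar>) ^ b * circle_symbol_exp u \<theta> \<le> fact b * exp (1/4 + y\<^sup>2) * circle_symbol_exp u \<theta>"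
      by (intro mult_right_mono) auto
    also have "\<dots> = B" unfolding B_def y(2) by (simp add: mult.assoc flip: exp_add)
    finally show ?thesis .
  qed
  have main: "u ^ a * \<bar>sin \<theta>\<bar> ^ b * circle_symbol_exp u \<theta> \<le> B * (u * (1 + u) ^ (m - 1))" if u: "u > 0" for u \<theta>
  proof (cases "u \<le> 1")
    case True
    have "u ^ a * (\<bar>sin \<theta>\<bar> ^ b * circle_symbol_exp u \<theta>) \<le> u ^ 1 * (1 * 1)"
      using u True monomial by (intro mult_mono power_decreasing power_le_one) (auto simp: mult_le_0_iff)
    also have "\<dots> \<le> B * (u * (1 + u) ^ (m - 1))"
      using u B1 one_le_power[of "1 + u" "m - 1"] mult_mono[of 1 B u "u * (1 + u) ^ (m - 1)"] by simp
    finally show ?thesis by (simp add: mult.assoc)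
  next
    case False
    \<comment> \<open>Writing \<open>u = w\<^sup>2\<close> avoids half-integer powers of \<open>u\<close>.\<close>
    define w where "w = sqrt u"
    have w: "w \<ge> 1" "u = w\<^sup>2" using False u by (auto simp: w_def)
    have "u ^ a * \<bar>sin \<theta>\<bar> ^ b = w ^ (2 * a) * \<bar>sin \<theta>\<bar> ^ b" by (simp add: w(2) power_mult)
    also have "\<dots> \<le> w ^ (b + 2 * m) * \<bar>sin \<theta>\<bar> ^ b"
      using w monomial by (intro mult_right_mono power_increasing) auto
    also have "\<dots> = u ^ m * (sqrt u * \<bar>sin \<theta>\<bar>) ^ b"
      by (simp add: w(2) power_add power_mult power_mult_distrib) (use w in simp)
    finally have "u ^ a * \<bar>sin \<theta>\<bar> ^ b * circle_symbol_exp u \<theta> \<le> u ^ m * (sqrt u * \<bar>sin \<theta>\<bar>) ^ b * circle_symbol_exp u \<theta>"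
      by (rule mult_right_mono) simp
    also have "\<dots> = u ^ m * ((sqrt u * \<bar>sin \<theta>\<bar>) ^ b * circle_symbol_exp u \<theta>)" by simp
    also have "\<dots> \<le> u ^ m * B" using key[OF u] u by (intro mult_left_mono) auto
    also have "u ^ m = u * u ^ (m - 1)" using m by (cases m) auto
    also have "u * u ^ (m - 1) * B \<le> u * (1 + u) ^ (m - 1) * B"
      using u B1 by (intro mult_right_mono mult_left_mono power_mono) auto
    finally show ?thesis by (simp add: mult_ac)
  qed
  show ?case
  proof (intro exI[of _ "\<bar>c\<bar> * B"] conjI allI impI)
    fix u \<theta> :: real assume u: "u > 0"
    have "\<bar>c * u ^ a * sin \<theta> ^ b * cos \<theta> ^ e * circle_symbol_exp u \<theta>\<bar> =
      \<bar>c\<bar> * \<bar>cos \<theta>\<bar> ^ e * (u ^ a * \<bar>sin \<theta>\<bar> ^ b * circle_symbol_exp u \<theta>)"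
      using u by (simp add: abs_mult power_abs)
    also have "\<dots> \<le> \<bar>c\<bar> * 1 * (B * (u * (1 + u) ^ (m - 1)))"
      using u by (intro mult_mono[OF _ main[OF u]] mult_left_mono power_le_one) auto
    finally show "\<bar>c * u ^ a * sin \<theta> ^ b * cos \<theta> ^ e * circle_symbol_exp u \<theta>\<bar> \<le> \<bar>c\<bar> * B * (u * (1 + u) ^ (m - 1))" by simp
  qed (use B1 in auto)
next
  case (add f g)
  then obtain C D where C: "C \<ge> 0" "D \<ge> 0" and 1: "\<And>u \<theta>. u > 0 \<Longrightarrow> \<bar>f u \<theta> * circle_symbol_exp u \<theta>\<bar> \<le> C * (u * (1 + u) ^ (m - 1))"
    and 2: "\<And>u \<theta>. u > 0 \<Longrightarrow> \<bar>g u \<theta> * circle_symbol_exp u \<theta>\<bar> \<le> D * (u * (1 + u) ^ (m - 1))" by blast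
  show ?case
  proof (intro exI[of _ "C + D"] conjI allI impI)
    fix u \<theta> :: real assume u: "u > 0"
    show "\<bar>(f u \<theta> + g u \<theta>) * circle_symbol_exp u \<theta>\<bar> \<le> (C + D) * (u * (1 + u) ^ (m - 1))"
      using 1[OF u, of \<theta>] 2[OF u, of \<theta>] by (simp only: distrib_right)
  qed (use C in auto)
qed

lemma norm_set_integral_circle_le:
  assumes c: "continuous_on UNIV (f :: real \<Rightarrow> complex)" and b: "\<And>\<theta>. norm (f \<theta>) \<le> B"
  shows "norm (LINT \<theta>:{-pi..pi}|lborel. f \<theta>) \<le> 2 * pi * B"
proof -
  have "norm (LINT \<theta>:{-pi..pi}|lborel. f \<theta>) \<le> (LINT \<theta>:{-pi..pi}|lborel. norm (f \<theta>))"
    by (rule set_integral_norm_bound[OF integrable_circle[OF c]])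
  also have "\<dots> \<le> (LINT \<theta>:{-pi..pi}|lborel. B)"
    by (rule set_integral_mono[OF set_integrable_norm[OF integrable_circle[OF c]]])
       (auto intro!: borel_integrable_atLeastAtMost' simp: b)
  also have "\<dots> = 2 * pi * B" by (simp add: set_lebesgue_integral_def)
  finally show ?thesis .
qed

text \<open>
  Integrating by parts \<open>2m\<close> times; the bound has the order of the \<open>2m\<close>-th moment of the walk at
  time \<open>u\<close>, including its linear vanishing as \<open>u\<close> tends to zero.
\<close>
lemma circle_heat_decay:
  assumes m: "m \<ge> 1"
  shows "\<exists>C\<ge>0. \<forall>u>0. \<forall>n. \<bar>of_int n\<bar> ^ (2 * m) * norm (circle_heat u n) \<le> C * (u * (1 + u) ^ (m - 1))"
proof -
  obtain k where k: "2 * m = Suc k" using m by (cases "2 * m") auto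
  from circle_heat_deriv_factor[of k] obtain g where g: "heat_deriv_factor (2 * m) g"
    and eq: "\<And>u n. (- \<i> * of_int n) ^ (2 * m) * circle_heat u n =
     (LINT \<theta>:{-pi..pi}|lborel. of_real (g u \<theta> * circle_symbol_exp u \<theta>) * wave (of_int n * \<theta>))"
    unfolding k by blast
  from heat_deriv_factor_bound[OF g m] obtain C where C: "C \<ge> 0"
    "\<And>u \<theta>. u > 0 \<Longrightarrow> \<bar>g u \<theta> * circle_symbol_exp u \<theta>\<bar> \<le> C * (u * (1 + u) ^ (m - 1))" by blast
  have "\<bar>of_int n\<bar> ^ (2 * m) * norm (circle_heat u n) \<le> 2 * pi * (C * (u * (1 + u) ^ (m - 1)))" if u: "u > 0" for u n
  proof -
    have "\<bar>of_int n\<bar> ^ (2 * m) * norm (circle_heat u n) = norm ((- \<i> * of_int n) ^ (2 * m) * circle_heat u n)"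
      by (simp add: norm_mult norm_power)
    also have "\<dots> \<le> 2 * pi * (C * (u * (1 + u) ^ (m - 1)))"
      unfolding eq using C(2)[OF u]
      by (intro norm_set_integral_circle_le continuous_intros heat_deriv_factor_continuous[OF g]) (auto simp: norm_mult abs_mult)
    finally show ?thesis .
  qed
  then show ?thesis using C(1) by (intro exI[of _ "2 * pi * C"]) (auto simp: mult.assoc)
qed

lemma norm_circle_heat_le: "u \<ge> 0 \<Longrightarrow> norm (circle_heat u n) \<le> 2 * pi"
  unfolding circle_heat_def
  by (rule order_trans[OF norm_set_integral_circle_le[where B=1]])
    (auto intro!: continuous_intros simp: norm_mult)

lemma circle_heat_0: "n \<noteq> 0 \<Longrightarrow> circle_heat 0 n = 0"
  using periodic_integration_by_parts[of "\<lambda>_. 1" "\<lambda>_. 0" n] by (simp add: circle_heat_def)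

lemma circle_heat_0_0: "circle_heat 0 0 = 2 * pi"
  by (simp add: circle_heat_def set_lebesgue_integral_def scaleR_conv_of_real)

section \<open>Fourier coefficients on the torus\<close>

abbreviation lnorm :: "int^'n \<Rightarrow> real" where
  "lnorm x \<equiv> norm (lattice_embed x)"

abbreviation period_box :: "(real^'n) set" where
  "period_box \<equiv> cbox (\<chi> i. - pi) (\<chi> i. pi)"

text \<open>
  Fourier coefficients without the factor \<open>(2\<pi>)\<^bsup>-d\<^esup>\<close>.
\<close>
definition torus_integral :: "(real^'n \<Rightarrow> complex) \<Rightarrow> int^'n \<Rightarrow> complex" where
  "torus_integral f x = (LINT \<xi>:period_box|lborel. f \<xi> * wave (lattice_embed x \<bullet> \<xi>))"

definition lattice_heat :: "real \<Rightarrow> int^'n \<Rightarrow> complex" where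
  "lattice_heat u = torus_integral (\<lambda>\<xi>. of_real (exp (- u * laplace_symbol \<xi>)))"

text \<open>The heat kernel at \<open>x\<close> in the diffusive scaling in which it has a limit as \<open>|x|\<close> grows.\<close>
abbreviation scaled_heat :: "real \<Rightarrow> int^'n \<Rightarrow> complex" where
  "scaled_heat \<tau> x \<equiv> of_real (lnorm x ^ CARD('n)) * lattice_heat ((lnorm x)\<^sup>2 * \<tau>) x"

abbreviation symbol_coeff :: "real \<Rightarrow> int^'n \<Rightarrow> complex" where
  "symbol_coeff s \<equiv> torus_integral (\<lambda>\<xi>. of_real (laplace_symbol \<xi> powr s))"

text \<open>
  The symbol is a sum over the coordinates and the box is a product.
\<close>
lemma lattice_heat_eq_prod: "lattice_heat u x = (\<Prod>j\<in>UNIV. circle_heat u (x $ j))"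
proof -
  define f :: "'a \<Rightarrow> real \<Rightarrow> complex" where "f j \<theta> = indicator {-pi..pi} \<theta> *\<^sub>R (of_real (circle_symbol_exp u \<theta>) * wave (of_int (x$j) * \<theta>))" for j \<theta>
  have i: "integrable lborel (f j)" for j
    unfolding f_def[abs_def] set_integrable_def[symmetric]
    by (intro integrable_circle continuous_intros)
  have box: "indicator (period_box) \<xi> = (\<Prod>j\<in>UNIV. indicator {-pi..pi} (\<xi> $ j) :: complex)" for \<xi> :: "real^'a"
    by (auto simp: mem_box_cart indicator_def)
  have e: "(\<Prod>j\<in>UNIV. f j (\<xi> $ j)) = indicator period_box \<xi> *\<^sub>R (of_real (exp (- u * laplace_symbol \<xi>)) * wave (lattice_embed x \<bullet> \<xi>))" for \<xi> :: "real^'a"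
    unfolding scaleR_conv_of_real of_real_indicator box
    by (simp add: f_def scaleR_conv_of_real of_real_indicator prod.distrib laplace_symbol_def lattice_embed_def inner_vec_def sum_distrib_left exp_sum exp_of_real flip: sum_negf)
  show ?thesis
    using lborel_integral_prod_vec(2)[of f, OF i] unfolding e
    by (simp add: lattice_heat_def torus_integral_def set_lebesgue_integral_def circle_heat_def f_def)
qed

lemma norm_lattice_embed_le_component:
  fixes x :: "int^'n"
  shows "\<exists>j. lnorm x \<le> real CARD('n) * \<bar>of_int (x $ j)\<bar>"
proof -
  define M where "M = Max (range (\<lambda>j. \<bar>lattice_embed x $ j\<bar>))"
  have "M \<in> range (\<lambda>j. \<bar>lattice_embed x $ j\<bar>)" unfolding M_def by (rule Max_in) auto
  then obtain j where j: "M = \<bar>lattice_embed x $ j\<bar>" by auto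
  have "lnorm x \<le> (\<Sum>i\<in>UNIV. \<bar>lattice_embed x $ i\<bar>)" by (rule norm_le_l1_cart)
  also have "\<dots> \<le> (\<Sum>i\<in>(UNIV::'n set). M)" unfolding M_def by (intro sum_mono Max_ge) auto
  finally show ?thesis using j by (auto simp: lattice_embed_def)
qed

text \<open>
  Some coordinate of \<open>x\<close> has size at least \<open>|x|/d\<close>. The decay in that coordinate suffices; the
  remaining factors of the product are only bounded.
\<close>
lemma lattice_heat_decay:
  assumes m: "m \<ge> 1"
  shows "\<exists>C\<ge>0. \<forall>u>0. \<forall>x::int^'n. lnorm x ^ (2 * m) * norm (lattice_heat u x) \<le> C * (u * (1 + u) ^ (m - 1))"
proof -
  from circle_heat_decay[OF m] obtain C where C: "C \<ge> 0"
    "\<And>u n. u > 0 \<Longrightarrow> \<bar>of_int n\<bar> ^ (2 * m) * norm (circle_heat u n) \<le> C * (u * (1 + u) ^ (m - 1))" by blast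
  define D where "D = real CARD('n) ^ (2 * m) * C * (2 * pi) ^ (CARD('n) - 1)"
  have "lnorm x ^ (2 * m) * norm (lattice_heat u x) \<le> D * (u * (1 + u) ^ (m - 1))" if u: "u > 0" for u and x :: "int^'n"
  proof -
    obtain j where j: "lnorm x \<le> real CARD('n) * \<bar>of_int (x $ j)\<bar>"
      using norm_lattice_embed_le_component by blast
    have "norm (lattice_heat u x) = norm (circle_heat u (x $ j)) * (\<Prod>i\<in>UNIV - {j}. norm (circle_heat u (x $ i)))"
      unfolding lattice_heat_eq_prod by (subst prod.remove[of _ j]) (auto simp: norm_mult prod_norm)
    also have "\<dots> \<le> norm (circle_heat u (x $ j)) * (\<Prod>i\<in>UNIV - {j}. 2 * pi)"
      using u by (intro mult_left_mono prod_mono) (auto intro!: norm_circle_heat_le)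
    finally have h: "norm (lattice_heat u x) \<le> norm (circle_heat u (x $ j)) * (2 * pi) ^ (CARD('n) - 1)" by simp
    have "lnorm x ^ (2 * m) * norm (lattice_heat u x) \<le> (real CARD('n) * \<bar>of_int (x $ j)\<bar>) ^ (2 * m) * (norm (circle_heat u (x $ j)) * (2 * pi) ^ (CARD('n) - 1))"
      by (intro mult_mono power_mono j h) auto
    also have "\<dots> = real CARD('n) ^ (2 * m) * (2 * pi) ^ (CARD('n) - 1) * (\<bar>of_int (x $ j)\<bar> ^ (2 * m) * norm (circle_heat u (x $ j)))"
      by (simp add: power_mult_distrib mult_ac)
    also have "\<dots> \<le> real CARD('n) ^ (2 * m) * (2 * pi) ^ (CARD('n) - 1) * (C * (u * (1 + u) ^ (m - 1)))"
      by (intro mult_left_mono C(2)[OF u]) auto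
    finally show ?thesis by (simp add: D_def mult_ac)
  qed
  then show ?thesis using C(1) by (intro exI[of _ D]) (auto simp: D_def)
qed

lemma torus_integral_one: "torus_integral (\<lambda>_. 1) (x :: int^'n) = (if x = 0 then of_real (2 * pi) ^ CARD('n) else 0)"
proof -
  have "torus_integral (\<lambda>_. 1) x = lattice_heat 0 x" by (simp add: lattice_heat_def)
  also have "\<dots> = (if x = 0 then of_real (2 * pi) ^ CARD('n) else 0)"
  proof (cases "x = 0")
    case True
    then show ?thesis by (simp add: lattice_heat_eq_prod circle_heat_0_0)
  next
    case False
    then obtain j where "x $ j \<noteq> 0" by (auto simp: vec_eq_iff)
    then show ?thesis using False by (auto simp: lattice_heat_eq_prod intro!: prod_zero bexI[of _ j] circle_heat_0)
  qed
  finally show ?thesis .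
qed

section \<open>Subordination\<close>
lemma set_integrable_lborel_nonneg:
  fixes f :: "real \<Rightarrow> real"
  assumes "f integrable_on A" "\<And>x. x \<in> A \<Longrightarrow> 0 \<le> f x" "A \<in> sets borel" "f \<in> borel_measurable borel"
  shows "set_integrable lborel A f"
proof -
  have "set_integrable lebesgue A f" using nonnegative_absolutely_integrable_1[OF assms(1,2)] by simp
  then show ?thesis unfolding set_integrable_def using assms(3,4)
    by (subst (asm) integrable_completion) auto
qed

text \<open>
  The value zero off the positive half-line lets integrals over \<open>u > 0\<close> be written as integrals
  over the whole line.
\<close>
definition levy_density :: "real \<Rightarrow> real \<Rightarrow> real" where
  "levy_density s u = (if u > 0 then u powr (- 1 - s) else 0)"

lemma levy_density_measurable [measurable]: "levy_density s \<in> borel_measurable borel"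
  unfolding levy_density_def[abs_def] by measurable

lemma levy_density_nonneg: "levy_density s u \<ge> 0"
  by (simp add: levy_density_def)

lemma integrable_levy_density:
  assumes s: "0 < s" "s < \<theta>"
  shows "integrable lborel (\<lambda>u. min 1 (u powr \<theta>) * levy_density s u)"
proof -
  have 1: "set_integrable lborel {0<..1} (\<lambda>u::real. u powr (\<theta> - 1 - s))"
    by (rule set_integrable_lborel_nonneg) (use s in \<open>auto intro!: integrable_on_powr_from_0'\<close>)
  have "(\<lambda>u::real. u powr (- 1 - s)) integrable_on {1..}"
    using has_integral_powr_to_inf[of "- 1 - s" 1] s by (auto simp: integrable_on_def)
  then have 2: "set_integrable lborel {1..} (\<lambda>u::real. u powr (- 1 - s))"
    by (rule set_integrable_lborel_nonneg) auto
  have "integrable lborel (\<lambda>u::real. indicator {0<..1} u * u powr (\<theta> - 1 - s) + indicator {1..} u * u powr (- 1 - s))"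
    using 1 2 unfolding set_integrable_def by (intro Bochner_Integration.integrable_add) simp_all
  then show ?thesis
  proof (rule Bochner_Integration.integrable_bound)
    have "norm (min 1 (u powr \<theta>) * levy_density s u) \<le> indicator {0<..1} u * u powr (\<theta> - 1 - s) + indicator {1..} u * u powr (- 1 - s)" for u
    proof (cases "u > 0")
      case u: True
      have e: "u powr \<theta> * u powr (- 1 - s) = u powr (\<theta> - 1 - s)" by (simp add: algebra_simps flip: powr_add)
      show ?thesis
      proof (cases "u \<le> 1")
        case True
        have "norm (min 1 (u powr \<theta>) * levy_density s u) = min 1 (u powr \<theta>) * u powr (- 1 - s)"
          using u by (simp add: levy_density_def)
        also have "\<dots> \<le> u powr \<theta> * u powr (- 1 - s)" by (intro mult_right_mono) auto
        also have "\<dots> \<le> indicator {0<..1} u * u powr (\<theta> - 1 - s) + indicator {1..} u * u powr (- 1 - s)"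
          unfolding e using u True by (simp add: indicator_def)
        finally show ?thesis .
      next
        case False
        have "norm (min 1 (u powr \<theta>) * levy_density s u) = min 1 (u powr \<theta>) * u powr (- 1 - s)"
          using u by (simp add: levy_density_def)
        also have "\<dots> \<le> 1 * u powr (- 1 - s)" by (intro mult_right_mono) auto
        finally show ?thesis using False by (simp add: indicator_def)
      qed
    qed (auto simp: levy_density_def)
    then show "AE u in lborel. norm (min 1 (u powr \<theta>) * levy_density s u) \<le> norm (indicator {0<..1} u * u powr (\<theta> - 1 - s) + indicator {1..} u * u powr (- 1 - s))"
      by (intro AE_I2) (smt (verit) real_norm_def norm_ge_zero)
  qed simp
qed

lemma one_minus_exp_le: "0 \<le> a \<Longrightarrow> 0 \<le> u \<Longrightarrow> 1 - exp (- (u * a)) \<le> (1 + a) * min 1 (u::real)"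
proof -
  assume a: "0 \<le> a" and u: "0 \<le> u"
  have 1: "1 - exp (- (u * a)) \<le> u * a" using exp_ge_add_one_self[of "- (u * a)"] by linarith
  have 2: "u * a \<le> (1 + a) * u" using u a by (simp add: algebra_simps)
  have 3: "1 - exp (- (u * a)) \<le> (1 + a) * 1" using a by (smt (verit) exp_gt_zero)
  show ?thesis using 1 2 3 by (auto simp: min_def)
qed

lemma levy_abs_bound:
  assumes a: "0 \<le> a"
  shows "\<bar>(1 - exp (- (u * a))) * levy_density s u\<bar> \<le> (1 + a) * (min 1 (u powr 1) * levy_density s u)"
proof (cases "u > 0")
  case True
  then have "\<bar>(1 - exp (- (u * a))) * levy_density s u\<bar> = (1 - exp (- (u * a))) * levy_density s u"
    using a by (intro abs_of_nonneg mult_nonneg_nonneg levy_density_nonneg) auto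
  also have "\<dots> \<le> ((1 + a) * min 1 u) * levy_density s u"
    using True a by (intro mult_right_mono one_minus_exp_le levy_density_nonneg) auto
  finally show ?thesis using True by simp
qed (simp add: levy_density_def)

definition levy_const :: "real \<Rightarrow> real" where
  "levy_const s = (LBINT u. (1 - exp (- u)) * levy_density s u)"

lemma integrable_levy:
  assumes "0 < s" "s < 1" "0 \<le> a"
  shows "integrable lborel (\<lambda>u. (1 - exp (- (u * a))) * levy_density s u)"
proof (rule Bochner_Integration.integrable_bound)
  show "integrable lborel (\<lambda>u. (1 + a) * (min 1 (u powr 1) * levy_density s u))"
    by (intro integrable_mult_right integrable_levy_density) (use assms in auto)
  show "AE u in lborel. norm ((1 - exp (- (u * a))) * levy_density s u) \<le> norm ((1 + a) * (min 1 (u powr 1) * levy_density s u))"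
    using levy_abs_bound[OF assms(3)] by (intro AE_I2) (smt (verit) real_norm_def norm_ge_zero)
qed auto

lemma levy_const_pos:
  assumes "0 < s" "s < 1"
  shows "levy_const s > 0"
proof -
  have nn: "(1 - exp (- u)) * levy_density s u \<ge> 0" for u
    by (cases "u > 0") (auto simp: levy_density_def)
  have i: "integrable lborel (\<lambda>u. (1 - exp (- u)) * levy_density s u)"
    using integrable_levy[OF assms, of 1] by simp
  have "levy_const s \<noteq> 0"
  proof
    assume "levy_const s = 0"
    then have "AE u in lborel. (1 - exp (- u)) * levy_density s u = 0"
      unfolding levy_const_def using integral_nonneg_eq_0_iff_AE[OF i] nn by auto
    then have "AE u in lborel. u \<notin> {0<..<1::real}"
      by eventually_elim (auto simp: levy_density_def)
    then have "emeasure lborel {0<..<1::real} = 0"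
      by (subst (asm) AE_iff_measurable[where N="{0<..<1}"]) auto
    then show False by simp
  qed
  moreover have "levy_const s \<ge> 0" unfolding levy_const_def using nn by (intro Bochner_Integration.integral_nonneg)
  ultimately show ?thesis by linarith
qed

lemma levy_density_scale:
  assumes "c > 0" shows "levy_density s (c * u) = c powr (- 1 - s) * levy_density s u"
  using assms by (auto simp: levy_density_def powr_mult zero_less_mult_iff)

text \<open>
  Both sides are homogeneous of degree \<open>s\<close> in \<open>a\<close>: substitute \<open>u \<rightarrow> a u\<close>.
\<close>
lemma levy_integral_eq_powr:
  assumes "0 < s" "s < 1" "0 \<le> a"
  shows "(LBINT u. (1 - exp (- (u * a))) * levy_density s u) = levy_const s * a powr s"
proof (cases "a = 0")
  case False
  then have a: "a > 0" using assms by simp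
  have "levy_const s = a * (LBINT u. (1 - exp (- (a * u))) * levy_density s (a * u))"
    unfolding levy_const_def using lborel_integral_real_affine[of a "\<lambda>u. (1 - exp (- u)) * levy_density s u" 0] a by simp
  also have "\<dots> = a * a powr (- 1 - s) * (LBINT u. (1 - exp (- (u * a))) * levy_density s u)"
    unfolding levy_density_scale[OF a] integral_mult_right_zero[symmetric] mult.assoc
    by (simp add: mult_ac)
  also have "a * a powr (- 1 - s) = a powr (- s)"
    using powr_add[of a 1 "- 1 - s"] a by simp
  finally have "levy_const s * a powr s = (a powr (-s) * a powr s) * (LBINT u. (1 - exp (- (u * a))) * levy_density s u)"
    by simp
  also have "a powr (-s) * a powr s = 1" using a by (simp flip: powr_add)
  finally show ?thesis by simp
qed simp

lemma integrable_pair_product: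
  fixes f :: "'a \<Rightarrow> real" and g :: "'b \<Rightarrow> real"
  assumes "sigma_finite_measure M" "sigma_finite_measure N"
  assumes f: "integrable M f" and g: "integrable N g"
  shows "integrable (M \<Otimes>\<^sub>M N) (\<lambda>(x, y). f x * g y)"
proof -
  interpret pair_sigma_finite M N using assms(1,2) by (simp add: pair_sigma_finite_def)
  have [measurable]: "f \<in> borel_measurable M" "g \<in> borel_measurable N" using f g by auto
  show ?thesis
  proof (rule Fubini_integrable)
    show "integrable M (\<lambda>x. LINT y|N. norm (case (x, y) of (x, y) \<Rightarrow> f x * g y))"
      using f by (simp add: abs_mult)
    show "AE x in M. integrable N (\<lambda>y. case (x, y) of (x, y) \<Rightarrow> f x * g y)"
      using g by simp
  qed measurable
qed

text \<open>
  The link between fractional powers and heat flow, used on the torus with the lattice symbol and on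
  Euclidean space with \<open>|\<eta>|\<^sup>2\<close>. Fubini applies because \<open>1 - e\<^bsup>-uP\<^esup> \<le> (1 + P) min 1 u\<close> and
  \<open>min 1 u\<close> is integrable against the density \<open>u\<^bsup>-1-s\<^esup>\<close>.
\<close>
lemma powr_integral_subordination:
  fixes P :: "'a::euclidean_space \<Rightarrow> real" and g :: "'a \<Rightarrow> complex"
  assumes s: "0 < s" "s < 1" and [measurable]: "P \<in> borel_measurable borel" and P: "\<And>x. P x \<ge> 0"
    and g: "integrable lborel g" and Pg: "integrable lborel (\<lambda>x. P x * norm (g x))"
  shows "(LBINT x. of_real (P x powr s) * g x) =
    of_real (1 / levy_const s) * (LBINT u. of_real (levy_density s u) * (LBINT x. of_real (1 - exp (- (u * P x))) * g x))"
proof -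
  have [measurable]: "g \<in> borel_measurable borel" using g by auto
  define F where "F u x = complex_of_real ((1 - exp (- (u * P x))) * levy_density s u) * g x" for u x
  have meas: "case_prod F \<in> borel_measurable (lborel \<Otimes>\<^sub>M lborel)"
    unfolding F_def by measurable
  have "integrable (lborel \<Otimes>\<^sub>M lborel) (\<lambda>(u, x). (min 1 (u powr 1) * levy_density s u) * (norm (g x) + P x * norm (g x)))"
    by (intro integrable_pair_product integrable_levy_density Bochner_Integration.integrable_add integrable_norm g Pg sigma_finite_lborel)
       (use s in auto)
  then have int: "integrable (lborel \<Otimes>\<^sub>M lborel) (case_prod F)"
  proof (rule Bochner_Integration.integrable_bound[OF _ meas], intro AE_I2, clarify)
    fix u :: real and x :: 'a
    have "norm (F u x) = \<bar>(1 - exp (- (u * P x))) * levy_density s u\<bar> * norm (g x)"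
      unfolding F_def by (simp only: norm_mult norm_of_real)
    also have "\<dots> \<le> ((1 + P x) * (min 1 (u powr 1) * levy_density s u)) * norm (g x)"
      by (intro mult_right_mono levy_abs_bound P) auto
    also have "\<dots> = (min 1 (u powr 1) * levy_density s u) * (norm (g x) + P x * norm (g x))"
      by (simp add: algebra_simps)
    finally show "norm (F u x) \<le> norm ((min 1 (u powr 1) * levy_density s u) * (norm (g x) + P x * norm (g x)))"
      by (smt (verit) real_norm_def)
  qed
  have inner: "(LBINT u. F u x) = of_real (levy_const s) * (of_real (P x powr s) * g x)" for x
  proof -
    have "(LBINT u. F u x) = (LBINT u. complex_of_real ((1 - exp (- (u * P x))) * levy_density s u)) * g x"
      unfolding F_def by (rule integral_mult_left_zero)
    also have "\<dots> = of_real (levy_const s * P x powr s) * g x"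
      unfolding integral_complex_of_real levy_integral_eq_powr[OF s P] ..
    finally show ?thesis by simp
  qed
  have "(LBINT x. (LBINT u. F u x)) = (LBINT u. (LBINT x. F u x))"
    by (rule lborel_pair.Fubini_integral[OF int])
  then have "of_real (levy_const s) * (LBINT x. of_real (P x powr s) * g x) = (LBINT u. (LBINT x. F u x))"
    unfolding inner by simp
  also have "\<dots> = (LBINT u. of_real (levy_density s u) * (LBINT x. of_real (1 - exp (- (u * P x))) * g x))"
    unfolding F_def by (simp add: mult_ac flip: integral_mult_right_zero)
  finally show ?thesis using levy_const_pos[OF s] by (simp add: field_simps)
qed

section \<open>The local limit theorem\<close>
lemma cos_ge_quadratic: "cos x \<ge> 1 - x\<^sup>2 / 2" for x :: real
proof -
  obtain t where t: "cos x = (\<Sum>m<2. cos_coeff m * x ^ m) + (cos (t + 1/2 * real 2 * pi) / fact 2) * x ^ 2"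
    using Maclaurin_cos_expansion[of x 2] by auto
  have "cos (t + pi) * x\<^sup>2 \<ge> (-1) * x\<^sup>2" by (intro mult_right_mono) auto
  then show ?thesis using t by (simp add: cos_coeff_def numeral_2_eq_2)
qed

lemma cos_le_quartic: "cos x \<le> 1 - x\<^sup>2 / 2 + x ^ 4 / 24" for x :: real
proof -
  obtain t where t: "cos x = (\<Sum>m<4. cos_coeff m * x ^ m) + (cos (t + 1/2 * real 4 * pi) / fact 4) * x ^ 4"
    using Maclaurin_cos_expansion[of x 4] by auto
  have "cos (t + 2 * pi) * x ^ 4 \<le> 1 * x ^ 4" by (intro mult_right_mono) auto
  then have "(cos (t + 1/2 * real 4 * pi) / fact 4) * x ^ 4 \<le> x ^ 4 / 24" by (simp add: fact_numeral)
  moreover have "(\<Sum>m<4. cos_coeff m * x ^ m) = 1 - x\<^sup>2 / 2"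
  proof -
    have "{..<4} = {0, 1, 2, 3 :: nat}" by auto
    then show ?thesis by (simp add: cos_coeff_def fact_numeral)
  qed
  ultimately show ?thesis using t by linarith
qed

lemma laplace_symbol_nonneg: "laplace_symbol \<xi> \<ge> 0"
  unfolding laplace_symbol_def by (intro sum_nonneg) simp

lemma laplace_symbol_le: "laplace_symbol (\<xi> :: real^'n) \<le> 4 * real CARD('n)"
proof -
  have "laplace_symbol \<xi> \<le> (\<Sum>j\<in>(UNIV :: 'n set). 4)"
    unfolding laplace_symbol_def
  proof (rule sum_mono)
    fix j :: 'n show "2 - 2 * cos (\<xi> $ j) \<le> 4" using cos_ge_minus_one[of "\<xi> $ j"] by linarith
  qed
  then show ?thesis by simp
qed

lemma laplace_symbol_measurable [measurable]: "laplace_symbol \<in> borel_measurable (borel :: (real^'n) measure)"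
  unfolding laplace_symbol_def[abs_def] by (intro borel_measurable_continuous_onI continuous_intros)

lemma laplace_symbol_le_norm: "laplace_symbol \<xi> \<le> (norm \<xi>)\<^sup>2"
  unfolding laplace_symbol_def norm_vec_sq
proof (rule sum_mono)
  fix j show "2 - 2 * cos (\<xi> $ j) \<le> (\<xi> $ j)\<^sup>2" using cos_ge_quadratic[of "\<xi> $ j"] by linarith
qed

lemma laplace_symbol_ge_norm_diff: "(norm \<xi>)\<^sup>2 - laplace_symbol \<xi> \<le> norm \<xi> ^ 4"
proof -
  have "(norm \<xi>)\<^sup>2 - laplace_symbol \<xi> = (\<Sum>j\<in>UNIV. (\<xi>$j)\<^sup>2 - (2 - 2 * cos (\<xi> $ j)))"
    unfolding laplace_symbol_def norm_vec_sq by (rule sum_subtractf[symmetric])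
  also have "\<dots> \<le> (\<Sum>j\<in>UNIV. (norm \<xi>)\<^sup>2 * (\<xi>$j)\<^sup>2)"
  proof (rule sum_mono)
    fix j
    have "(\<xi>$j)\<^sup>2 \<le> (norm \<xi>)\<^sup>2" using component_le_norm_cart[of \<xi> j] abs_le_square_iff[of "\<xi>$j" "norm \<xi>"] by simp
    then have "(\<xi>$j)\<^sup>2 * (\<xi>$j)\<^sup>2 \<le> (norm \<xi>)\<^sup>2 * (\<xi>$j)\<^sup>2" by (intro mult_right_mono) auto
    moreover have "(\<xi>$j)^4 = (\<xi>$j)\<^sup>2 * (\<xi>$j)\<^sup>2" by (simp flip: power_add)
    moreover have "0 \<le> (\<xi>$j)^4" by simp
    ultimately show "(\<xi>$j)\<^sup>2 - (2 - 2 * cos (\<xi> $ j)) \<le> (norm \<xi>)\<^sup>2 * (\<xi>$j)\<^sup>2"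
      using cos_le_quartic[of "\<xi> $ j"] by linarith
  qed
  also have "\<dots> = (norm \<xi>)\<^sup>2 * (norm \<xi>)\<^sup>2" by (simp add: norm_vec_sq sum_distrib_left)
  finally show ?thesis by (simp flip: power_add)
qed

text \<open>
  On the box \<open>\<theta>\<^sup>2 \<le> \<pi>\<^sup>2 < 10\<close>, so the quartic Taylor bound leaves at least
  \<open>\<theta>\<^sup>2 (1 - 10/12) = \<theta>\<^sup>2/6\<close>.
\<close>
lemma laplace_symbol_ge:
  assumes "\<xi> \<in> period_box" shows "laplace_symbol \<xi> \<ge> (norm \<xi>)\<^sup>2 / 6"
  unfolding laplace_symbol_def norm_vec_sq sum_divide_distrib
proof (rule sum_mono)
  fix j
  have "\<bar>\<xi> $ j\<bar> \<le> pi" using assms by (auto simp: mem_box_cart abs_le_iff) (smt (verit))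
  also have "\<dots> \<le> 3.15" using pi_approx by simp
  finally have "(\<xi> $ j)\<^sup>2 \<le> 3.15\<^sup>2" using abs_le_square_iff[of "\<xi>$j" "3.15"] by simp
  also have "\<dots> \<le> 10" by (simp add: power2_eq_square)
  finally have "(\<xi>$j)\<^sup>2 * (\<xi>$j)\<^sup>2 \<le> 10 * (\<xi>$j)\<^sup>2" by (intro mult_right_mono) auto
  moreover have "(\<xi>$j)^4 = (\<xi>$j)\<^sup>2 * (\<xi>$j)\<^sup>2" by (simp flip: power_add)
  ultimately show "(\<xi> $ j)\<^sup>2 / 6 \<le> 2 - 2 * cos (\<xi> $ j)" using cos_le_quartic[of "\<xi> $ j"] by linarith
qed

text \<open>
  \<open>(2\<pi>)\<^sup>d\<close> times the Euclidean heat kernel at time \<open>\<tau>\<close> and a point of norm one.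
\<close>
definition heat_profile :: "'n::finite itself \<Rightarrow> real \<Rightarrow> real" where
  "heat_profile _ \<tau> = sqrt (pi / \<tau>) ^ CARD('n) * exp (- 1 / (4 * \<tau>))"

lemma exp_minus_diff_le: "0 \<le> a \<Longrightarrow> a \<le> b \<Longrightarrow> exp (- a) - exp (- b) \<le> (b - a) * exp (- a :: real)"
proof -
  have "1 + (a - b) \<le> exp (a - b)" by (rule exp_ge_add_one_self)
  then have "(1 - exp (a - b)) * exp (-a) \<le> (b - a) * exp (-a)" by (intro mult_right_mono) (linarith, simp)
  also have "(1 - exp (a - b)) * exp (-a) = exp (-a) - exp (-b)" by (simp add: left_diff_distrib flip: exp_add)
  finally show ?thesis .
qed

text \<open>
  Inside the box the exponents differ by at most \<open>\<tau> |\<eta>|\<^sup>4 / R\<^sup>2\<close> and both are at least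
  \<open>\<tau> |\<eta>|\<^sup>2 / 6\<close>. Outside the box only the Gaussian is left, and there \<open>1 \<le> |\<eta>|\<^sup>2 / R\<^sup>2\<close>.
\<close>
lemma scaled_symbol_error:
  fixes \<eta> :: "real^'n"
  assumes R: "R > 0" and t: "\<tau> > 0"
  shows "\<bar>indicator period_box (\<eta> /\<^sub>R R) * exp (- (R\<^sup>2 * \<tau>) * laplace_symbol (\<eta> /\<^sub>R R)) - exp (- \<tau> * (norm \<eta>)\<^sup>2)\<bar>
    \<le> (norm \<eta> ^ 2 + \<tau> * norm \<eta> ^ 4) / R\<^sup>2 * exp (- (\<tau> / 6) * (norm \<eta>)\<^sup>2)"
proof (cases "\<eta> /\<^sub>R R \<in> period_box")
  case True
  define a where "a = R\<^sup>2 * \<tau> * laplace_symbol (\<eta> /\<^sub>R R)"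
  define b where "b = \<tau> * (norm \<eta>)\<^sup>2"
  have n: "(norm (\<eta> /\<^sub>R R))\<^sup>2 = (norm \<eta>)\<^sup>2 / R\<^sup>2" "norm (\<eta> /\<^sub>R R) ^ 4 = norm \<eta> ^ 4 / (R\<^sup>2 * R\<^sup>2)"
    using R by (simp_all add: power_mult_distrib field_simps flip: power_add)
  have a0: "a \<ge> 0" unfolding a_def using t by (intro mult_nonneg_nonneg laplace_symbol_nonneg) auto
  have "a \<le> R\<^sup>2 * \<tau> * ((norm \<eta>)\<^sup>2 / R\<^sup>2)"
    unfolding a_def using laplace_symbol_le_norm[of "\<eta> /\<^sub>R R"] t n by (intro mult_left_mono) auto
  then have ab: "a \<le> b" using R by (simp add: b_def)
  have "R\<^sup>2 * \<tau> * ((norm \<eta>)\<^sup>2 / R\<^sup>2 / 6) \<le> a"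
    unfolding a_def using laplace_symbol_ge[OF True] t n by (intro mult_left_mono) auto
  then have a6: "\<tau> / 6 * (norm \<eta>)\<^sup>2 \<le> a" using R by simp
  have "b - a = R\<^sup>2 * \<tau> * ((norm (\<eta> /\<^sub>R R))\<^sup>2 - laplace_symbol (\<eta> /\<^sub>R R))"
    unfolding a_def b_def n using R by (simp add: field_simps)
  also have "\<dots> \<le> R\<^sup>2 * \<tau> * (norm (\<eta> /\<^sub>R R) ^ 4)"
    using laplace_symbol_ge_norm_diff[of "\<eta> /\<^sub>R R"] t by (intro mult_left_mono) auto
  also have "\<dots> = \<tau> * norm \<eta> ^ 4 / R\<^sup>2" unfolding n using R by (simp add: field_simps)
  finally have d: "b - a \<le> \<tau> * norm \<eta> ^ 4 / R\<^sup>2" .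
  have "\<bar>exp (-a) - exp (-b)\<bar> = exp (-a) - exp (-b)" using ab by simp
  also have "\<dots> \<le> (b - a) * exp (-a)" by (rule exp_minus_diff_le[OF a0 ab])
  also have "\<dots> \<le> (\<tau> * norm \<eta> ^ 4 / R\<^sup>2) * exp (- (\<tau> / 6 * (norm \<eta>)\<^sup>2))"
    using d a6 ab t by (intro mult_mono) auto
  also have "\<dots> \<le> (norm \<eta> ^ 2 + \<tau> * norm \<eta> ^ 4) / R\<^sup>2 * exp (- (\<tau> / 6) * (norm \<eta>)\<^sup>2)"
    by (simp add: add_divide_distrib distrib_right)
  finally show ?thesis using True by (simp add: a_def b_def)
next
  case False
  then obtain j where "\<not> \<bar>(\<eta> /\<^sub>R R) $ j\<bar> \<le> pi" by (auto simp: mem_box_cart abs_le_iff) (smt (verit))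
  then have "norm (\<eta> /\<^sub>R R) \<ge> 1" using component_le_norm_cart[of "\<eta> /\<^sub>R R" j] pi_gt3 by linarith
  then have "norm \<eta> \<ge> R" using R by (simp add: field_simps)
  then have 1: "1 \<le> (norm \<eta>)\<^sup>2 / R\<^sup>2" using R by (simp add: power_mono)
  have "exp (- \<tau> * (norm \<eta>)\<^sup>2) \<le> exp (- (\<tau> / 6) * (norm \<eta>)\<^sup>2)" using t by (simp add: mult_right_mono)
  also have "\<dots> \<le> (norm \<eta>)\<^sup>2 / R\<^sup>2 * exp (- (\<tau> / 6) * (norm \<eta>)\<^sup>2)"
    using mult_right_mono[OF 1, of "exp (- (\<tau> / 6) * (norm \<eta>)\<^sup>2)"] by simp
  also have "\<dots> \<le> (norm \<eta> ^ 2 + \<tau> * norm \<eta> ^ 4) / R\<^sup>2 * exp (- (\<tau> / 6) * (norm \<eta>)\<^sup>2)"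
    using t R by (intro mult_right_mono divide_right_mono) auto
  finally show ?thesis using False by simp
qed

lemma scaled_lattice_heat:
  fixes x :: "int^'n"
  assumes x: "x \<noteq> 0" and R: "R = lnorm x"
  shows "of_real (R ^ CARD('n)) * lattice_heat u x = (LBINT \<eta>. of_real (indicator period_box (\<eta> /\<^sub>R R) * exp (- u * laplace_symbol (\<eta> /\<^sub>R R))) * wave ((lattice_embed x /\<^sub>R R) \<bullet> \<eta>))"
proof -
  have "lattice_embed x \<noteq> 0" using x by (auto simp: lattice_embed_def vec_eq_iff)
  then have R0: "R > 0" using R by simp
  define f where "f \<xi> = indicator period_box \<xi> *\<^sub>R (of_real (exp (- u * laplace_symbol \<xi>)) * wave (lattice_embed x \<bullet> \<xi>) :: complex)" for \<xi>
  have [measurable]: "f \<in> borel_measurable borel" unfolding f_def by measurable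
  have "lattice_heat u x = (1 / R) ^ DIM(real^'n) *\<^sub>R (LBINT \<eta>. f ((1 / R) *\<^sub>R \<eta>))"
    using lborel_integral_scaleR(2)[of "1/R" f] R0 
    by (simp add: lattice_heat_def torus_integral_def set_lebesgue_integral_def f_def)
  then have "of_real (R ^ CARD('n)) * lattice_heat u x = (LBINT \<eta>. f ((1 / R) *\<^sub>R \<eta>))"
    using R0 by (simp add: scaleR_conv_of_real power_divide)
  also have "\<dots> = (LBINT \<eta>. of_real (indicator period_box (\<eta> /\<^sub>R R) * exp (- u * laplace_symbol (\<eta> /\<^sub>R R))) * wave ((lattice_embed x /\<^sub>R R) \<bullet> \<eta>))"
    by (intro Bochner_Integration.integral_cong refl) (simp add: f_def scaleR_conv_of_real[where 'a=complex] inverse_eq_divide)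
  finally show ?thesis .
qed

text \<open>
  Integrating the pointwise error over \<open>\<eta>\<close>; the substitution \<open>v = \<surd>\<tau> \<eta>\<close> makes the dependence on
  \<open>\<tau>\<close> explicit. The rate matters, not only the convergence: for small \<open>\<tau>\<close> it controls the heat kernel
  wherever \<open>R\<close> is large compared with a power of \<open>1/\<tau>\<close>.
\<close>
lemma lattice_local_limit:
  "\<exists>C\<ge>0. \<forall>\<tau>>0. \<forall>x::int^'n. x \<noteq> 0 \<longrightarrow>
     norm (scaled_heat \<tau> x - of_real (heat_profile TYPE('n) \<tau>))
     \<le> C / ((lnorm x)\<^sup>2 * sqrt \<tau> ^ (CARD('n) + 2))"
proof -
  define w where "w v = (norm v ^ 2 + norm v ^ 4) * exp (- (1 / 6) * (norm v)\<^sup>2)" for v :: "real^'n"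
  have wi: "integrable lborel w" unfolding w_def distrib_right
    by (intro Bochner_Integration.integrable_add integrable_power_gaussian) auto
  have [measurable]: "w \<in> borel_measurable borel" using wi by auto
  define C where "C = (LBINT v. w v)"
  have C: "C \<ge> 0" unfolding C_def w_def by (intro Bochner_Integration.integral_nonneg) auto
  have main: "norm (of_real (R ^ CARD('n)) * lattice_heat (R\<^sup>2 * \<tau>) x - of_real (heat_profile TYPE('n) \<tau>))
     \<le> C / (R\<^sup>2 * sqrt \<tau> ^ (CARD('n) + 2))" if t: "\<tau> > 0" and x: "x \<noteq> 0" and R: "R = lnorm x" for \<tau> R and x :: "int^'n"
  proof -
    have "lattice_embed x \<noteq> 0" using x by (auto simp: lattice_embed_def vec_eq_iff)
    then have R0: "R > 0" using R by simp
    define z where "z = lattice_embed x /\<^sub>R R"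
    have z: "norm z = 1" using R R0 by (simp add: z_def)
    define F where "F \<eta> = indicator period_box (\<eta> /\<^sub>R R) * exp (- (R\<^sup>2 * \<tau>) * laplace_symbol (\<eta> /\<^sub>R R))" for \<eta> :: "real^'n"
    define G where "G \<eta> = exp (- \<tau> * (norm \<eta>)\<^sup>2)" for \<eta> :: "real^'n"
    define D where "D \<eta> = (norm \<eta> ^ 2 + \<tau> * norm \<eta> ^ 4) / R\<^sup>2 * exp (- (\<tau> / 6) * (norm \<eta>)\<^sup>2)" for \<eta> :: "real^'n"
    have Dw: "D \<eta> = 1 / (R\<^sup>2 * \<tau>) * w (sqrt \<tau> *\<^sub>R \<eta>)" for \<eta>
    proof -
      have "(sqrt \<tau>) ^ 4 = ((sqrt \<tau>)\<^sup>2)\<^sup>2" by (simp flip: power_mult)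
      then have "(sqrt \<tau>) ^ 4 = \<tau>\<^sup>2" using t by simp
      then have "w (sqrt \<tau> *\<^sub>R \<eta>) = \<tau> * ((norm \<eta> ^ 2 + \<tau> * norm \<eta> ^ 4) * exp (- (\<tau> / 6) * (norm \<eta>)\<^sup>2))" 
        unfolding w_def using t by (simp add: power_mult_distrib algebra_simps power2_eq_square[of \<tau>])
      then show ?thesis unfolding D_def using t R0 by simp
    qed
    have iD: "integrable lborel D" unfolding Dw
      using lborel_integral_scaleR(1)[of "sqrt \<tau>" w] t wi by (intro integrable_mult_right) auto
    have "(LBINT \<eta>. D \<eta>) = 1 / (R\<^sup>2 * \<tau>) * (LBINT \<eta>. w (sqrt \<tau> *\<^sub>R \<eta>))" unfolding Dw by simp
    also have "(LBINT \<eta>. w (sqrt \<tau> *\<^sub>R \<eta>)) = C / sqrt \<tau> ^ CARD('n)"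
      using lborel_integral_scaleR(2)[of "sqrt \<tau>" w] t unfolding C_def by (simp add: field_simps)
    also have "1 / (R\<^sup>2 * \<tau>) * (C / sqrt \<tau> ^ CARD('n)) = C / (R\<^sup>2 * sqrt \<tau> ^ (CARD('n) + 2))"
      using t by (simp add: power_add)
    finally have intD: "(LBINT \<eta>. D \<eta>) = C / (R\<^sup>2 * sqrt \<tau> ^ (CARD('n) + 2))" .
    have FG: "\<bar>F \<eta> - G \<eta>\<bar> \<le> D \<eta>" for \<eta>
      unfolding F_def G_def D_def by (rule scaled_symbol_error[OF R0 t])
    have [measurable]: "F \<in> borel_measurable borel" "G \<in> borel_measurable borel" unfolding F_def G_def by measurable
    have iFG: "integrable lborel (\<lambda>\<eta>. complex_of_real (F \<eta> - G \<eta>) * wave (z \<bullet> \<eta>))"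
    proof (rule Bochner_Integration.integrable_bound[OF iD])
      show "AE \<eta> in lborel. norm (complex_of_real (F \<eta> - G \<eta>) * wave (z \<bullet> \<eta>)) \<le> norm (D \<eta>)"
      proof (rule AE_I2)
        fix \<eta>
        have "norm (complex_of_real (F \<eta> - G \<eta>) * wave (z \<bullet> \<eta>)) = \<bar>F \<eta> - G \<eta>\<bar>"
          by (simp only: norm_mult norm_of_real norm_exp_i_times mult_1_right)
        also have "\<dots> \<le> norm (D \<eta>)" using FG[of \<eta>] by simp
        finally show "norm (complex_of_real (F \<eta> - G \<eta>) * wave (z \<bullet> \<eta>)) \<le> norm (D \<eta>)" .
      qed
    qed measurable
    have iG: "integrable lborel (\<lambda>\<eta>. complex_of_real (G \<eta>) * wave (z \<bullet> \<eta>))"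
      unfolding G_def by (rule gaussian_fourier(1)[OF t])
    have "of_real (R ^ CARD('n)) * lattice_heat (R\<^sup>2 * \<tau>) x = (LBINT \<eta>. of_real (F \<eta>) * wave (z \<bullet> \<eta>))"
      unfolding F_def z_def by (rule scaled_lattice_heat[OF x R])
    also have "\<dots> = (LBINT \<eta>. of_real (F \<eta> - G \<eta>) * wave (z \<bullet> \<eta>) + of_real (G \<eta>) * wave (z \<bullet> \<eta>))"
      by (simp add: algebra_simps)
    also have "\<dots> = (LBINT \<eta>. of_real (F \<eta> - G \<eta>) * wave (z \<bullet> \<eta>)) + (LBINT \<eta>. of_real (G \<eta>) * wave (z \<bullet> \<eta>))"
      by (rule Bochner_Integration.integral_add[OF iFG iG])
    also have "(LBINT \<eta>. of_real (G \<eta>) * wave (z \<bullet> \<eta>)) = of_real (heat_profile TYPE('n) \<tau>)"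
      unfolding G_def gaussian_fourier(2)[OF t] z heat_profile_def by simp
    finally have "of_real (R ^ CARD('n)) * lattice_heat (R\<^sup>2 * \<tau>) x - of_real (heat_profile TYPE('n) \<tau>) = (LBINT \<eta>. of_real (F \<eta> - G \<eta>) * wave (z \<bullet> \<eta>))"
      by simp
    also have "norm \<dots> \<le> (LBINT \<eta>. norm (of_real (F \<eta> - G \<eta>) * wave (z \<bullet> \<eta>)))"
      by (rule integral_norm_bound)
    also have "\<dots> \<le> (LBINT \<eta>. D \<eta>)"
      using FG by (intro integral_mono integrable_norm iFG iD) (simp only: norm_mult norm_of_real norm_exp_i_times mult_1_right)
    finally show ?thesis unfolding intD .
  qed
  then show ?thesis using C by (intro exI[of _ C]) blast
qed

text \<open>
  The exponential beats every power of \<open>1/\<tau>\<close>.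
\<close>
lemma gaussian_peak_bound:
  assumes b: "b > 0" and c: "c \<ge> 0"
  shows "\<exists>C\<ge>0. \<forall>\<tau>>0. \<tau> \<le> 1 \<longrightarrow> sqrt (c / \<tau>) ^ d * exp (- b / \<tau>) \<le> C * \<tau>"
proof -
  define C where "C = sqrt c ^ d * (fact (d + 1) * (1 / b) ^ (d + 1))"
  have "sqrt (c / \<tau>) ^ d * exp (- b / \<tau>) \<le> C * \<tau>" if t: "\<tau> > 0" "\<tau> \<le> 1" for \<tau>
  proof -
    have "c * \<tau> \<le> c * 1" using t c by (intro mult_left_mono) auto
    then have "c / \<tau> \<le> c / \<tau>\<^sup>2" using t by (simp add: field_simps power2_eq_square)
    then have "sqrt (c / \<tau>) \<le> sqrt (c / \<tau>\<^sup>2)" by simp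
    then have "sqrt (c / \<tau>) \<le> sqrt c / \<tau>" using t by (simp add: real_sqrt_divide)
    then have 1: "sqrt (c / \<tau>) ^ d \<le> (sqrt c / \<tau>) ^ d"
      using c t by (intro power_mono) auto
    have "(b / \<tau>) ^ (d + 1) \<le> fact (d + 1) * exp (b / \<tau>)" using b t by (intro power_le_fact_exp) auto
    then have "(b / \<tau>) ^ (d + 1) * exp (- (b / \<tau>)) \<le> fact (d + 1) * exp (b / \<tau>) * exp (- (b / \<tau>))"
      by (rule mult_right_mono) simp
    then have "(b / \<tau>) ^ (d + 1) * exp (- (b / \<tau>)) \<le> fact (d + 1)"
      unfolding mult.assoc by (simp flip: exp_add del: fact_Suc)
    then have "(\<tau> / b) ^ (d + 1) * ((b / \<tau>) ^ (d + 1) * exp (- (b / \<tau>))) \<le> (\<tau> / b) ^ (d + 1) * fact (d + 1)"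
      using b t by (intro mult_left_mono) auto
    moreover have "(\<tau> / b) ^ (d + 1) * ((b / \<tau>) ^ (d + 1) * exp (- (b / \<tau>))) = exp (- (b / \<tau>))"
      unfolding mult.assoc[symmetric] power_mult_distrib[symmetric] using b t by simp
    ultimately have 2: "exp (- b / \<tau>) \<le> fact (d + 1) * (1 / b) ^ (d + 1) * \<tau> ^ (d + 1)"
      by (simp add: power_divide mult.commute)
    have "sqrt (c / \<tau>) ^ d * exp (- b / \<tau>) \<le> (sqrt c / \<tau>) ^ d * (fact (d + 1) * (1 / b) ^ (d + 1) * \<tau> ^ (d + 1))"
      using 1 2 c t by (intro mult_mono) auto
    also have "\<dots> = C * \<tau>" using t by (simp add: C_def power_divide)
    finally show ?thesis .
  qed
  then show ?thesis using b c by (intro exI[of _ C]) (auto simp: C_def)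
qed

section \<open>Fourier coefficients of the fractional symbol\<close>
lemma heat_profile_nonneg: "\<tau> > 0 \<Longrightarrow> heat_profile TYPE('n::finite) \<tau> \<ge> 0"
  by (simp add: heat_profile_def)

lemma heat_profile_measurable [measurable]: "heat_profile TYPE('n::finite) \<in> borel_measurable borel"
  unfolding heat_profile_def[abs_def] by measurable

lemma norm_lattice_embed_ge_1:
  assumes "x \<noteq> 0" shows "lnorm (x :: int^'n) \<ge> 1"
proof -
  obtain j where "x $ j \<noteq> 0" using assms by (auto simp: vec_eq_iff)
  then have "1 \<le> \<bar>lattice_embed x $ j\<bar>" by (simp add: lattice_embed_def)
  also have "\<dots> \<le> lnorm x" by (rule component_le_norm_cart)
  finally show ?thesis .
qed

lemma lattice_embed_0 [simp]: "lattice_embed 0 = 0"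
  by (simp add: lattice_embed_def vec_eq_iff)

text \<open>
  The domination needed to integrate against \<open>\<tau>\<^bsup>-1-s\<^esup>\<close>. For \<open>\<tau> \<ge> 1\<close> the local limit theorem
  gives a constant. For \<open>\<tau> < 1\<close> there are two regimes. If \<open>R\<^sup>2 \<ge> \<tau>\<^bsup>-(d+4)/2\<^esup>\<close>, the error of the
  local limit theorem is at most a multiple of \<open>\<tau>\<close>, and so is the profile itself. Otherwise \<open>R\<close> is
  bounded by a power of \<open>1/\<tau>\<close>, and the polynomial decay of the heat kernel, taken of high enough
  order, compensates for the factor \<open>R\<^sup>d\<close>.
\<close>
lemma scaled_lattice_heat_bound:
  "\<exists>C\<ge>0. \<forall>\<tau>>0. \<forall>x::int^'n.
     norm (scaled_heat \<tau> x) \<le> C * min 1 (\<tau> powr 1)"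
proof -
  define d where "d = CARD('n)"
  have d: "d \<ge> 1" unfolding d_def by (simp add: Suc_leI)
  obtain C1 where C1: "C1 \<ge> 0" "\<And>\<tau> x::int^'n. \<tau> > 0 \<Longrightarrow> x \<noteq> 0 \<Longrightarrow>
     norm (of_real (lnorm x ^ d) * lattice_heat ((lnorm x)\<^sup>2 * \<tau>) x - of_real (heat_profile TYPE('n) \<tau>))
     \<le> C1 / ((lnorm x)\<^sup>2 * sqrt \<tau> ^ (d + 2))"
    unfolding d_def using lattice_local_limit by blast
  \<comment> \<open>The order of decay that compensates for \<open>R\<^sup>d\<close> when \<open>R\<^sup>2 \<le> \<tau>\<^bsup>-(d+4)/2\<^esup>\<close>.\<close>
  define m where "m = d * (d + 4) + 1"
  obtain C2 where C2: "C2 \<ge> 0" "\<And>u x::int^'n. u > 0 \<Longrightarrow> lnorm x ^ (2 * m) * norm (lattice_heat u x) \<le> C2 * (u * (1 + u) ^ (m - 1))"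
    using lattice_heat_decay[of m] unfolding m_def by auto
  obtain C3 where C3: "C3 \<ge> 0" "\<And>\<tau>. \<tau> > 0 \<Longrightarrow> \<tau> \<le> 1 \<Longrightarrow> heat_profile TYPE('n) \<tau> \<le> C3 * \<tau>"
    using gaussian_peak_bound[of "1/4" pi d] unfolding heat_profile_def d_def by auto
  define C4 where "C4 = sqrt pi ^ d"
  have C4: "C4 \<ge> 0" "heat_profile TYPE('n) \<tau> \<le> C4" if "\<tau> \<ge> 1" for \<tau>
  proof -
    have "sqrt (pi / \<tau>) ^ d * exp (- 1 / (4 * \<tau>)) \<le> sqrt (pi / 1) ^ d * 1"
      using that by (intro mult_mono power_mono real_sqrt_le_mono divide_left_mono) auto
    then show "heat_profile TYPE('n) \<tau> \<le> C4" by (simp add: heat_profile_def d_def C4_def)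
  qed (simp add: C4_def)
  define C where "C = C1 + C2 * 2 ^ (m - 1) + C3 + C4"
  have C40: "C4 \<ge> 0" by (simp add: C4_def)
  have C: "C \<ge> 0" using C1 C2 C3 C40 by (simp add: C_def)
  have "norm (of_real (lnorm x ^ d) * lattice_heat ((lnorm x)\<^sup>2 * \<tau>) x) \<le> C * min 1 (\<tau> powr 1)"
    if t: "\<tau> > 0" for \<tau> and x :: "int^'n"
  proof (cases "x = 0")
    case True
    then show ?thesis using C t d by (simp add: power_0_left)
  next
    case x: False
    define R where "R = lnorm x"
    define W where "W = of_real (R ^ d) * lattice_heat (R\<^sup>2 * \<tau>) x"
    have R: "R \<ge> 1" unfolding R_def by (rule norm_lattice_embed_ge_1[OF x])
    have loc: "norm W \<le> heat_profile TYPE('n) \<tau> + C1 / (R\<^sup>2 * sqrt \<tau> ^ (d + 2))"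
    proof -
      have "norm W \<le> norm (W - of_real (heat_profile TYPE('n) \<tau>)) + norm (of_real (heat_profile TYPE('n) \<tau>) :: complex)"
        using norm_triangle_ineq[of "W - of_real (heat_profile TYPE('n) \<tau>)" "of_real (heat_profile TYPE('n) \<tau>)"] by simp
      then show ?thesis using C1(2)[OF t x] heat_profile_nonneg[OF t, where 'n='n] by (simp add: W_def R_def)
    qed
    have "norm W \<le> C * min 1 \<tau>"
    proof (cases "\<tau> \<ge> 1")
      case True
      have "1 * 1 \<le> R\<^sup>2 * sqrt \<tau> ^ (d + 2)" using R True by (intro mult_mono one_le_power) auto
      then have "C1 / (R\<^sup>2 * sqrt \<tau> ^ (d + 2)) \<le> C1 / 1" using C1(1) by (intro divide_left_mono) auto
      then have "norm W \<le> C4 + C1" using loc C4(2)[OF True] by simp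
      also have "\<dots> \<le> C" using C2 C3 by (simp add: C_def)
      finally show ?thesis using True by simp
    next
      case t1: False
      have "norm W \<le> C * \<tau>"
      proof (cases "R\<^sup>2 * sqrt \<tau> ^ (d + 4) \<ge> 1")
        case True
        have "sqrt \<tau> ^ (d + 4) = sqrt \<tau> ^ (d + 2) * (sqrt \<tau>)\<^sup>2" unfolding power_add[symmetric] by (rule arg_cong[where f="power (sqrt \<tau>)"]) simp
        then have "1 \<le> R\<^sup>2 * sqrt \<tau> ^ (d + 2) * \<tau>" using True t by (simp add: mult_ac)
        then have "C1 * 1 \<le> C1 * (R\<^sup>2 * sqrt \<tau> ^ (d + 2) * \<tau>)" using C1(1) by (intro mult_left_mono) auto
        moreover have "R\<^sup>2 * sqrt \<tau> ^ (d + 2) > 0" using R t by simp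
        ultimately have "C1 / (R\<^sup>2 * sqrt \<tau> ^ (d + 2)) \<le> C1 * \<tau>" by (simp add: pos_divide_le_eq mult_ac)
        then have "norm W \<le> (C3 + C1) * \<tau>" using loc C3(2)[OF t] t1 by (simp add: distrib_right)
        also have "\<dots> \<le> C * \<tau>" using C2 C40 t by (intro mult_right_mono) (auto simp: C_def)
        finally show ?thesis .
      next
        case False
        define h where "h = norm (lattice_heat (R\<^sup>2 * \<tau>) x)"
        have R2: "R\<^sup>2 > 0" using R by simp
        have dec: "R ^ (2 * m) * h \<le> C2 * (R\<^sup>2 * \<tau> * (1 + R\<^sup>2 * \<tau>) ^ (m - 1))"
          unfolding h_def R_def by (rule C2(2)) (use R2 t in \<open>simp add: R_def\<close>)
        have Rd: "R ^ d \<le> (R\<^sup>2) ^ d" using R by (intro power_mono) (auto simp: self_le_power)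
        have key: "R ^ d * (1 + R\<^sup>2 * \<tau>) ^ (m - 1) \<le> 2 ^ (m - 1) * (R\<^sup>2) ^ (m - 1)"
        proof (cases "R\<^sup>2 * \<tau> \<le> 1")
          case True
          have "R ^ d * (1 + R\<^sup>2 * \<tau>) ^ (m - 1) \<le> (R\<^sup>2) ^ d * 2 ^ (m - 1)"
            using True t R2 by (intro mult_mono[OF Rd] power_mono) auto
          also have "\<dots> \<le> (R\<^sup>2) ^ (m - 1) * 2 ^ (m - 1)"
            using R by (intro mult_right_mono power_increasing) (auto simp: m_def one_le_power)
          finally show ?thesis by (simp add: mult.commute)
        next
          case large: False
          define w where "w = sqrt \<tau>"
          have w: "0 < w" "w \<le> 1" "w\<^sup>2 = \<tau>" using t t1 by (auto simp: w_def)
          have "(R\<^sup>2 * w ^ (d + 4)) ^ d \<le> 1" using False R2 w by (intro power_le_one) (auto simp: w_def)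
          then have a: "(R\<^sup>2) ^ d * w ^ (d * (d + 4)) \<le> 1" by (simp add: power_mult_distrib power_mult mult.commute[of d])
          have "\<tau> ^ (m - 1) = w ^ (2 * (d * (d + 4)))" by (simp add: m_def power_mult w(3)) 
          also have "\<dots> \<le> w ^ (d * (d + 4))" using w by (intro power_decreasing) auto
          finally have b: "R ^ d * \<tau> ^ (m - 1) \<le> 1" using a Rd R2 w
            by (intro order_trans[OF mult_mono a]) (auto simp: t less_imp_le)
          have "R ^ d * (1 + R\<^sup>2 * \<tau>) ^ (m - 1) \<le> R ^ d * (2 * (R\<^sup>2 * \<tau>)) ^ (m - 1)"
          proof (intro mult_left_mono power_mono)
            show "1 + R\<^sup>2 * \<tau> \<le> 2 * (R\<^sup>2 * \<tau>)" using large by linarith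
          qed (use R t in auto)
          also have "\<dots> = (R ^ d * \<tau> ^ (m - 1)) * (2 ^ (m - 1) * (R\<^sup>2) ^ (m - 1))" by (simp add: power_mult_distrib mult_ac)
          also have "\<dots> \<le> 1 * (2 ^ (m - 1) * (R\<^sup>2) ^ (m - 1))" using b R2 by (intro mult_right_mono) auto
          finally show ?thesis by simp
        qed
        have "(R\<^sup>2) ^ m * norm W = R ^ d * (R ^ (2 * m) * h)"
          using R by (simp add: W_def h_def norm_mult power_mult norm_power)
        also have "\<dots> \<le> R ^ d * (C2 * (R\<^sup>2 * \<tau> * (1 + R\<^sup>2 * \<tau>) ^ (m - 1)))"
          using dec R by (intro mult_left_mono) auto
        also have "\<dots> = C2 * R\<^sup>2 * \<tau> * (R ^ d * (1 + R\<^sup>2 * \<tau>) ^ (m - 1))" by (simp add: mult_ac)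
        also have "\<dots> \<le> C2 * R\<^sup>2 * \<tau> * (2 ^ (m - 1) * (R\<^sup>2) ^ (m - 1))"
          using key C2(1) R2 t by (intro mult_left_mono) auto
        also have "\<dots> = (R\<^sup>2) ^ m * (C2 * 2 ^ (m - 1) * \<tau>)" by (simp add: m_def mult_ac)
        finally have "norm W \<le> C2 * 2 ^ (m - 1) * \<tau>" using R2 by (simp add: mult_le_cancel_left)
        also have "\<dots> \<le> C * \<tau>" using t C1 C3 C40 by (intro mult_right_mono) (auto simp: C_def)
        finally show ?thesis .
      qed
      then show ?thesis using t1 by simp
    qed
    then show ?thesis using t by (simp add: W_def R_def)
  qed
  then show ?thesis using C unfolding d_def by blast
qed

text \<open>
  The constant \<open>A\<close> of the theorem.
\<close>
definition levy_amplitude :: "'n::finite itself \<Rightarrow> real \<Rightarrow> complex" where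
  "levy_amplitude n s = - of_real (1 / levy_const s) * (LBINT \<tau>. of_real (levy_density s \<tau>) * of_real (heat_profile n \<tau>))"

lemma integrable_period_box:
  assumes "f \<in> borel_measurable borel" "\<And>\<xi>. \<xi> \<in> period_box \<Longrightarrow> norm (f \<xi>) \<le> B"
  shows "set_integrable lborel (period_box :: (real^'n) set) (f :: _ \<Rightarrow> complex)"
  unfolding set_integrable_def
  by (rule integrableI_bounded_set_indicator[where B=B]) (use assms emeasure_lborel_cbox_finite in auto)

text \<open>
  Subordination, followed by the substitution \<open>u = R\<^sup>2 \<tau>\<close>. The constant \<open>1\<close> in \<open>1 - e\<^bsup>-u\<Phi>\<^esup>\<close> does
  not contribute off the origin, and at the origin the weight vanishes.
\<close>
lemma torus_integral_symbol_powr: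
  fixes x :: "int^'n"
  assumes s: "0 < s" "s < 1"
  shows "of_real (lnorm x powr (real CARD('n) + 2 * s)) * symbol_coeff s x =
    - of_real (1 / levy_const s) * (LBINT \<tau>. of_real (levy_density s \<tau>) *
       (scaled_heat \<tau> x))"
proof (cases "x = 0")
  case False
  define R where "R = lnorm x"
  have R: "R > 0" using norm_lattice_embed_ge_1[OF False] unfolding R_def by linarith
  define g where "g \<xi> = indicator period_box \<xi> *\<^sub>R (wave (lattice_embed x \<bullet> \<xi>) :: complex)" for \<xi>
  have [measurable]: "g \<in> borel_measurable borel" unfolding g_def by measurable
  have g: "integrable lborel g" unfolding g_def
    using integrable_period_box[of "\<lambda>\<xi>. wave (lattice_embed x \<bullet> \<xi>)" 1] by (simp add: set_integrable_def)
  have Pg: "integrable lborel (\<lambda>\<xi>. laplace_symbol \<xi> * norm (g \<xi>))"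
  proof (rule Bochner_Integration.integrable_bound)
    show "integrable lborel (\<lambda>\<xi>. (4 * real CARD('n)) * norm (g \<xi>))" using g by (intro integrable_mult_right integrable_norm)
    show "AE \<xi> in lborel. norm (laplace_symbol \<xi> * norm (g \<xi>)) \<le> norm ((4 * real CARD('n)) * norm (g \<xi>))"
      by (auto intro!: AE_I2 mult_right_mono simp: laplace_symbol_le laplace_symbol_nonneg abs_mult)
  qed measurable
  have inner: "(LBINT \<xi>. of_real (1 - exp (- (u * laplace_symbol \<xi>))) * g \<xi>) = - lattice_heat u x" if u: "u > 0" for u
  proof -
    have 1: "integrable lborel (\<lambda>\<xi>. indicator period_box \<xi> *\<^sub>R (of_real (exp (- u * laplace_symbol \<xi>)) * wave (lattice_embed x \<bullet> \<xi>) :: complex))"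
      using u by (intro integrable_period_box[where B=1, unfolded set_integrable_def]) (auto simp: norm_mult laplace_symbol_nonneg)
    have "(LBINT \<xi>. of_real (1 - exp (- (u * laplace_symbol \<xi>))) * g \<xi>) =
      (LBINT \<xi>. g \<xi> - indicator period_box \<xi> *\<^sub>R (of_real (exp (- u * laplace_symbol \<xi>)) * wave (lattice_embed x \<bullet> \<xi>)))"
      by (simp add: g_def algebra_simps)
    also have "\<dots> = torus_integral (\<lambda>_. 1) x - lattice_heat u x"
      by (subst Bochner_Integration.integral_diff[OF g 1]) (simp add: torus_integral_def lattice_heat_def set_lebesgue_integral_def g_def[abs_def])
    finally show ?thesis using False by (simp add: torus_integral_one)
  qed
  have "symbol_coeff s x = (LBINT \<xi>. of_real (laplace_symbol \<xi> powr s) * g \<xi>)"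
    by (simp add: torus_integral_def set_lebesgue_integral_def g_def mult_ac)
  also have "\<dots> = of_real (1 / levy_const s) * (LBINT u. of_real (levy_density s u) * (LBINT \<xi>. of_real (1 - exp (- (u * laplace_symbol \<xi>))) * g \<xi>))"
    by (rule powr_integral_subordination[OF s _ laplace_symbol_nonneg g Pg]) measurable
  also have "(LBINT u. of_real (levy_density s u) * (LBINT \<xi>. of_real (1 - exp (- (u * laplace_symbol \<xi>))) * g \<xi>)) =
     (LBINT u. - (of_real (levy_density s u) * lattice_heat u x))"
  proof (intro Bochner_Integration.integral_cong refl)
    fix u show "of_real (levy_density s u) * (LBINT \<xi>. of_real (1 - exp (- (u * laplace_symbol \<xi>))) * g \<xi>) = - (of_real (levy_density s u) * lattice_heat u x)"
      by (cases "u > 0") (simp_all only: inner mult_minus_right, simp add: levy_density_def)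
  qed
  also have "\<dots> = (R\<^sup>2) *\<^sub>R (LBINT u. - (of_real (levy_density s (R\<^sup>2 * u)) * lattice_heat (R\<^sup>2 * u) x))"
    using lborel_integral_real_affine[of "R\<^sup>2" "\<lambda>u. - (of_real (levy_density s u) * lattice_heat u x)" 0] R by simp
  also have "(LBINT u. - (of_real (levy_density s (R\<^sup>2 * u)) * lattice_heat (R\<^sup>2 * u) x)) =
     (LBINT u. (- of_real ((R\<^sup>2) powr (- 1 - s))) * (of_real (levy_density s u) * lattice_heat (R\<^sup>2 * u) x))"
    using R by (intro Bochner_Integration.integral_cong refl) (simp add: levy_density_scale[of "R\<^sup>2"])
  also have "\<dots> = (- of_real ((R\<^sup>2) powr (- 1 - s))) * (LBINT u. of_real (levy_density s u) * lattice_heat (R\<^sup>2 * u) x)"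
    by (rule integral_mult_right_zero)
  finally have eq: "symbol_coeff s x = of_real (1 / levy_const s) * (R\<^sup>2 *\<^sub>R
      ((- of_real ((R\<^sup>2) powr (- 1 - s))) * (LBINT u. of_real (levy_density s u) * lattice_heat (R\<^sup>2 * u) x)))" .
  have p: "R powr (real CARD('n) + 2 * s) * (R\<^sup>2 * (R\<^sup>2) powr (- 1 - s)) = R ^ CARD('n)"
  proof -
    have "R\<^sup>2 = R powr 2" "R ^ CARD('n) = R powr real CARD('n)" using R by (simp_all add: powr_realpow)
    then show ?thesis unfolding \<open>R\<^sup>2 = R powr 2\<close> \<open>R ^ CARD('n) = R powr real CARD('n)\<close> powr_powr powr_add[symmetric]
      by (simp add: algebra_simps)
  qed
  have "of_real (R powr (real CARD('n) + 2 * s)) * symbol_coeff s x =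
     - of_real (1 / levy_const s) * (of_real (R powr (real CARD('n) + 2 * s) * (R\<^sup>2 * (R\<^sup>2) powr (- 1 - s))) * (LBINT u. of_real (levy_density s u) * lattice_heat (R\<^sup>2 * u) x))"
    unfolding eq scaleR_conv_of_real of_real_mult by (simp only: mult_minus_left mult_minus_right mult_ac)
  also have "\<dots> = - of_real (1 / levy_const s) * (LBINT \<tau>. of_real (levy_density s \<tau>) * (of_real (R ^ CARD('n)) * lattice_heat (R\<^sup>2 * \<tau>) x))"
    unfolding p integral_mult_right_zero[symmetric] by (simp only: mult_ac)
  finally show ?thesis by (simp add: R_def)
qed simp

lemma lattice_heat_measurable [measurable]: "(\<lambda>u. lattice_heat u (x :: int^'n)) \<in> borel_measurable borel"
  unfolding lattice_heat_def torus_integral_def set_lebesgue_integral_def by measurable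

lemma torus_integral_symbol_powr_bound:
  assumes s: "0 < s" "s < 1"
  shows "\<exists>C. \<forall>x::int^'n. lnorm x powr (real CARD('n) + 2 * s) * norm (symbol_coeff s x) \<le> C"
    and "filterlim (\<lambda>n. lnorm (X n :: int^'n)) at_top sequentially \<Longrightarrow>
     (\<lambda>n. of_real (lnorm (X n) powr (real CARD('n) + 2 * s)) * symbol_coeff s (X n)) \<longlonglongrightarrow> levy_amplitude TYPE('n) s"
proof -
  define V where "V x \<tau> = complex_of_real (levy_density s \<tau>) * (scaled_heat \<tau> x)" for \<tau> and x :: "int^'n"
  obtain C where C: "C \<ge> 0" "\<And>\<tau> x::int^'n. \<tau> > 0 \<Longrightarrow>
     norm (scaled_heat \<tau> x) \<le> C * min 1 (\<tau> powr 1)"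
    using scaled_lattice_heat_bound by blast
  define w where "w \<tau> = C * (min 1 (\<tau> powr 1) * levy_density s \<tau>)" for \<tau>
  have w: "integrable lborel w" unfolding w_def by (intro integrable_mult_right integrable_levy_density) (use s in auto)
  have Vw: "norm (V x \<tau>) \<le> w \<tau>" for x \<tau>
  proof (cases "\<tau> > 0")
    case True
    have "norm (V x \<tau>) = levy_density s \<tau> * norm (scaled_heat \<tau> x)"
      unfolding V_def by (simp only: norm_mult norm_of_real abs_of_nonneg[OF levy_density_nonneg])
    also have "\<dots> \<le> levy_density s \<tau> * (C * min 1 (\<tau> powr 1))" by (intro mult_left_mono C True levy_density_nonneg)
    finally show ?thesis by (simp add: w_def mult_ac)
  qed (simp add: V_def w_def levy_density_def)
  have [measurable]: "V x \<in> borel_measurable borel" for x unfolding V_def by measurable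
  have T: "of_real (lnorm x powr (real CARD('n) + 2 * s)) * symbol_coeff s x =
    - of_real (1 / levy_const s) * (LBINT \<tau>. V x \<tau>)" for x :: "int^'n"
    unfolding V_def by (rule torus_integral_symbol_powr[OF s])
  have "lnorm x powr (real CARD('n) + 2 * s) * norm (symbol_coeff s x) \<le> 1 / levy_const s * (LBINT \<tau>. w \<tau>)" for x :: "int^'n"
  proof -
    have "lnorm x powr (real CARD('n) + 2 * s) * norm (symbol_coeff s x) =
      norm (- of_real (1 / levy_const s) * (LBINT \<tau>. V x \<tau>))"
      unfolding T[symmetric] by (simp add: norm_mult)
    also have "\<dots> = 1 / levy_const s * norm (LBINT \<tau>. V x \<tau>)" using levy_const_pos[OF s] by (simp add: norm_mult norm_divide)
    also have "norm (LBINT \<tau>. V x \<tau>) \<le> (LBINT \<tau>. w \<tau>)"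
      by (rule Bochner_Integration.integral_norm_bound_integral[OF _ w]) (auto intro!: Vw Bochner_Integration.integrable_bound[OF w] AE_I2 order_trans[OF Vw])
    finally show ?thesis using levy_const_pos[OF s] by (simp add: divide_right_mono)
  qed
  then show "\<exists>C. \<forall>x::int^'n. lnorm x powr (real CARD('n) + 2 * s) * norm (symbol_coeff s x) \<le> C" by blast
  assume X: "filterlim (\<lambda>n. lnorm (X n :: int^'n)) at_top sequentially"
  obtain C1 where C1: "C1 \<ge> 0" "\<And>\<tau> x::int^'n. \<tau> > 0 \<Longrightarrow> x \<noteq> 0 \<Longrightarrow>
     norm (scaled_heat \<tau> x - of_real (heat_profile TYPE('n) \<tau>))
     \<le> C1 / ((lnorm x)\<^sup>2 * sqrt \<tau> ^ (CARD('n) + 2))"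
    using lattice_local_limit by blast
  have "(\<lambda>n. LBINT \<tau>. V (X n) \<tau>) \<longlonglongrightarrow> (LBINT \<tau>. of_real (levy_density s \<tau>) * of_real (heat_profile TYPE('n) \<tau>))"
  proof (rule integral_dominated_convergence[OF _ _ w])
    show "AE \<tau> in lborel. (\<lambda>n. V (X n) \<tau>) \<longlonglongrightarrow> of_real (levy_density s \<tau>) * of_real (heat_profile TYPE('n) \<tau>)"
    proof (rule AE_I2)
      fix \<tau> :: real
      show "(\<lambda>n. V (X n) \<tau>) \<longlonglongrightarrow> of_real (levy_density s \<tau>) * of_real (heat_profile TYPE('n) \<tau>)"
      proof (cases "\<tau> > 0")
        case True
        have "(\<lambda>n. of_real (lnorm (X n) ^ CARD('n)) * lattice_heat ((lnorm (X n))\<^sup>2 * \<tau>) (X n)) \<longlonglongrightarrow> complex_of_real (heat_profile TYPE('n) \<tau>)"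
        proof (rule LIM_zero_cancel, rule Lim_null_comparison)
          show "\<forall>\<^sub>F n in sequentially. norm (of_real (lnorm (X n) ^ CARD('n)) * lattice_heat ((lnorm (X n))\<^sup>2 * \<tau>) (X n) - complex_of_real (heat_profile TYPE('n) \<tau>))
             \<le> C1 / ((lnorm (X n))\<^sup>2 * sqrt \<tau> ^ (CARD('n) + 2))"
            using filterlim_at_top_dense[THEN iffD1, OF X, rule_format, of 0]
            by eventually_elim (rule C1(2)[OF True], auto)
          have "filterlim (\<lambda>n. (lnorm (X n))\<^sup>2 * sqrt \<tau> ^ (CARD('n) + 2)) at_top sequentially"
            using True by (intro filterlim_at_top_mult_tendsto_pos[OF tendsto_const] filterlim_pow_at_top X) auto
          then show "(\<lambda>n. C1 / ((lnorm (X n))\<^sup>2 * sqrt \<tau> ^ (CARD('n) + 2))) \<longlonglongrightarrow> 0"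
            by (intro real_tendsto_divide_at_top[OF tendsto_const])
        qed
        then show ?thesis unfolding V_def by (intro tendsto_mult_left)
      qed (simp add: V_def levy_density_def)
    qed
  qed (auto intro!: AE_I2 Vw)
  then show "(\<lambda>n. of_real (lnorm (X n) powr (real CARD('n) + 2 * s)) * symbol_coeff s (X n)) \<longlonglongrightarrow> levy_amplitude TYPE('n) s"
    unfolding T levy_amplitude_def by (intro tendsto_mult_left)
qed

section \<open>Fourier transforms of test functions\<close>
lemma smooth_compact_support_iff:
  "smooth_compact_support (f :: 'a::euclidean_space \<Rightarrow> 'b::real_normed_vector) \<longleftrightarrow> (\<forall>k. C_k k f) \<and> (\<exists>R. \<forall>x. norm x > R \<longrightarrow> f x = 0)"
proof -
  have "compact (closure {x. f x \<noteq> 0}) \<longleftrightarrow> bounded {x. f x \<noteq> 0}" by (simp add: compact_closure)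
  also have "\<dots> \<longleftrightarrow> (\<exists>R. \<forall>x. norm x > R \<longrightarrow> f x = 0)"
    unfolding bounded_iff by (metis (mono_tags, lifting) mem_Collect_eq linorder_not_less)
  finally show ?thesis unfolding smooth_compact_support_def by simp
qed

definition dir_deriv :: "'a::euclidean_space \<Rightarrow> ('a \<Rightarrow> complex) \<Rightarrow> 'a \<Rightarrow> complex" where
  "dir_deriv v f x = frechet_derivative f (at x) v"

lemma smooth_compact_support_dir_deriv:
  assumes "smooth_compact_support f" shows "smooth_compact_support (dir_deriv v f)"
proof -
  obtain R where R: "\<And>x. norm x > R \<Longrightarrow> f x = 0" using assms by (auto simp: smooth_compact_support_iff)
  have "dir_deriv v f x = 0" if x: "norm x > R" for x
  proof -
    have "(f has_derivative (\<lambda>_. 0)) (at x)"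
      by (rule has_derivative_transform_within_open[of "\<lambda>_. 0" _ _ _ "{x. norm x > R}"])
        (use x R in \<open>auto intro!: open_Collect_less continuous_intros\<close>)
    then show ?thesis unfolding dir_deriv_def by (metis frechet_derivative_at)
  qed
  moreover have "C_k k (dir_deriv v f)" for k
    using assms C_k.simps(2)[of k f] unfolding smooth_compact_support_def dir_deriv_def[abs_def] by blast
  ultimately show ?thesis by (auto simp: smooth_compact_support_iff)
qed

lemma smooth_compact_support_continuous: "smooth_compact_support f \<Longrightarrow> continuous_on UNIV f"
  unfolding smooth_compact_support_def by (metis C_k.simps(1))

lemma smooth_compact_support_measurable: "smooth_compact_support f \<Longrightarrow> f \<in> borel_measurable borel"
  by (intro borel_measurable_continuous_onI smooth_compact_support_continuous)

lemma continuous_compact_support_integrable: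
  fixes f :: "'a::euclidean_space \<Rightarrow> 'b::{banach, second_countable_topology}"
  assumes "continuous_on UNIV f" "\<And>x. norm x > R \<Longrightarrow> f x = 0"
  shows "integrable lborel f"
proof -
  have "integrable lborel (\<lambda>x. indicator (cball 0 R) x *\<^sub>R f x)"
    by (rule borel_integrable_compact[OF compact_cball continuous_on_subset[OF assms(1)]]) simp
  moreover have "(\<lambda>x. indicator (cball 0 R) x *\<^sub>R f x) = f"
    using assms(2) by (auto simp: fun_eq_iff indicator_def)
  ultimately show ?thesis by simp
qed

lemma smooth_compact_support_bounded:
  assumes "smooth_compact_support (f :: 'a::euclidean_space \<Rightarrow> complex)"
  shows "\<exists>B\<ge>0. \<forall>x. norm (f x) \<le> B"
proof -
  obtain R where R: "\<And>x. norm x > R \<Longrightarrow> f x = 0" using assms by (auto simp: smooth_compact_support_iff)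
  have "compact (f ` cball 0 R)"
    using smooth_compact_support_continuous[OF assms] continuous_on_subset by (intro compact_continuous_image) auto
  then have "bounded (f ` cball 0 R)" by (rule compact_imp_bounded)
  then obtain B where "\<forall>x\<in>cball 0 R. norm (f x) \<le> B" by (auto simp: bounded_iff)
  then have B: "\<And>x. norm x \<le> R \<Longrightarrow> norm (f x) \<le> B" by simp
  have "norm (f x) \<le> max B 0" for x
    by (cases "norm x \<le> R") (use B[of x] R[of x] in auto)
  then show ?thesis by (intro exI[of _ "max B 0"]) auto
qed

definition fourier :: "('a::euclidean_space \<Rightarrow> complex) \<Rightarrow> 'a \<Rightarrow> complex" where
  "fourier f z = (LBINT x. f x * wave (z \<bullet> x))"

lemma integrable_mult_character:
  fixes f :: "'a::euclidean_space \<Rightarrow> complex"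
  assumes "integrable lborel f" shows "integrable lborel (\<lambda>x. f x * wave (z \<bullet> x))"
  by (rule Bochner_Integration.integrable_bound[OF assms]) (use assms in \<open>auto simp: norm_mult\<close>)

lemma lborel_integral_translate:
  fixes f :: "'a::euclidean_space \<Rightarrow> 'b::{banach, second_countable_topology}"
  assumes [measurable]: "f \<in> borel_measurable borel"
  shows "(LBINT x. f (c + x)) = (LBINT x. f x)"
    and "integrable lborel (\<lambda>x. f (c + x)) \<longleftrightarrow> integrable lborel f"
proof -
  have "(LBINT x. f x) = (LINT x|distr lborel borel ((+) c). f x)" by (simp add: lborel_distr_plus)
  also have "\<dots> = (LBINT x. f (c + x))" by (rule integral_distr) measurable
  finally show "(LBINT x. f (c + x)) = (LBINT x. f x)" ..
  have "integrable lborel f \<longleftrightarrow> integrable (distr lborel borel ((+) c)) f" by (simp add: lborel_distr_plus)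
  also have "\<dots> \<longleftrightarrow> integrable lborel (\<lambda>x. f (c + x))" by (rule integrable_distr_eq) measurable
  finally show "integrable lborel (\<lambda>x. f (c + x)) \<longleftrightarrow> integrable lborel f" ..
qed

lemma has_vector_derivative_at_0:
  assumes "(f has_vector_derivative D) (at 0)"
  shows "((\<lambda>k. (f k - f 0) /\<^sub>R k) \<longlongrightarrow> D) (at 0)"
proof -
  have "((\<lambda>k. norm (f k - f 0 - k *\<^sub>R D) / norm k) \<longlongrightarrow> 0) (at 0)"
    using assms unfolding has_vector_derivative_def has_derivative_at by simp
  moreover have "\<forall>\<^sub>F k in at 0. norm (f k - f 0 - k *\<^sub>R D) / norm k = norm ((f k - f 0) /\<^sub>R k - D)"
    unfolding eventually_at_filter
  proof (intro always_eventually allI impI)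
    fix k :: real assume k: "k \<noteq> 0"
    have "(f k - f 0) /\<^sub>R k - D = (f k - f 0 - k *\<^sub>R D) /\<^sub>R k"
      using k by (simp add: algebra_simps)
    then show "norm (f k - f 0 - k *\<^sub>R D) / norm k = norm ((f k - f 0) /\<^sub>R k - D)"
      by (simp add: divide_inverse mult.commute)
  qed
  ultimately have "((\<lambda>k. norm ((f k - f 0) /\<^sub>R k - D)) \<longlongrightarrow> 0) (at 0)"
    by (rule Lim_transform_eventually)
  then show ?thesis by (intro LIM_zero_cancel[of _ D]) (rule tendsto_norm_zero_cancel)
qed

text \<open>
  The mean value theorem along a line, in the form that dominates difference quotients.
\<close>
lemma dir_deriv_quotient_bound:
  fixes f :: "'a::euclidean_space \<Rightarrow> complex"
  assumes "\<And>x. f differentiable (at x)" "\<And>x. norm (dir_deriv v f x) \<le> B"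
  shows "((\<lambda>\<tau>. f (x + \<tau> *\<^sub>R v)) has_vector_derivative dir_deriv v f (x + \<tau> *\<^sub>R v)) (at \<tau>)"
    and "norm (f (x + h *\<^sub>R v) - f x) \<le> B * \<bar>h\<bar>"
proof -
  show D: "((\<lambda>\<tau>. f (x + \<tau> *\<^sub>R v)) has_vector_derivative dir_deriv v f (x + \<tau> *\<^sub>R v)) (at \<tau>)" for \<tau>
  proof -
    have 1: "(f has_derivative frechet_derivative f (at (x + \<tau> *\<^sub>R v))) (at (x + \<tau> *\<^sub>R v))"
      using assms(1) by (simp add: frechet_derivative_works)
    have "((\<lambda>\<tau>. f (x + \<tau> *\<^sub>R v)) has_derivative (\<lambda>h. frechet_derivative f (at (x + \<tau> *\<^sub>R v)) (h *\<^sub>R v))) (at \<tau>)"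
      by (rule has_derivative_compose[where f="\<lambda>\<tau>. x + \<tau> *\<^sub>R v" and g=f, OF _ 1]) (auto intro!: derivative_eq_intros)
    then show ?thesis
      unfolding has_vector_derivative_def dir_deriv_def
      using linear_frechet_derivative[OF assms(1)] by (simp add: linear_cmul)
  qed
  have "norm (f (x + h *\<^sub>R v) - f (x + 0 *\<^sub>R v)) \<le> B * norm (h - 0)"
  proof (rule differentiable_bound[where S=UNIV and f'="\<lambda>\<tau> k. k *\<^sub>R dir_deriv v f (x + \<tau> *\<^sub>R v)"])
    fix \<tau> :: real
    show "((\<lambda>\<tau>. f (x + \<tau> *\<^sub>R v)) has_derivative (\<lambda>k. k *\<^sub>R dir_deriv v f (x + \<tau> *\<^sub>R v))) (at \<tau> within UNIV)"
      using D[of \<tau>] by (simp add: has_vector_derivative_def)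
    show "onorm (\<lambda>k. k *\<^sub>R dir_deriv v f (x + \<tau> *\<^sub>R v)) \<le> B"
      by (rule onorm_bound) (use assms(2) order_trans[OF norm_ge_zero assms(2)] in \<open>auto simp: mult.commute[of B] intro!: mult_left_mono\<close>)
  qed auto
  then show "norm (f (x + h *\<^sub>R v) - f x) \<le> B * \<bar>h\<bar>" by simp
qed

text \<open>
  Translating \<open>f\<close> by \<open>hv\<close> multiplies its transform by \<open>e\<^bsup>-ih z\<bullet>v\<^esup>\<close>. Differentiating this identity
  at \<open>h = 0\<close> replaces integration by parts; the derivative passes under the integral by dominated
  convergence.
\<close>
lemma fourier_dir_deriv:
  assumes f: "smooth_compact_support f"
  shows "fourier (dir_deriv v f) z = - \<i> * of_real (z \<bullet> v) * fourier f z"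
proof -
  have diff: "\<And>x. f differentiable (at x)"
    using f unfolding smooth_compact_support_def by (meson C_k.simps(2))
  obtain R where R: "\<And>x. norm x > R \<Longrightarrow> f x = 0" using f by (auto simp: smooth_compact_support_iff)
  obtain B where B: "B \<ge> 0" "\<And>x. norm (dir_deriv v f x) \<le> B"
    using smooth_compact_support_bounded[OF smooth_compact_support_dir_deriv[OF f]] by blast
  note [measurable] = smooth_compact_support_measurable[OF f] smooth_compact_support_measurable[OF smooth_compact_support_dir_deriv[OF f]]
  have fi: "integrable lborel f" by (rule continuous_compact_support_integrable[OF smooth_compact_support_continuous[OF f] R])
  \<comment> \<open>A sequence of step sizes in \<open>(0, 1]\<close>; staying below 1 keeps all supports in one ball.\<close>
  define h where "h n = 1 / real (Suc n)" for n
  have h: "h n > 0" "h n \<le> 1" for n by (auto simp: h_def divide_simps)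
  have h0: "h \<longlonglongrightarrow> 0" unfolding h_def by (rule LIMSEQ_Suc[OF lim_1_over_n])
  have hat: "filterlim h (at 0) sequentially"
    using h0 h unfolding filterlim_at by (auto intro!: always_eventually) (metis less_irrefl)
  define q where "q n x = ((f (x + h n *\<^sub>R v) - f x) /\<^sub>R h n) * wave (z \<bullet> x)" for n x
  have lim1: "(\<lambda>n. LBINT x. q n x) \<longlonglongrightarrow> fourier (dir_deriv v f) z"
    unfolding fourier_def
  proof (rule integral_dominated_convergence)
    show "integrable lborel (\<lambda>x::'a. B * indicator (cball 0 (R + norm v)) x)"
      by (intro integrable_mult_right integrable_real_indicator) (simp, rule emeasure_lborel_cball_finite)
    show "AE x in lborel. (\<lambda>n. q n x) \<longlonglongrightarrow> dir_deriv v f x * wave (z \<bullet> x)"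
    proof (rule AE_I2)
      fix x
      have "((\<lambda>k. (f (x + k *\<^sub>R v) - f x) /\<^sub>R k) \<longlongrightarrow> dir_deriv v f x) (at 0)"
        using has_vector_derivative_at_0[OF dir_deriv_quotient_bound(1)[OF diff B(2), of x 0]] by simp
      from filterlim_compose[OF this hat]
      show "(\<lambda>n. q n x) \<longlonglongrightarrow> dir_deriv v f x * wave (z \<bullet> x)"
        unfolding q_def by (intro tendsto_mult_right)
    qed
    show "AE x in lborel. norm (q n x) \<le> B * indicator (cball 0 (R + norm v)) x" for n
    proof (rule AE_I2)
      fix x
      have "norm (q n x) = norm (f (x + h n *\<^sub>R v) - f x) / h n"
        using h(1)[of n] by (simp add: q_def norm_mult divide_inverse)
      also have "\<dots> \<le> B" using dir_deriv_quotient_bound(2)[OF diff B(2), of x "h n"] h(1)[of n] by (simp add: divide_le_eq)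
      finally have 1: "norm (q n x) \<le> B" .
      have "q n x = 0" if x: "norm x > R + norm v"
      proof -
        have "norm (h n *\<^sub>R v) \<le> 1 * norm v" using h[of n] mult_right_mono[of "h n" 1 "norm v"] by simp
        then have "norm (x + h n *\<^sub>R v) > R" using x norm_diff_ineq[of x "h n *\<^sub>R v"] by linarith
        moreover have "norm x > R" using x norm_ge_zero[of v] by linarith
        ultimately show ?thesis using R by (simp add: q_def)
      qed
      then show "norm (q n x) \<le> B * indicator (cball 0 (R + norm v)) x" using 1 by (auto simp: indicator_def)
    qed
  qed (unfold q_def, measurable)
  have qeq: "(LBINT x. q n x) = ((wave (- h n * (z \<bullet> v)) - 1) /\<^sub>R h n) * fourier f z" for n
  proof -
    have i1: "integrable lborel (\<lambda>x. f x * wave (z \<bullet> x))" by (rule integrable_mult_character[OF fi])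
    define g where "g x = f x * wave (z \<bullet> (x - h n *\<^sub>R v))" for x
    have [measurable]: "g \<in> borel_measurable borel" unfolding g_def by measurable
    have gm: "g = (\<lambda>x. wave (- h n * (z \<bullet> v)) * (f x * wave (z \<bullet> x)))"
      by (auto simp: g_def fun_eq_iff inner_diff_right algebra_simps simp flip: exp_add)
    have gi: "integrable lborel g" unfolding gm by (intro integrable_mult_right i1)
    have gt: "f (x + h n *\<^sub>R v) * wave (z \<bullet> x) = g (h n *\<^sub>R v + x)" for x
      by (simp add: g_def add.commute)
    have "(LBINT x. q n x) = (LBINT x. (g (h n *\<^sub>R v + x) - f x * wave (z \<bullet> x)) /\<^sub>R h n)"
      unfolding gt[symmetric] q_def by (simp add: algebra_simps)
    also have "\<dots> = ((LBINT x. g (h n *\<^sub>R v + x)) - fourier f z) /\<^sub>R h n"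
      using gi i1 by (simp add: lborel_integral_translate(2) fourier_def)
    also have "(LBINT x. g (h n *\<^sub>R v + x)) = (LBINT x. g x)" by (rule lborel_integral_translate) measurable
    also have "\<dots> = wave (- h n * (z \<bullet> v)) * fourier f z" unfolding gm fourier_def by simp
    finally show ?thesis by (simp add: algebra_simps)
  qed
  have "((\<lambda>k. wave (- k * (z \<bullet> v))) has_vector_derivative (- \<i> * of_real (z \<bullet> v))) (at 0)"
  proof -
    have "((\<lambda>w::complex. exp (\<i> * (- w * of_real (z \<bullet> v)))) has_field_derivative (- \<i> * of_real (z \<bullet> v))) (at (of_real 0))"
      by (auto intro!: derivative_eq_intros)
    from has_vector_derivative_real_field[OF this] show ?thesis by (simp add: o_def)
  qed
  from has_vector_derivative_at_0[OF this]
  have "((\<lambda>k. (wave (- k * (z \<bullet> v)) - 1) /\<^sub>R k) \<longlongrightarrow> - \<i> * of_real (z \<bullet> v)) (at 0)"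
    by simp
  from filterlim_compose[OF this hat]
  have "(\<lambda>n. LBINT x. q n x) \<longlonglongrightarrow> - \<i> * of_real (z \<bullet> v) * fourier f z"
    unfolding qeq by (intro tendsto_mult_right)
  with lim1 show ?thesis by (rule LIMSEQ_unique)
qed

lemma smooth_compact_support_integrable:
  assumes f: "smooth_compact_support (f :: 'a::euclidean_space \<Rightarrow> complex)"
  shows "integrable lborel f"
proof -
  obtain R where R: "\<And>x. norm x > R \<Longrightarrow> f x = 0" using f by (auto simp: smooth_compact_support_iff)
  show ?thesis by (rule continuous_compact_support_integrable[OF smooth_compact_support_continuous[OF f] R])
qed

lemma norm_fourier_le:
  assumes "integrable lborel f" shows "norm (fourier f z) \<le> (LBINT x. norm (f x))"
proof -
  have "norm (fourier f z) \<le> (LBINT x. norm (f x * wave (z \<bullet> x)))"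
    unfolding fourier_def by (rule integral_norm_bound)
  then show ?thesis by (simp add: norm_mult)
qed

lemma fourier_decay_direction:
  assumes "smooth_compact_support f"
  shows "\<exists>C\<ge>0. \<forall>z. \<bar>z \<bullet> v\<bar> ^ k * norm (fourier f z) \<le> C"
  using assms
proof (induction k arbitrary: f)
  case 0
  then show ?case using norm_fourier_le[OF smooth_compact_support_integrable[OF 0]]
    by (intro exI[of _ "LBINT x. norm (f x)"]) (auto intro!: Bochner_Integration.integral_nonneg)
next
  case (Suc k)
  from Suc.IH[OF smooth_compact_support_dir_deriv[OF Suc.prems]] obtain C where
    C: "C \<ge> 0" "\<And>z. \<bar>z \<bullet> v\<bar> ^ k * norm (fourier (dir_deriv v f) z) \<le> C" by blast
  have "\<bar>z \<bullet> v\<bar> ^ Suc k * norm (fourier f z) = \<bar>z \<bullet> v\<bar> ^ k * norm (fourier (dir_deriv v f) z)" for z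
    unfolding fourier_dir_deriv[OF Suc.prems] by (simp add: norm_mult mult_ac)
  with C show ?case by (intro exI[of _ C]) metis
qed

lemma fourier_decay:
  assumes f: "smooth_compact_support (f :: 'a::euclidean_space \<Rightarrow> complex)"
  shows "\<exists>C\<ge>0. \<forall>z. norm z ^ k * norm (fourier f z) \<le> C"
proof -
  have "\<forall>b. \<exists>C\<ge>0. \<forall>z. \<bar>z \<bullet> b\<bar> ^ k * norm (fourier f z) \<le> C" using fourier_decay_direction[OF f] by blast
  then obtain C where C: "\<And>b. C b \<ge> 0" "\<And>b z. \<bar>z \<bullet> b\<bar> ^ k * norm (fourier f z) \<le> C b" by metis
  define D where "D = real DIM('a) ^ k * (\<Sum>b\<in>Basis. C b)"
  have "norm z ^ k * norm (fourier f z) \<le> D" for z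
  proof -
    define M where "M = Max ((\<lambda>b. \<bar>z \<bullet> b\<bar>) ` Basis)"
    have "M \<in> (\<lambda>b. \<bar>z \<bullet> b\<bar>) ` Basis" unfolding M_def by (rule Max_in) auto
    then obtain b where b: "b \<in> Basis" "M = \<bar>z \<bullet> b\<bar>" by auto
    have "norm z \<le> (\<Sum>b\<in>Basis. \<bar>z \<bullet> b\<bar>)" by (rule norm_le_l1)
    also have "\<dots> \<le> (\<Sum>b\<in>(Basis::'a set). M)" unfolding M_def by (intro sum_mono Max_ge) auto
    finally have "norm z \<le> real DIM('a) * \<bar>z \<bullet> b\<bar>" using b by simp
    then have "norm z ^ k \<le> (real DIM('a) * \<bar>z \<bullet> b\<bar>) ^ k" by (intro power_mono) auto
    then have "norm z ^ k * norm (fourier f z) \<le> (real DIM('a) * \<bar>z \<bullet> b\<bar>) ^ k * norm (fourier f z)"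
      by (intro mult_right_mono) auto
    also have "\<dots> = real DIM('a) ^ k * (\<bar>z \<bullet> b\<bar> ^ k * norm (fourier f z))" by (simp add: power_mult_distrib)
    also have "\<dots> \<le> real DIM('a) ^ k * C b" by (intro mult_left_mono C) auto
    also have "C b \<le> (\<Sum>b\<in>Basis. C b)" using b C by (intro member_le_sum) auto
    finally show ?thesis unfolding D_def by (simp add: mult_left_mono)
  qed
  then show ?thesis using C(1) by (intro exI[of _ D]) (auto simp: D_def intro!: mult_nonneg_nonneg sum_nonneg)
qed

lemma fourier_measurable:
  assumes [measurable]: "f \<in> borel_measurable borel" shows "fourier f \<in> borel_measurable borel"
  unfolding fourier_def[abs_def] by measurable

lemma integrable_inverse_square_1d: "integrable lborel (\<lambda>x::real. 1 / (1 + x\<^sup>2))"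
  using integrable_inverse_1_plus_square by (simp add: set_integrable_def einterval_eq inverse_eq_divide)

text \<open>
  Decay of order \<open>2d\<close> suffices because \<open>(1 + |z|\<^sup>2)\<^bsup>-d\<^esup>\<close> lies below the product of the
  one-dimensional functions \<open>1 / (1 + z\<^sub>j\<^sup>2)\<close>.
\<close>
lemma integrable_fourier:
  assumes f: "smooth_compact_support (f :: real^'n \<Rightarrow> complex)"
  shows "integrable lborel (fourier f)"
proof -
  define d where "d = CARD('n)"
  obtain C0 where C0: "C0 \<ge> 0" "\<And>z. norm z ^ 0 * norm (fourier f z) \<le> C0" using fourier_decay[OF f, of 0] by blast
  obtain C1 where C1: "C1 \<ge> 0" "\<And>z. norm z ^ (2 * d) * norm (fourier f z) \<le> C1" using fourier_decay[OF f, of "2 * d"] by blast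
  have "integrable lborel (\<lambda>z::real^'n. \<Prod>j\<in>UNIV. complex_of_real (1 / (1 + (z $ j)\<^sup>2)))"
    by (rule lborel_integral_prod_vec(1)) (simp only: complex_of_real_integrable_eq integrable_inverse_square_1d)
  then have "integrable lborel (\<lambda>z::real^'n. \<Prod>j\<in>UNIV. 1 / (1 + (z $ j)\<^sup>2))"
    by (simp only: of_real_prod[symmetric] complex_of_real_integrable_eq)
  then have "integrable lborel (\<lambda>z::real^'n. (2 ^ d * (C0 + C1)) * (\<Prod>j\<in>UNIV. 1 / (1 + (z $ j)\<^sup>2)))"
    by (rule integrable_mult_right)
  then show ?thesis
  proof (rule Bochner_Integration.integrable_bound)
    show "AE z in lborel. norm (fourier f z) \<le> norm ((2 ^ d * (C0 + C1)) * (\<Prod>j\<in>UNIV. 1 / (1 + (z $ j)\<^sup>2)))"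
    proof (rule AE_I2)
      fix z :: "real^'n"
      have p: "(1 + (norm z)\<^sup>2) ^ d > 0" by (simp add: add_pos_nonneg)
      have "(1 + (norm z)\<^sup>2) ^ d \<le> (2 * max 1 ((norm z)\<^sup>2)) ^ d" by (intro power_mono) auto
      also have "\<dots> = 2 ^ d * max 1 ((norm z)\<^sup>2) ^ d" by (simp add: power_mult_distrib)
      also have "max 1 ((norm z)\<^sup>2) ^ d \<le> 1 + norm z ^ (2 * d)" by (auto simp: max_def power_mult)
      finally have "(1 + (norm z)\<^sup>2) ^ d * norm (fourier f z) \<le> (2 ^ d * (1 + norm z ^ (2 * d))) * norm (fourier f z)"
        by (intro mult_right_mono) auto
      also have "\<dots> = 2 ^ d * (norm (fourier f z) + norm z ^ (2 * d) * norm (fourier f z))" by (simp add: algebra_simps)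
      also have "\<dots> \<le> 2 ^ d * (C0 + C1)" using C0(2)[of z] C1(2)[of z] by (intro mult_left_mono add_mono) auto
      finally have 1: "norm (fourier f z) \<le> (2 ^ d * (C0 + C1)) * (1 / (1 + (norm z)\<^sup>2) ^ d)"
        using p by (simp add: field_simps)
      have "1 / (1 + (norm z)\<^sup>2) ^ d = (\<Prod>j\<in>(UNIV::'n set). 1 / (1 + (norm z)\<^sup>2))" by (simp add: d_def power_one_over)
      also have "\<dots> \<le> (\<Prod>j\<in>UNIV. 1 / (1 + (z $ j)\<^sup>2))"
      proof (rule prod_mono, intro conjI)
        fix j
        have "(z $ j)\<^sup>2 \<le> (norm z)\<^sup>2" using component_le_norm_cart[of z j] abs_le_square_iff[of "z $ j" "norm z"] by simp
        then show "1 / (1 + (norm z)\<^sup>2) \<le> 1 / (1 + (z $ j)\<^sup>2)" by (intro divide_left_mono) (auto intro!: mult_pos_pos add_pos_nonneg)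
      qed simp
      finally have "norm (fourier f z) \<le> (2 ^ d * (C0 + C1)) * (\<Prod>j\<in>UNIV. 1 / (1 + (z $ j)\<^sup>2))"
        using 1 C0 C1 by (smt (verit) mult_left_mono zero_le_mult_iff zero_le_power)
      then show "norm (fourier f z) \<le> norm ((2 ^ d * (C0 + C1)) * (\<Prod>j\<in>UNIV. 1 / (1 + (z $ j)\<^sup>2)))" by (smt (verit) real_norm_def)
    qed
  qed (use fourier_measurable[OF smooth_compact_support_measurable[OF f]] in simp)
qed

section \<open>The cutoff integral\<close>
lemma fourier_scaled:
  fixes f :: "'a::euclidean_space \<Rightarrow> complex"
  assumes [measurable]: "f \<in> borel_measurable borel" and N: "N > 0"
  shows "fourier (\<lambda>x. f (x /\<^sub>R N)) z = of_real (N ^ DIM('a)) * fourier f (N *\<^sub>R z)"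
proof -
  have "fourier (\<lambda>x. f (x /\<^sub>R N)) z = N ^ DIM('a) *\<^sub>R (LBINT x. f ((N *\<^sub>R x) /\<^sub>R N) * wave (z \<bullet> (N *\<^sub>R x)))"
    unfolding fourier_def
    by (rule lborel_integral_scaleR(2)[OF N, of "\<lambda>x. f (x /\<^sub>R N) * wave (z \<bullet> x)"]) measurable
  then show ?thesis using N by (simp add: fourier_def scaleR_conv_of_real)
qed

text \<open>
  The density of the heat flow at time \<open>u\<close>, whose Fourier transform is \<open>e\<^bsup>-u|\<eta>|^2\<^esup>\<close>.
\<close>
definition gauss_kernel :: "real \<Rightarrow> real^'n \<Rightarrow> real" where
  "gauss_kernel u h = (1 / sqrt (4 * pi * u)) ^ CARD('n) * exp (- (norm h)\<^sup>2 / (4 * u))"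

lemma gauss_kernel_nonneg: "u > 0 \<Longrightarrow> gauss_kernel u h \<ge> 0"
  by (simp add: gauss_kernel_def)

lemma gauss_kernel_measurable [measurable]: "gauss_kernel u \<in> borel_measurable borel"
  unfolding gauss_kernel_def[abs_def] by measurable

lemma gauss_kernel_normalization:
  "u > 0 \<Longrightarrow> (1 / sqrt (4 * pi * u)) ^ k * sqrt (pi / (1 / (4 * u))) ^ k = 1"
  unfolding power_mult_distrib[symmetric] by (simp add: mult_ac)

lemma gauss_kernel_integral:
  assumes u: "u > 0"
  shows "integrable lborel (gauss_kernel u :: real^'n \<Rightarrow> real)"
    and "(LBINT h. gauss_kernel u (h :: real^'n)) = 1"
proof -
  have e: "gauss_kernel u = (\<lambda>h::real^'n. (1 / sqrt (4 * pi * u)) ^ CARD('n) * exp (- (1 / (4 * u)) * (norm h)\<^sup>2))"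
    by (simp add: gauss_kernel_def[abs_def] fun_eq_iff)
  have a: "1 / (4 * u) > 0" using u by simp
  show "integrable lborel (gauss_kernel u :: real^'n \<Rightarrow> real)"
    unfolding e by (intro integrable_mult_right integrable_gaussian(1) a)
  have "(LBINT h. gauss_kernel u (h :: real^'n)) = (1 / sqrt (4 * pi * u)) ^ CARD('n) * sqrt (pi / (1 / (4 * u))) ^ CARD('n)"
    unfolding e integral_mult_right_zero integrable_gaussian(2)[OF a] ..
  also have "\<dots> = 1" by (rule gauss_kernel_normalization[OF u])
  finally show "(LBINT h. gauss_kernel u (h :: real^'n)) = 1" .
qed

lemma gauss_kernel_fourier:
  fixes \<eta> :: "real^'n" assumes u: "u > 0"
  shows "(LBINT h. of_real (gauss_kernel u h) * wave (\<eta> \<bullet> h)) = complex_of_real (exp (- (u * (norm \<eta>)\<^sup>2)))"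
proof -
  have a: "1 / (4 * u) > 0" using u by simp
  have "(LBINT h. of_real (gauss_kernel u h) * wave (\<eta> \<bullet> h)) =
     (LBINT h. of_real ((1 / sqrt (4 * pi * u)) ^ CARD('n)) * (of_real (exp (- (1 / (4 * u)) * (norm h)\<^sup>2)) * wave (\<eta> \<bullet> h)))"
    by (simp add: gauss_kernel_def mult_ac)
  also have "\<dots> = of_real ((1 / sqrt (4 * pi * u)) ^ CARD('n)) * of_real (sqrt (pi / (1 / (4 * u))) ^ CARD('n) * exp (- (norm \<eta>)\<^sup>2 / (4 * (1 / (4 * u)))))"
    unfolding integral_mult_right_zero gaussian_fourier(2)[OF a] ..
  also have "\<dots> = of_real (exp (- (u * (norm \<eta>)\<^sup>2)))"
    unfolding of_real_mult[symmetric] mult.assoc[symmetric] gauss_kernel_normalization[OF u] by (simp add: mult.commute)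
  finally show ?thesis .
qed

text \<open>
  A Gaussian factor before the Fourier transform is a Gaussian average after it.
\<close>
lemma gaussian_damped_fourier:
  fixes f :: "real^'n \<Rightarrow> complex"
  assumes u: "u > 0" and f: "integrable lborel f"
  shows "(LBINT \<eta>. of_real (exp (- (u * (norm \<eta>)\<^sup>2))) * (f \<eta> * wave (\<omega> \<bullet> \<eta>))) =
    (LBINT h. of_real (gauss_kernel u h) * fourier f (\<omega> + h))"
proof -
  have [measurable]: "f \<in> borel_measurable borel" using f by auto
  define F where "F h \<eta> = complex_of_real (gauss_kernel u h) * (f \<eta> * wave ((\<omega> + h) \<bullet> \<eta>))" for h \<eta>
  have meas: "case_prod F \<in> borel_measurable (lborel \<Otimes>\<^sub>M lborel)" unfolding F_def by measurable
  have "integrable (lborel \<Otimes>\<^sub>M lborel) (\<lambda>(h :: real^'n, \<eta>). gauss_kernel u h * norm (f \<eta>))"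
    by (intro integrable_pair_product sigma_finite_lborel gauss_kernel_integral(1) u integrable_norm f)
  then have int: "integrable (lborel \<Otimes>\<^sub>M lborel) (case_prod F)"
    by (rule Bochner_Integration.integrable_bound[OF _ meas])
      (auto simp: F_def norm_mult gauss_kernel_nonneg[OF u])
  have "(LBINT \<eta>. (LBINT h. F h \<eta>)) = (LBINT h. (LBINT \<eta>. F h \<eta>))"
    by (rule lborel_pair.Fubini_integral[OF int])
  moreover have "(LBINT h. F h \<eta>) = of_real (exp (- (u * (norm \<eta>)\<^sup>2))) * (f \<eta> * wave (\<omega> \<bullet> \<eta>))" for \<eta>
  proof -
    have "(LBINT h. F h \<eta>) = (LBINT h. (of_real (gauss_kernel u h) * wave (\<eta> \<bullet> h)) * (f \<eta> * wave (\<omega> \<bullet> \<eta>)))"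
      by (simp add: F_def inner_add_left distrib_left exp_add mult_ac inner_commute[of \<eta>])
    also have "\<dots> = of_real (exp (- (u * (norm \<eta>)\<^sup>2))) * (f \<eta> * wave (\<omega> \<bullet> \<eta>))"
      unfolding integral_mult_left_zero gauss_kernel_fourier[OF u] ..
    finally show ?thesis .
  qed
  moreover have "(LBINT \<eta>. F h \<eta>) = of_real (gauss_kernel u h) * fourier f (\<omega> + h)" for h
    unfolding F_def fourier_def by (rule integral_mult_right_zero)
  ultimately show ?thesis by simp
qed

abbreviation damped_cutoff :: "(real^'n \<Rightarrow> complex) \<Rightarrow> real^'n \<Rightarrow> real \<Rightarrow> real \<Rightarrow> real^'n \<Rightarrow> complex" where
  "damped_cutoff \<phi> \<omega> N u \<eta> \<equiv> of_real (exp (- (u * (norm \<eta>)\<^sup>2))) * (\<phi> (\<eta> /\<^sub>R N) * wave (\<omega> \<bullet> \<eta>))"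

text \<open>
  The inner integral that subordination produces from the cutoff integral.
\<close>
definition cutoff_difference :: "(real^'n \<Rightarrow> complex) \<Rightarrow> real^'n \<Rightarrow> real \<Rightarrow> real \<Rightarrow> complex" where
  "cutoff_difference \<phi> \<omega> N u = (LBINT \<eta>. of_real (1 - exp (- (u * (norm \<eta>)\<^sup>2))) * (\<phi> (\<eta> /\<^sub>R N) * wave (\<omega> \<bullet> \<eta>)))"

context
  fixes \<phi> :: "real^'n \<Rightarrow> complex" and \<omega> :: "real^'n"
  assumes \<phi>: "smooth_compact_support \<phi>" and \<omega>: "norm \<omega> = 1"
begin

lemma cutoff_measurable [measurable]: "\<phi> \<in> borel_measurable borel"
  by (rule smooth_compact_support_measurable[OF \<phi>])

lemma integrable_cutoff_scaled: "N > 0 \<Longrightarrow> integrable lborel (\<lambda>\<eta>. \<phi> (\<eta> /\<^sub>R N))"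
  using lborel_integral_scaleR(1)[of "inverse N" \<phi>] smooth_compact_support_integrable[OF \<phi>] by simp

lemma cutoff_difference_eq:
  assumes N: "N > 0" and u: "u > 0"
  shows "cutoff_difference \<phi> \<omega> N u = of_real (N ^ CARD('n)) * fourier \<phi> (N *\<^sub>R \<omega>) -
    (LBINT \<eta>. damped_cutoff \<phi> \<omega> N u \<eta>)"
proof -
  have 1: "integrable lborel (\<lambda>\<eta>. \<phi> (\<eta> /\<^sub>R N) * wave (\<omega> \<bullet> \<eta>))"
    by (rule integrable_mult_character[OF integrable_cutoff_scaled[OF N]])
  have 2: "integrable lborel (\<lambda>\<eta>. damped_cutoff \<phi> \<omega> N u \<eta>)"
    by (rule Bochner_Integration.integrable_bound[OF 1]) (use u in \<open>auto simp: norm_mult mult_left_le_one_le\<close>)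
  have "cutoff_difference \<phi> \<omega> N u = (LBINT \<eta>. \<phi> (\<eta> /\<^sub>R N) * wave (\<omega> \<bullet> \<eta>) -
     damped_cutoff \<phi> \<omega> N u \<eta>)"
    unfolding cutoff_difference_def by (simp add: left_diff_distrib)
  also have "\<dots> = (LBINT \<eta>. \<phi> (\<eta> /\<^sub>R N) * wave (\<omega> \<bullet> \<eta>)) -
    (LBINT \<eta>. damped_cutoff \<phi> \<omega> N u \<eta>)"
    by (rule Bochner_Integration.integral_diff[OF 1 2])
  also have "(LBINT \<eta>. \<phi> (\<eta> /\<^sub>R N) * wave (\<omega> \<bullet> \<eta>)) = of_real (N ^ CARD('n)) * fourier \<phi> (N *\<^sub>R \<omega>)"
    using fourier_scaled[OF cutoff_measurable N, of \<omega>] by (simp add: fourier_def)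
  finally show ?thesis .
qed

text \<open>
  Away from the origin the transform of \<open>\<phi>(\<eta>/N)\<close> is smaller than every power of \<open>1/N\<close>.
\<close>
lemma scaled_fourier_decay:
  "\<exists>C\<ge>0. \<forall>N>0. \<forall>z. norm z \<ge> 1 / 2 \<longrightarrow> N ^ k * norm (fourier \<phi> (N *\<^sub>R z)) \<le> C"
proof -
  obtain C where C: "C \<ge> 0" "\<And>z. norm z ^ k * norm (fourier \<phi> z) \<le> C" using fourier_decay[OF \<phi>] by blast
  have "N ^ k * norm (fourier \<phi> (N *\<^sub>R z)) \<le> 2 ^ k * C" if "N > 0" "norm z \<ge> 1 / 2" for N z
  proof -
    have "N * 1 \<le> N * (2 * norm z)" using that by (intro mult_left_mono) auto
    then have "N ^ k \<le> (2 * norm (N *\<^sub>R z)) ^ k" using that by (intro power_mono) auto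
    then have "N ^ k * norm (fourier \<phi> (N *\<^sub>R z)) \<le> (2 * norm (N *\<^sub>R z)) ^ k * norm (fourier \<phi> (N *\<^sub>R z))"
      by (intro mult_right_mono) auto
    also have "\<dots> = 2 ^ k * (norm (N *\<^sub>R z) ^ k * norm (fourier \<phi> (N *\<^sub>R z)))" unfolding power_mult_distrib by simp
    also have "\<dots> \<le> 2 ^ k * C" by (intro mult_left_mono C) auto
    finally show ?thesis .
  qed
  then show ?thesis using C(1) by (intro exI[of _ "2 ^ k * C"]) auto
qed

lemma cutoff_difference_bound_large_time:
  "\<exists>C\<ge>0. \<forall>N>0. \<forall>u\<ge>1. norm (cutoff_difference \<phi> \<omega> N u) \<le> C"
proof -
  obtain C where C: "C \<ge> 0" "\<And>N z. N > 0 \<Longrightarrow> norm z \<ge> 1 / 2 \<Longrightarrow> N ^ CARD('n) * norm (fourier \<phi> (N *\<^sub>R z)) \<le> C"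
    using scaled_fourier_decay by blast
  obtain B where B: "B \<ge> 0" "\<And>x. norm (\<phi> x) \<le> B" using smooth_compact_support_bounded[OF \<phi>] by blast
  define D where "D = (LBINT \<eta>. B * exp (- 1 * (norm (\<eta>::real^'n))\<^sup>2))"
  have D: "D \<ge> 0" unfolding D_def using B by (intro Bochner_Integration.integral_nonneg) auto
  have "norm (cutoff_difference \<phi> \<omega> N u) \<le> C + D" if N: "N > 0" and u: "u \<ge> 1" for N u
  proof -
    have "norm (LBINT \<eta>. damped_cutoff \<phi> \<omega> N u \<eta>) \<le> D"
      unfolding D_def
    proof (rule Bochner_Integration.integral_norm_bound_integral)
      show i: "integrable lborel (\<lambda>\<eta>::real^'n. B * exp (- 1 * (norm \<eta>)\<^sup>2))" by (intro integrable_mult_right integrable_gaussian) auto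
      show b: "norm (damped_cutoff \<phi> \<omega> N u \<eta>) \<le> B * exp (- 1 * (norm \<eta>)\<^sup>2)" for \<eta>
      proof -
        have "exp (- (u * (norm \<eta>)\<^sup>2)) * norm (\<phi> (\<eta> /\<^sub>R N)) \<le> exp (- 1 * (norm \<eta>)\<^sup>2) * B"
          using u by (intro mult_mono B) (auto intro: mult_right_mono[of 1 u "(norm \<eta>)\<^sup>2", simplified])
        then show ?thesis by (simp add: norm_mult mult.commute)
      qed
      show "integrable lborel (\<lambda>\<eta>. damped_cutoff \<phi> \<omega> N u \<eta>)"
        by (rule Bochner_Integration.integrable_bound[OF i]) (auto intro!: AE_I2 order_trans[OF b] simp del: exp_of_real)
    qed
    moreover have "norm (of_real (N ^ CARD('n)) * fourier \<phi> (N *\<^sub>R \<omega>)) \<le> C"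
      using C(2)[OF N, of \<omega>] \<omega> N by (simp add: norm_mult norm_power)
    ultimately show ?thesis using cutoff_difference_eq[OF N, of u] u
      norm_triangle_ineq4[of "of_real (N ^ CARD('n)) * fourier \<phi> (N *\<^sub>R \<omega>)" "LBINT \<eta>. damped_cutoff \<phi> \<omega> N u \<eta>"]
      by simp
  qed
  then show ?thesis using C D by (intro exI[of _ "C + D"]) auto
qed

text \<open>
  From \<open>1 - e\<^bsup>-y\<^esup> \<le> y\<close> alone. The growth in \<open>N\<close> is harmless as long as \<open>N\<close> is at most a small
  negative power of \<open>u\<close>.
\<close>
lemma cutoff_difference_bound_crude:
  "\<exists>C\<ge>0. \<forall>N>0. \<forall>u>0. norm (cutoff_difference \<phi> \<omega> N u) \<le> C * u * N ^ (CARD('n) + 2)"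
proof -
  obtain R where R: "\<And>x. norm x > R \<Longrightarrow> \<phi> x = 0" using \<phi> by (auto simp: smooth_compact_support_iff)
  define w where "w x = (norm x)\<^sup>2 * norm (\<phi> x)" for x
  have w: "integrable lborel w" unfolding w_def
    by (rule continuous_compact_support_integrable[where R=R])
      (use R in \<open>auto intro!: continuous_intros smooth_compact_support_continuous[OF \<phi>]\<close>)
  have [measurable]: "w \<in> borel_measurable borel" using w by auto
  define C where "C = (LBINT x. w x)"
  have C: "C \<ge> 0" unfolding C_def w_def by (intro Bochner_Integration.integral_nonneg) auto
  have "norm (cutoff_difference \<phi> \<omega> N u) \<le> C * u * N ^ (CARD('n) + 2)" if N: "N > 0" and u: "u > 0" for N u
  proof -
    have i: "integrable lborel (\<lambda>\<eta>. (u * N\<^sup>2) * w (\<eta> /\<^sub>R N))"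
      using lborel_integral_scaleR(1)[of "inverse N" w] w N by (intro integrable_mult_right) simp
    have b: "norm (complex_of_real (1 - exp (- (u * (norm \<eta>)\<^sup>2))) * (\<phi> (\<eta> /\<^sub>R N) * wave (\<omega> \<bullet> \<eta>))) \<le> (u * N\<^sup>2) * w (\<eta> /\<^sub>R N)" for \<eta>
    proof -
      have "norm (complex_of_real (1 - exp (- (u * (norm \<eta>)\<^sup>2)))) = 1 - exp (- (u * (norm \<eta>)\<^sup>2))"
        unfolding norm_of_real using u by (intro abs_of_nonneg) auto
      also have "\<dots> \<le> u * (norm \<eta>)\<^sup>2" using exp_ge_add_one_self[of "- (u * (norm \<eta>)\<^sup>2)"] by linarith
      finally have "norm (complex_of_real (1 - exp (- (u * (norm \<eta>)\<^sup>2))) * (\<phi> (\<eta> /\<^sub>R N) * wave (\<omega> \<bullet> \<eta>))) \<le> u * (norm \<eta>)\<^sup>2 * norm (\<phi> (\<eta> /\<^sub>R N))"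
        unfolding norm_mult norm_exp_i_times by (simp add: mult_right_mono)
      also have "\<dots> = (u * N\<^sup>2) * w (\<eta> /\<^sub>R N)" using N by (simp add: w_def power_mult_distrib field_simps)
      finally show ?thesis .
    qed
    have "norm (cutoff_difference \<phi> \<omega> N u) \<le> (LBINT \<eta>. (u * N\<^sup>2) * w (\<eta> /\<^sub>R N))"
      unfolding cutoff_difference_def
      by (rule Bochner_Integration.integral_norm_bound_integral[OF _ i b], rule Bochner_Integration.integrable_bound[OF i])
        (measurable, intro AE_I2 order_trans[OF b], simp)
    also have "\<dots> = (u * N\<^sup>2) * (N ^ CARD('n) * C)"
      unfolding integral_mult_right_zero C_def using lborel_integral_scaleR(2)[OF N, of "\<lambda>\<eta>. w (\<eta> /\<^sub>R N)"] N by simp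
    finally show ?thesis by (simp add: power_add power2_eq_square mult_ac)
  qed
  then show ?thesis using C by blast
qed

text \<open>
  The transform \<open>\<psi>\<close> of \<open>\<phi>(\<eta>/N)\<close> is concentrated near the origin, while \<open>\<omega>\<close> has norm one. In the
  Gaussian average of \<open>\<psi>(\<omega> + h)\<close>, displacements with \<open>|h| \<le> 1/2\<close> keep the argument away from the
  origin, where \<open>\<psi>\<close> is of order \<open>N\<^bsup>-k\<^esup>\<close>; for larger displacements the Gaussian density is at most
  of order \<open>u\<close>, and the integral of \<open>|\<psi>|\<close> is independent of \<open>N\<close>.
\<close>
lemma cutoff_difference_bound_smooth:
  "\<exists>C\<ge>0. \<forall>N>0. \<forall>u>0. u \<le> 1 \<longrightarrow> norm (cutoff_difference \<phi> \<omega> N u) \<le> C * (u + 1 / N ^ k)"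
proof -
  define d where "d = CARD('n)"
  obtain C where C: "C \<ge> 0" "\<And>N z. N > 0 \<Longrightarrow> norm z \<ge> 1 / 2 \<Longrightarrow> N ^ (d + k) * norm (fourier \<phi> (N *\<^sub>R z)) \<le> C"
    using scaled_fourier_decay by blast
  obtain D where D: "D \<ge> 0" "\<And>u. u > 0 \<Longrightarrow> u \<le> 1 \<Longrightarrow> sqrt ((1 / (4 * pi)) / u) ^ d * exp (- (1 / 16) / u) \<le> D * u"
    using gaussian_peak_bound[of "1/16" "1 / (4 * pi)" d] by auto
  define L where "L = (LBINT z. norm (fourier \<phi> z))"
  have L: "L \<ge> 0" unfolding L_def by (intro Bochner_Integration.integral_nonneg) auto
  have Li: "integrable lborel (\<lambda>z. norm (fourier \<phi> z))" by (rule integrable_norm[OF integrable_fourier[OF \<phi>]])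
  note [measurable] = fourier_measurable[OF cutoff_measurable]
  have main: "norm (cutoff_difference \<phi> \<omega> N u) \<le> (2 * C + D * L) * (u + 1 / N ^ k)" if N: "N > 0" and u: "u > 0" "u \<le> 1" for N u
  proof -
    define \<psi> where "\<psi> z = of_real (N ^ d) * fourier \<phi> (N *\<^sub>R z)" for z
    have [measurable]: "\<psi> \<in> borel_measurable borel" unfolding \<psi>_def by measurable
    have \<psi>: "norm (\<psi> z) \<le> C / N ^ k" if "norm z \<ge> 1 / 2" for z
      using C(2)[OF N that] N by (simp add: \<psi>_def norm_mult norm_power power_add field_simps)
    have \<psi>i: "integrable lborel (\<lambda>z. norm (\<psi> z))" and \<psi>L: "(LBINT z. norm (\<psi> z)) = L"
    proof -
      have e: "norm (\<psi> z) = N ^ d * norm (fourier \<phi> (N *\<^sub>R z))" for z using N by (simp add: \<psi>_def norm_mult norm_power)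
      show "integrable lborel (\<lambda>z. norm (\<psi> z))" unfolding e
        using lborel_integral_scaleR(1)[OF N, of "\<lambda>z. norm (fourier \<phi> z)"] Li by (intro integrable_mult_right) simp
      show "(LBINT z. norm (\<psi> z)) = L" unfolding e L_def
        using lborel_integral_scaleR(2)[OF N, of "\<lambda>z. norm (fourier \<phi> z)"] by (simp add: d_def)
    qed
    have "(LBINT \<eta>. damped_cutoff \<phi> \<omega> N u \<eta>) = (LBINT h. of_real (gauss_kernel u h) * \<psi> (\<omega> + h))"
      unfolding gaussian_damped_fourier[OF u(1) integrable_cutoff_scaled[OF N]] fourier_scaled[OF cutoff_measurable N] \<psi>_def d_def by simp
    also have "norm \<dots> \<le> (LBINT h. C / N ^ k * gauss_kernel u h + D * u * norm (\<psi> (\<omega> + h)))"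
    proof (rule Bochner_Integration.integral_norm_bound_integral)
      show i: "integrable lborel (\<lambda>h. C / N ^ k * gauss_kernel u h + D * u * norm (\<psi> (\<omega> + h)))"
        using \<psi>i lborel_integral_translate(2)[of "\<lambda>z. norm (\<psi> z)" \<omega>]
        by (intro Bochner_Integration.integrable_add integrable_mult_right gauss_kernel_integral u) auto
      show b: "norm (complex_of_real (gauss_kernel u h) * \<psi> (\<omega> + h)) \<le> C / N ^ k * gauss_kernel u h + D * u * norm (\<psi> (\<omega> + h))" for h
      proof (cases "norm h \<le> 1 / 2")
        case True
        have "norm (\<omega> + h) \<ge> 1 / 2" using norm_diff_ineq[of \<omega> h] \<omega> True by simp
        then have "gauss_kernel u h * norm (\<psi> (\<omega> + h)) \<le> gauss_kernel u h * (C / N ^ k)"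
          by (intro mult_left_mono \<psi> gauss_kernel_nonneg u)
        moreover have "0 \<le> D * u * norm (\<psi> (\<omega> + h))" using D u by simp
        ultimately show ?thesis using gauss_kernel_nonneg[OF u(1), of h] by (simp add: norm_mult mult.commute)
      next
        case False
        have "(1 / 2)\<^sup>2 \<le> (norm h)\<^sup>2" using False by (intro power_mono) auto
        then have "1 / 16 / u \<le> (norm h)\<^sup>2 / (4 * u)" using u by (simp add: field_simps power2_eq_square)
        then have "gauss_kernel u h \<le> (1 / sqrt (4 * pi * u)) ^ d * exp (- (1 / 16) / u)"
          unfolding gauss_kernel_def d_def using u by (intro mult_left_mono) auto
        also have "\<dots> \<le> D * u" using D(2)[OF u] u by (simp add: real_sqrt_divide real_sqrt_mult)
        finally have "gauss_kernel u h * norm (\<psi> (\<omega> + h)) \<le> D * u * norm (\<psi> (\<omega> + h))" by (intro mult_right_mono) auto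
        moreover have "0 \<le> C / N ^ k * gauss_kernel u h" using C N gauss_kernel_nonneg[OF u(1), of h] by simp
        ultimately show ?thesis using gauss_kernel_nonneg[OF u(1), of h] by (simp add: norm_mult)
      qed
      show "integrable lborel (\<lambda>h. complex_of_real (gauss_kernel u h) * \<psi> (\<omega> + h))"
        by (rule Bochner_Integration.integrable_bound[OF i]) (measurable, intro AE_I2 order_trans[OF b], simp)
    qed
    also have "\<dots> = C / N ^ k + D * u * L"
      using \<psi>i lborel_integral_translate[of "\<lambda>z. norm (\<psi> z)" \<omega>] gauss_kernel_integral[OF u(1), where 'n='n] \<psi>L
      by (subst Bochner_Integration.integral_add) (auto intro!: integrable_mult_right)
    finally have 1: "norm (LBINT \<eta>. damped_cutoff \<phi> \<omega> N u \<eta>) \<le> C / N ^ k + D * u * L" .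
    have 2: "norm (\<psi> \<omega>) \<le> C / N ^ k" using \<psi>[of \<omega>] \<omega> by simp
    have "norm (cutoff_difference \<phi> \<omega> N u) \<le> C / N ^ k + (C / N ^ k + D * u * L)"
      unfolding cutoff_difference_eq[OF N u(1)] d_def[symmetric] \<psi>_def[symmetric]
      by (rule order_trans[OF norm_triangle_ineq4 add_mono[OF 2 1]])
    also have "\<dots> \<le> (2 * C + D * L) * (u + 1 / N ^ k)"
      using C(1) D(1) L N u by (simp add: algebra_simps)
    finally show ?thesis .
  qed
  then show ?thesis using C D L by (intro exI[of _ "2 * C + D * L"]) auto
qed

text \<open>
  For \<open>u \<le> 1\<close> the crude bound serves for \<open>N \<le> u\<^bsup>-\<delta>\<^esup>\<close> and the one from smoothness beyond. Any
  exponent of \<open>u\<close> strictly between \<open>s\<close> and 1 would do; it must exceed \<open>s\<close> to be integrable against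
  \<open>u\<^bsup>-1-s\<^esup>\<close>, and it falls short of 1 by the price of the crude bound.
\<close>
lemma cutoff_difference_bound:
  assumes s: "0 < s" "s < 1"
  shows "\<exists>C\<ge>0. \<forall>N\<ge>1. \<forall>u>0. norm (cutoff_difference \<phi> \<omega> N u) \<le> C * min 1 (u powr ((1 + s) / 2))"
proof -
  define d where "d = CARD('n)"
  define \<theta> where "\<theta> = (1 + s) / 2"
  define \<delta> where "\<delta> = (1 - s) / (2 * (real d + 2))"
  have \<theta>: "0 < \<theta>" "\<theta> < 1" using s by (auto simp: \<theta>_def)
  have \<delta>: "\<delta> > 0" "\<delta> * (real d + 2) = 1 - \<theta>" using s by (auto simp: \<delta>_def \<theta>_def field_simps)
  \<comment> \<open>The choice of \<open>\<delta>\<close> makes \<open>u N\<^bsup>d+2\<^esup> \<le> u\<^sup>\<theta>\<close> up to \<open>N = u\<^bsup>-\<delta>\<^esup>\<close>, and \<open>k\<close> makes \<open>N\<^bsup>-k\<^esup> \<le> u\<close> beyond.\<close>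
  obtain k :: nat where k: "real k \<ge> 1 / \<delta>" using real_arch_simple by blast
  then have k: "\<delta> * real k \<ge> 1" using \<delta> by (simp add: field_simps)
  obtain C1 where C1: "C1 \<ge> 0" "\<And>N u. N > 0 \<Longrightarrow> u \<ge> 1 \<Longrightarrow> norm (cutoff_difference \<phi> \<omega> N u) \<le> C1"
    using cutoff_difference_bound_large_time by blast
  obtain C2 where C2: "C2 \<ge> 0" "\<And>N u. N > 0 \<Longrightarrow> u > 0 \<Longrightarrow> norm (cutoff_difference \<phi> \<omega> N u) \<le> C2 * u * N ^ (d + 2)"
    using cutoff_difference_bound_crude unfolding d_def by blast
  obtain C3 where C3: "C3 \<ge> 0" "\<And>N u. N > 0 \<Longrightarrow> u > 0 \<Longrightarrow> u \<le> 1 \<Longrightarrow> norm (cutoff_difference \<phi> \<omega> N u) \<le> C3 * (u + 1 / N ^ k)"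
    using cutoff_difference_bound_smooth[of k] by blast
  define C where "C = C1 + C2 + 2 * C3"
  have C: "C \<ge> 0" using C1 C2 C3 by (simp add: C_def)
  have "norm (cutoff_difference \<phi> \<omega> N u) \<le> C * min 1 (u powr \<theta>)" if N: "N \<ge> 1" and u: "u > 0" for N u
  proof (cases "u \<ge> 1")
    case True
    then have "u powr \<theta> \<ge> 1" using \<theta> by (intro ge_one_powr_ge_zero) auto
    then show ?thesis using C1(2)[of N u] C1(1) C2(1) C3(1) True N by (simp add: C_def min_def)
  next
    case False
    have m: "min 1 (u powr \<theta>) = u powr \<theta>" using False u \<theta> by (intro min_absorb2) (auto intro: powr_le1)
    have ut: "u \<le> u powr \<theta>" using powr_mono'[of \<theta> 1 u] False u \<theta> by simp
    show ?thesis
    proof (cases "N \<le> u powr (- \<delta>)")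
      case True
      have "N ^ (d + 2) \<le> (u powr (- \<delta>)) ^ (d + 2)" using True N by (intro power_mono) auto
      also have "\<dots> = (u powr (- \<delta>)) powr real (d + 2)" using u by (intro powr_realpow[symmetric]) simp
      also have "\<dots> = u powr (- \<delta> * (real d + 2))" by (simp add: powr_powr add.commute)
      also have "- \<delta> * (real d + 2) = \<theta> - 1" using \<delta> by simp
      finally have "u * N ^ (d + 2) \<le> u powr 1 * u powr (\<theta> - 1)" using u by (simp add: mult_left_mono)
      also have "\<dots> = u powr \<theta>" unfolding powr_add[symmetric] by simp
      finally have "C2 * (u * N ^ (d + 2)) \<le> C2 * u powr \<theta>" using C2(1) by (intro mult_left_mono) auto
      then have "norm (cutoff_difference \<phi> \<omega> N u) \<le> C2 * u powr \<theta>" using C2(2)[of N u] N u by (simp add: mult_ac)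
      also have "\<dots> \<le> C * u powr \<theta>" using C1 C3 by (intro mult_right_mono) (auto simp: C_def)
      finally show ?thesis unfolding m .
    next
      case large: False
      have "u powr (- 1) \<le> u powr (- (\<delta> * real k))" using k u False by (intro powr_mono') auto
      also have "\<dots> = (u powr (- \<delta>)) ^ k" using u by (simp add: powr_powr flip: powr_realpow)
      also have "\<dots> \<le> N ^ k" using large by (intro power_mono) auto
      finally have "1 / u \<le> N ^ k" using u by (simp add: powr_minus_divide)
      then have "1 / N ^ k \<le> u" using u N by (simp add: field_simps)
      then have "C3 * (u + 1 / N ^ k) \<le> C3 * (2 * u powr \<theta>)" using ut C3(1) by (intro mult_left_mono) auto
      then have "norm (cutoff_difference \<phi> \<omega> N u) \<le> (2 * C3) * u powr \<theta>" using C3(2)[of N u] N u False by simp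
      also have "\<dots> \<le> C * u powr \<theta>" using C1 C2 by (intro mult_right_mono) (auto simp: C_def)
      finally show ?thesis unfolding m .
    qed
  qed
  then show ?thesis using C unfolding \<theta>_def by blast
qed

lemma cutoff_difference_tendsto:
  assumes one: "\<And>x. norm x \<le> 1 / 2 \<Longrightarrow> \<phi> x = 1" and u: "u > 0"
  shows "((\<lambda>N. cutoff_difference \<phi> \<omega> N u) \<longlongrightarrow> - of_real (heat_profile TYPE('n) u)) at_top"
proof -
  define d where "d = CARD('n)"
  obtain B where B: "B \<ge> 0" "\<And>x. norm (\<phi> x) \<le> B" using smooth_compact_support_bounded[OF \<phi>] by blast
  obtain C where C: "C \<ge> 0" "\<And>N z. N > 0 \<Longrightarrow> norm z \<ge> 1 / 2 \<Longrightarrow> N ^ (d + 1) * norm (fourier \<phi> (N *\<^sub>R z)) \<le> C"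
    using scaled_fourier_decay by blast
  have l1: "((\<lambda>N. of_real (N ^ d) * fourier \<phi> (N *\<^sub>R \<omega>)) \<longlongrightarrow> 0) at_top"
  proof (rule Lim_null_comparison)
    show "\<forall>\<^sub>F N in at_top. norm (complex_of_real (N ^ d) * fourier \<phi> (N *\<^sub>R \<omega>)) \<le> C / N"
      using eventually_gt_at_top[of 0]
    proof eventually_elim
      case (elim N)
      then show ?case using C(2)[of N \<omega>] \<omega> by (simp add: norm_mult norm_power field_simps)
    qed
    show "((\<lambda>N. C / N) \<longlongrightarrow> 0) at_top" by (rule real_tendsto_divide_at_top[OF tendsto_const filterlim_ident])
  qed
  have l2: "((\<lambda>N. LBINT \<eta>. damped_cutoff \<phi> \<omega> N u \<eta>) \<longlongrightarrow>
     (LBINT \<eta>. of_real (exp (- u * (norm \<eta>)\<^sup>2)) * wave (\<omega> \<bullet> \<eta>))) at_top"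
  proof (rule integral_dominated_convergence_at_top)
    show "integrable lborel (\<lambda>\<eta>::real^'n. B * exp (- u * (norm \<eta>)\<^sup>2))" by (intro integrable_mult_right integrable_gaussian u)
    show "\<forall>\<^sub>F N in at_top. AE \<eta> in lborel. norm (damped_cutoff \<phi> \<omega> N u \<eta>) \<le> B * exp (- u * (norm \<eta>)\<^sup>2)"
      using B by (intro always_eventually allI AE_I2) (simp add: norm_mult mult.commute mult_right_mono)
    show "AE \<eta> in lborel. ((\<lambda>N. damped_cutoff \<phi> \<omega> N u \<eta>) \<longlongrightarrow> of_real (exp (- u * (norm \<eta>)\<^sup>2)) * wave (\<omega> \<bullet> \<eta>)) at_top"
    proof (rule AE_I2, rule tendsto_eventually)
      fix \<eta> :: "real^'n"
      show "\<forall>\<^sub>F N in at_top. damped_cutoff \<phi> \<omega> N u \<eta> = of_real (exp (- u * (norm \<eta>)\<^sup>2)) * wave (\<omega> \<bullet> \<eta>)"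
        using eventually_gt_at_top[of "max 0 (2 * norm \<eta>)"]
      proof eventually_elim
        case (elim N)
        then have N: "2 * norm \<eta> < N" "N > 0" using norm_ge_zero[of \<eta>] by (simp_all only: max_less_iff_conj)
        then have "norm (\<eta> /\<^sub>R N) = norm \<eta> / N" by (simp add: divide_inverse mult.commute)
        also have "\<dots> \<le> 1 / 2" using N by (simp add: field_simps)
        finally show ?case by (simp add: one)
      qed
    qed
  qed measurable
  have "(LBINT \<eta>. of_real (exp (- u * (norm \<eta>)\<^sup>2)) * wave (\<omega> \<bullet> \<eta>)) = complex_of_real (heat_profile TYPE('n) u)"
    unfolding gaussian_fourier(2)[OF u] \<omega> heat_profile_def by simp
  with tendsto_diff[OF l1 l2]
  have "((\<lambda>N. of_real (N ^ d) * fourier \<phi> (N *\<^sub>R \<omega>) - (LBINT \<eta>. damped_cutoff \<phi> \<omega> N u \<eta>)) \<longlongrightarrow> - of_real (heat_profile TYPE('n) u)) at_top"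
    by simp
  then show ?thesis
    by (rule Lim_transform_eventually)
      (use eventually_gt_at_top[of 0] in \<open>eventually_elim, simp add: cutoff_difference_eq u d_def\<close>)
qed

lemma cutoff_integral_tendsto:
  assumes one: "\<And>x. norm x \<le> 1 / 2 \<Longrightarrow> \<phi> x = 1" and s: "0 < s" "s < 1"
  shows "(cutoff_integral s \<phi> \<omega> \<longlongrightarrow> levy_amplitude TYPE('n) s) at_top"
proof -
  obtain R where R: "\<And>x. norm x > R \<Longrightarrow> \<phi> x = 0" using \<phi> by (auto simp: smooth_compact_support_iff)
  obtain C where C: "C \<ge> 0" "\<And>N u. N \<ge> 1 \<Longrightarrow> u > 0 \<Longrightarrow> norm (cutoff_difference \<phi> \<omega> N u) \<le> C * min 1 (u powr ((1 + s) / 2))"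
    using cutoff_difference_bound[OF s] by blast
  have eq: "cutoff_integral s \<phi> \<omega> N = of_real (1 / levy_const s) * (LBINT u. of_real (levy_density s u) * cutoff_difference \<phi> \<omega> N u)"
    if N: "N > 0" for N
  proof -
    define g where "g \<eta> = \<phi> (\<eta> /\<^sub>R N) * wave (\<omega> \<bullet> \<eta>)" for \<eta>
    have cg: "continuous_on UNIV g" unfolding g_def
      by (intro continuous_intros continuous_on_compose2[OF smooth_compact_support_continuous[OF \<phi>]]) auto
    have gR: "g \<eta> = 0" if "norm \<eta> > N * R" for \<eta>
    proof -
      have "norm (\<eta> /\<^sub>R N) > R" using that N by (simp add: field_simps)
      then show ?thesis by (simp add: g_def R)
    qed
    have "(LBINT \<eta>. of_real (((norm \<eta>)\<^sup>2) powr s) * g \<eta>) = of_real (1 / levy_const s) *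
      (LBINT u. of_real (levy_density s u) * (LBINT \<eta>. of_real (1 - exp (- (u * (norm \<eta>)\<^sup>2))) * g \<eta>))"
    proof (rule powr_integral_subordination[OF s])
      show "integrable lborel g" by (rule continuous_compact_support_integrable[OF cg gR])
      show "integrable lborel (\<lambda>x. (norm x)\<^sup>2 * norm (g x))"
        by (rule continuous_compact_support_integrable[where R="N * R"]) (auto intro!: continuous_intros cg simp: gR)
    qed auto
    moreover have "((norm \<eta>)\<^sup>2) powr s = norm \<eta> powr (2 * s)" for \<eta> :: "real^'n"
    proof (cases "\<eta> = 0")
      case False
      then have "(norm \<eta>)\<^sup>2 = norm \<eta> powr 2" by simp
      then show ?thesis by (simp only: powr_powr)
    qed simp
    ultimately show ?thesis unfolding cutoff_integral_def cutoff_difference_def g_def by (simp add: mult.assoc)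
  qed
  have "((\<lambda>N. LBINT u. of_real (levy_density s u) * cutoff_difference \<phi> \<omega> N u) \<longlongrightarrow> (LBINT u. - (of_real (levy_density s u) * of_real (heat_profile TYPE('n) u)))) at_top"
  proof (rule integral_dominated_convergence_at_top)
    show "integrable lborel (\<lambda>u. C * (min 1 (u powr ((1 + s) / 2)) * levy_density s u))"
      by (intro integrable_mult_right integrable_levy_density) (use s in auto)
    show "\<forall>\<^sub>F N in at_top. AE u in lborel. norm (complex_of_real (levy_density s u) * cutoff_difference \<phi> \<omega> N u) \<le> C * (min 1 (u powr ((1 + s) / 2)) * levy_density s u)"
      using eventually_ge_at_top[of 1]
    proof (eventually_elim, intro AE_I2)
      fix N u :: real assume N: "1 \<le> N"
      show "norm (complex_of_real (levy_density s u) * cutoff_difference \<phi> \<omega> N u) \<le> C * (min 1 (u powr ((1 + s) / 2)) * levy_density s u)"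
      proof (cases "u > 0")
        case True
        have "norm (complex_of_real (levy_density s u) * cutoff_difference \<phi> \<omega> N u) = levy_density s u * norm (cutoff_difference \<phi> \<omega> N u)"
          by (simp only: norm_mult norm_of_real abs_of_nonneg[OF levy_density_nonneg])
        also have "\<dots> \<le> levy_density s u * (C * min 1 (u powr ((1 + s) / 2)))" by (intro mult_left_mono C N True levy_density_nonneg)
        finally show ?thesis by (simp add: mult_ac)
      qed (simp add: levy_density_def)
    qed
    show "AE u in lborel. ((\<lambda>N. complex_of_real (levy_density s u) * cutoff_difference \<phi> \<omega> N u) \<longlongrightarrow> - (of_real (levy_density s u) * of_real (heat_profile TYPE('n) u))) at_top"
    proof (rule AE_I2)
      fix u
      show "((\<lambda>N. complex_of_real (levy_density s u) * cutoff_difference \<phi> \<omega> N u) \<longlongrightarrow> - (of_real (levy_density s u) * of_real (heat_profile TYPE('n) u))) at_top"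
      proof (cases "u > 0")
        case True
        from tendsto_mult_left[OF cutoff_difference_tendsto[OF one True], of "of_real (levy_density s u)"]
        show ?thesis by simp
      qed (simp add: levy_density_def)
    qed
  qed (unfold cutoff_difference_def, measurable)
  from tendsto_mult_left[OF this, of "of_real (1 / levy_const s)"]
  have "((\<lambda>N. of_real (1 / levy_const s) * (LBINT u. of_real (levy_density s u) * cutoff_difference \<phi> \<omega> N u)) \<longlongrightarrow> levy_amplitude TYPE('n) s) at_top"
    by (simp add: levy_amplitude_def)
  then show ?thesis
    by (rule Lim_transform_eventually) (use eventually_gt_at_top[of 0] in \<open>eventually_elim, simp add: eq\<close>)
qed

end

section \<open>Absolute convergence of the Fourier series\<close>

text \<open>Unordered sums are integrals against counting measure, so that dominated convergence and Fubini
  apply to them.\<close>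
abbreviation unordered_sum :: "('a \<Rightarrow> 'b) \<Rightarrow> 'b::{banach, second_countable_topology}" (binder "\<Sum>\<^sub>c" 10) where
  "unordered_sum f \<equiv> integral\<^sup>L (count_space UNIV) f"

abbreviation summable_c :: "('a \<Rightarrow> 'b::{banach, second_countable_topology}) \<Rightarrow> bool" where
  "summable_c f \<equiv> integrable (count_space UNIV) f"

lemma count_space_Fubini:
  fixes f :: "'a::countable \<Rightarrow> 'b \<Rightarrow> complex"
  assumes N: "sigma_finite_measure N" and f: "\<And>a. integrable N (f a)"
    and s: "summable_c (\<lambda>a. LINT y|N. norm (f a y))"
  shows "(LINT y|N. (\<Sum>\<^sub>c a. f a y)) = (\<Sum>\<^sub>c a. (LINT y|N. f a y))"
    and "integrable N (\<lambda>y. \<Sum>\<^sub>c a. f a y)"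
    and "(LINT y|N. norm (\<Sum>\<^sub>c a. f a y)) \<le> (\<Sum>\<^sub>c a. (LINT y|N. norm (f a y)))"
    and "AE y in N. summable_c (\<lambda>a. f a y)"
proof -
  interpret pair_sigma_finite "count_space (UNIV :: 'a set)" N
    using N by (simp add: pair_sigma_finite_def sigma_finite_measure_count_space)
  have meas: "case_prod f \<in> borel_measurable (count_space UNIV \<Otimes>\<^sub>M N)"
    by (rule measurable_pair_measure_countable1) (use f in auto)
  have int: "integrable (count_space UNIV \<Otimes>\<^sub>M N) (case_prod f)"
    by (rule Fubini_integrable[OF meas]) (use f s in auto)
  show "(LINT y|N. (\<Sum>\<^sub>c a. f a y)) = (\<Sum>\<^sub>c a. (LINT y|N. f a y))"
    by (rule Fubini_integral[OF int])
  show i: "integrable N (\<lambda>y. \<Sum>\<^sub>c a. f a y)"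
    by (rule integrable_snd[OF int])
  show "AE y in N. summable_c (\<lambda>a. f a y)"
    by (rule AE_integrable_snd[OF int])
  have int': "integrable (count_space UNIV \<Otimes>\<^sub>M N) (case_prod (\<lambda>a y. norm (f a y)))"
    using integrable_norm[OF int] by (simp add: case_prod_unfold)
  have "(LINT y|N. norm (\<Sum>\<^sub>c a. f a y)) \<le> (LINT y|N. (\<Sum>\<^sub>c a. norm (f a y)))"
    by (intro integral_mono integrable_norm i integrable_snd[OF int'] integral_norm_bound)
  also have "\<dots> = (\<Sum>\<^sub>c a. (LINT y|N. norm (f a y)))"
    by (rule Fubini_integral[OF int'])
  finally show "(LINT y|N. norm (\<Sum>\<^sub>c a. f a y)) \<le> (\<Sum>\<^sub>c a. (LINT y|N. norm (f a y)))" .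
qed

lemma bij_shift: "bij (\<lambda>z. c - z :: 'a::ab_group_add)" "bij (\<lambda>z. z - c)" "bij (\<lambda>z. z + c)"
proof -
  show "bij (\<lambda>z. c - z)" by (rule bij_betw_byWitness[where f'="\<lambda>z. c - z"]) auto
  show "bij (\<lambda>z. z - c)" by (rule bij_betw_byWitness[where f'="\<lambda>z. z + c"]) auto
  show "bij (\<lambda>z. z + c)" by (rule bij_betw_byWitness[where f'="\<lambda>z. z - c"]) auto
qed

text \<open>
  The coefficients of \<open>(1 - y)\<^sup>s\<close>.
\<close>
definition alt_binomial :: "real \<Rightarrow> nat \<Rightarrow> real" where
  "alt_binomial s k = (-1) ^ k * (s gchoose k)"

lemma alt_binomial_Suc: "alt_binomial s (Suc k) = alt_binomial s k * ((real k - s) / (real k + 1))"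
  by (simp add: alt_binomial_def gbinomial_prod_rev prod.atLeast0_lessThan_Suc field_simps)

lemma alt_binomial_nonpos:
  assumes "0 < s" "s < 1" shows "alt_binomial s (Suc k) \<le> 0"
proof (induction k)
  case (Suc k)
  have "(real (Suc k) - s) / (real (Suc k) + 1) \<ge> 0" using assms by simp
  with Suc show ?case unfolding alt_binomial_Suc[of s "Suc k"] by (rule mult_nonpos_nonneg)
qed (use assms in \<open>simp add: alt_binomial_def\<close>)

lemma alt_binomial_sums:
  assumes "\<bar>y\<bar> < 1" shows "(\<lambda>k. alt_binomial s k * y ^ k) sums (1 - y) powr s"
proof -
  have "(\<lambda>k. (s gchoose k) * (- y) ^ k) sums (1 + - y) powr s" by (rule gen_binomial_real) (use assms in simp)
  moreover have "(s gchoose k) * (- y) ^ k = alt_binomial s k * y ^ k" for k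
    unfolding alt_binomial_def power_minus[of y] by simp
  ultimately show ?thesis by simp
qed

text \<open>
  All coefficients after the first have the same sign, so their absolute partial sums at \<open>y < 1\<close> are
  bounded by \<open>1 - (1 - y)\<^sup>s \<le> 1\<close>; let \<open>y\<close> tend to 1.
\<close>
lemma alt_binomial_summable:
  assumes s: "0 < s" "s < 1" shows "summable (\<lambda>k. \<bar>alt_binomial s k\<bar>)"
proof -
  have part: "(\<Sum>k<n. \<bar>alt_binomial s (Suc k)\<bar> * y ^ Suc k) \<le> 1" if y: "0 < y" "y < 1" for y n
  proof -
    have "(\<lambda>k. alt_binomial s k * y ^ k) sums (1 - y) powr s" by (rule alt_binomial_sums) (use y in simp)
    then have "(\<lambda>k. alt_binomial s (Suc k) * y ^ Suc k) sums ((1 - y) powr s - 1)"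
      by (subst sums_Suc_iff) (simp add: alt_binomial_def)
    then have s': "(\<lambda>k. - (alt_binomial s (Suc k) * y ^ Suc k)) sums (- ((1 - y) powr s - 1))" by (rule sums_minus)
    have e: "\<bar>alt_binomial s (Suc k)\<bar> * y ^ Suc k = - (alt_binomial s (Suc k) * y ^ Suc k)" for k
      using alt_binomial_nonpos[OF s, of k] by (simp add: abs_of_nonpos)
    have "(\<Sum>k<n. \<bar>alt_binomial s (Suc k)\<bar> * y ^ Suc k) \<le> (\<Sum>k. - (alt_binomial s (Suc k) * y ^ Suc k))"
      unfolding e by (rule sum_le_suminf[OF sums_summable[OF s']]) (use alt_binomial_nonpos[OF s] y in \<open>auto simp del: power_Suc simp: mult_nonpos_nonneg\<close>)
    also have "\<dots> = 1 - (1 - y) powr s" using sums_unique[OF s'] by simp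
    also have "\<dots> \<le> 1" by simp
    finally show ?thesis .
  qed
  have "(\<Sum>k<n. \<bar>alt_binomial s (Suc k)\<bar>) \<le> 1" for n
  proof (rule tendsto_upperbound)
    show "((\<lambda>y. \<Sum>k<n. \<bar>alt_binomial s (Suc k)\<bar> * y ^ Suc k) \<longlongrightarrow> (\<Sum>k<n. \<bar>alt_binomial s (Suc k)\<bar>)) (at_left 1)"
      by (rule tendsto_eq_intros refl | simp)+
    show "\<forall>\<^sub>F y in at_left 1. (\<Sum>k<n. \<bar>alt_binomial s (Suc k)\<bar> * y ^ Suc k) \<le> 1"
    proof (rule eventually_mono)
      show "\<forall>\<^sub>F y in at_left 1. y \<in> {0<..<1::real}" by (rule eventually_at_left_real) simp
      fix y :: real assume "y \<in> {0<..<1}"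
      then show "(\<Sum>k<n. \<bar>alt_binomial s (Suc k)\<bar> * y ^ Suc k) \<le> 1" by (intro part) auto
    qed
  qed auto
  then have "summable (\<lambda>k. \<bar>alt_binomial s (Suc k)\<bar>)" by (intro summableI_nonneg_bounded[of _ 1]) auto
  then show ?thesis by (simp only: summable_Suc_iff[of "\<lambda>k. \<bar>alt_binomial s k\<bar>"])
qed

text \<open>
  Absolute summability extends the binomial series to the closed interval. The endpoints are needed:
  \<open>mean_cos\<close> equals 1 at the origin, where the sum of the Fourier series has to be evaluated.
\<close>
lemma alt_binomial_integral:
  assumes s: "0 < s" "s < 1" and y: "\<bar>y\<bar> \<le> 1"
  shows "(\<Sum>\<^sub>c k. alt_binomial s k * y ^ k) = (1 - y) powr s"
proof -
  have bi: "summable_c (\<lambda>k. \<bar>alt_binomial s k\<bar>)"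
    using alt_binomial_summable[OF s] by (simp add: integrable_count_space_nat_iff)
  have bd: "norm (alt_binomial s k * z ^ k) \<le> \<bar>alt_binomial s k\<bar>" if "\<bar>z\<bar> \<le> 1" for z k
  proof -
    have "\<bar>z ^ k\<bar> \<le> 1" using that by (simp add: power_abs power_le_one)
    then show ?thesis using mult_left_mono[of "\<bar>z ^ k\<bar>" 1 "\<bar>alt_binomial s k\<bar>"] by (simp add: abs_mult)
  qed
  \<comment> \<open>Approach \<open>y\<close> from inside the disc of convergence.\<close>
  define r where "r n = (1 - 1 / real (Suc n)) * y" for n
  have r1: "\<bar>r n\<bar> < 1" for n
  proof -
    have "\<bar>r n\<bar> = (1 - 1 / real (Suc n)) * \<bar>y\<bar>" by (simp add: r_def abs_mult)
    also have "\<dots> \<le> (1 - 1 / real (Suc n)) * 1" using y by (intro mult_left_mono) auto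
    also have "\<dots> < 1" by simp
    finally show ?thesis .
  qed
  have rl: "r \<longlonglongrightarrow> y"
  proof -
    have "(\<lambda>n. (1 - 1 / real (Suc n)) * y) \<longlonglongrightarrow> (1 - 0) * y"
      by (intro tendsto_mult tendsto_diff tendsto_const LIMSEQ_Suc[OF lim_1_over_n])
    then show ?thesis unfolding r_def by simp
  qed
  have "(\<lambda>n. \<Sum>\<^sub>c k. alt_binomial s k * r n ^ k) \<longlonglongrightarrow> (\<Sum>\<^sub>c k. alt_binomial s k * y ^ k)"
    by (rule integral_dominated_convergence[OF _ _ bi])
       (simp_all only: borel_measurable_count_space, intro AE_I2 tendsto_intros rl, intro AE_I2 bd less_imp_le[OF r1])
  moreover have "(\<Sum>\<^sub>c k. alt_binomial s k * r n ^ k) = (1 - r n) powr s" for n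
  proof -
    have "summable_c (\<lambda>k. alt_binomial s k * r n ^ k)"
      by (rule Bochner_Integration.integrable_bound[OF bi]) (use bd[OF less_imp_le[OF r1]] in auto)
    from integral_count_space_nat[OF this] show ?thesis using sums_unique[OF alt_binomial_sums[OF r1[of n]]] by simp
  qed
  ultimately have "(\<lambda>n. (1 - r n) powr s) \<longlonglongrightarrow> (\<Sum>\<^sub>c k. alt_binomial s k * y ^ k)" by simp
  moreover have "(\<lambda>n. (1 - r n) powr s) \<longlonglongrightarrow> (1 - y) powr s"
  proof (rule tendsto_powr')
    show "1 - y \<noteq> 0 \<or> 0 < s \<and> (\<forall>\<^sub>F n in sequentially. 0 \<le> 1 - r n)"
      using s r1 by (auto intro!: always_eventually simp: abs_less_iff less_imp_le)
  qed (intro tendsto_intros rl)+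
  ultimately show ?thesis by (rule LIMSEQ_unique)
qed

text \<open>
  The distribution of the simple random walk after \<open>k\<close> steps, which is the sequence of Fourier
  coefficients of the \<open>k\<close>-th power of \<open>mean_cos\<close>.
\<close>
fun walk :: "nat \<Rightarrow> int^'n \<Rightarrow> real" where
  "walk 0 z = (if z = 0 then 1 else 0)"
| "walk (Suc k) z = (\<Sum>j\<in>UNIV. walk k (z - axis j 1) + walk k (z + axis j 1)) / (2 * real CARD('n))"

definition lattice_char :: "int^'n \<Rightarrow> real^'n \<Rightarrow> complex" where
  "lattice_char z \<xi> = exp (- (\<i> * of_real (lattice_embed z \<bullet> \<xi>)))"

lemma lattice_embed_add: "lattice_embed (x + y) = lattice_embed x + lattice_embed y"
  and lattice_embed_diff: "lattice_embed (x - y) = lattice_embed x - lattice_embed y"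
  by (simp_all add: lattice_embed_def vec_eq_iff)

lemma norm_lattice_char [simp]: "norm (lattice_char z \<xi>) = 1"
  by (simp add: lattice_char_def)

lemma lattice_char_add: "lattice_char (x + y) \<xi> = lattice_char x \<xi> * lattice_char y \<xi>"
  by (simp add: lattice_char_def lattice_embed_add inner_add_left distrib_left exp_add exp_diff exp_minus divide_inverse)

lemma lattice_char_zero: "lattice_char 0 \<xi> = 1" "lattice_char z 0 = 1"
  by (simp_all add: lattice_char_def)

lemma lattice_char_measurable [measurable]: "lattice_char z \<in> borel_measurable borel"
  unfolding lattice_char_def[abs_def] by measurable

lemma lattice_char_axis: "lattice_char (axis j 1) \<xi> + lattice_char (- axis j 1) \<xi> = of_real (2 * cos (\<xi> $ j))"
proof -
  have 1: "lattice_embed (axis j 1) = axis j 1" and 2: "lattice_embed (- axis j 1) = - axis j 1"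
    by (auto simp: lattice_embed_def vec_eq_iff axis_def)
  show ?thesis unfolding lattice_char_def 1 2
    by (simp add: inner_axis' cos_of_real[symmetric] cos_exp_eq)
qed

lemma walk_nonneg: "walk k z \<ge> 0"
  by (induction k arbitrary: z) (auto intro!: divide_nonneg_nonneg sum_nonneg add_nonneg_nonneg)

definition mean_cos :: "real^'n \<Rightarrow> real" where
  "mean_cos \<xi> = (\<Sum>j\<in>UNIV. cos (\<xi> $ j)) / real CARD('n)"

lemma walk_integrable: "summable_c (walk k :: int^'n \<Rightarrow> real)"
proof (induction k)
  case 0
  have "summable_c (\<lambda>z::int^'n. indicator {0} z :: real)"
    by (intro integrable_real_indicator) auto
  then show ?case by (rule Bochner_Integration.integrable_cong[THEN iffD1, rotated 2]) (auto simp: indicator_def)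
next
  case (Suc k)
  have "summable_c (\<lambda>z. walk k (z - axis j 1))" "summable_c (\<lambda>z. walk k (z + axis j 1))" for j :: 'n
    using Suc integrable_bij_count_space[OF bij_shift(2)] integrable_bij_count_space[OF bij_shift(3)] by blast+
  then have "summable_c (\<lambda>z. (\<Sum>j\<in>(UNIV::'n set). walk k (z - axis j 1) + walk k (z + axis j 1)) / (2 * real CARD('n)))"
    by (intro integrable_divide Bochner_Integration.integrable_sum Bochner_Integration.integrable_add)
  then show ?case by simp
qed

lemma integrable_mult_lattice_char:
  assumes "summable_c F" shows "summable_c (\<lambda>z. F z * lattice_char z \<xi>)"
  by (rule Bochner_Integration.integrable_bound[OF assms]) (auto simp: norm_mult)

lemma integral_shift_lattice_char:
  fixes F :: "int^'n \<Rightarrow> complex"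
  shows "(\<Sum>\<^sub>c z. F (z - c) * lattice_char z \<xi>) = lattice_char c \<xi> * (\<Sum>\<^sub>c z. F z * lattice_char z \<xi>)"
proof -
  have "(\<Sum>\<^sub>c z. F (z - c) * lattice_char z \<xi>) = (\<Sum>\<^sub>c z. F ((z + c) - c) * lattice_char (z + c) \<xi>)"
    by (rule integral_bij_count_space[OF bij_shift(3), symmetric, where f="\<lambda>z. F (z - c) * lattice_char z \<xi>"])
  also have "\<dots> = (\<Sum>\<^sub>c z. lattice_char c \<xi> * (F z * lattice_char z \<xi>))"
    by (simp add: lattice_char_add mult_ac)
  finally show ?thesis by simp
qed

lemma walk_transform:
  fixes \<xi> :: "real^'n"
  shows "(\<Sum>\<^sub>c z. of_real (walk k z) * lattice_char z \<xi>) = of_real (mean_cos \<xi> ^ k)"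
proof (induction k)
  case 0
  have st: "{a\<in>UNIV. complex_of_real (walk 0 a) * lattice_char a \<xi> \<noteq> 0} = {0}"
    by (auto simp: lattice_char_def)
  have "(\<Sum>\<^sub>c z. of_real (walk 0 z) * lattice_char z \<xi>) = (\<Sum>a\<in>{0}. of_real (walk 0 a) * lattice_char a \<xi>)"
    unfolding st[symmetric] by (rule lebesgue_integral_count_space_finite_support) (unfold st, simp)
  then show ?case by (simp add: lattice_char_zero)
next
  case (Suc k)
  define T where "T = (\<Sum>\<^sub>c z. of_real (walk k z) * lattice_char z \<xi>)"
  have wi: "summable_c (\<lambda>z. complex_of_real (walk k z))"
    using walk_integrable by (rule integrable_of_real)
  have i1: "summable_c (\<lambda>z. complex_of_real (walk k (z - c)) * lattice_char z \<xi>)" for c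
    using integrable_mult_lattice_char integrable_bij_count_space[OF bij_shift(2), of "\<lambda>z. complex_of_real (walk k z)" c] wi by blast
  have s1: "(\<Sum>\<^sub>c z. of_real (walk k (z - c)) * lattice_char z \<xi>) = lattice_char c \<xi> * T" for c
    unfolding T_def by (rule integral_shift_lattice_char)
  have "(\<Sum>\<^sub>c z. of_real (walk (Suc k) z) * lattice_char z \<xi>) =
    (\<Sum>\<^sub>c z. (\<Sum>j\<in>UNIV. of_real (walk k (z - axis j 1)) * lattice_char z \<xi> + of_real (walk k (z - (- axis j 1))) * lattice_char z \<xi>) / (2 * of_nat CARD('n)))"
    by (simp add: sum_distrib_right distrib_right sum_divide_distrib add_divide_distrib)
  also have "\<dots> = (\<Sum>j\<in>UNIV. lattice_char (axis j 1) \<xi> * T + lattice_char (- axis j 1) \<xi> * T) / (2 * of_nat CARD('n))"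
    unfolding integral_divide_zero
    by (subst Bochner_Integration.integral_sum) (auto intro!: Bochner_Integration.integrable_add i1 simp only: Bochner_Integration.integral_add[OF i1 i1] s1)
  also have "\<dots> = (\<Sum>j\<in>UNIV. (lattice_char (axis j 1) \<xi> + lattice_char (- axis j 1) \<xi>) * T) / (2 * of_nat CARD('n))"
    by (simp add: distrib_right)
  also have "\<dots> = of_real (mean_cos \<xi>) * T"
    unfolding lattice_char_axis by (simp add: mean_cos_def sum_distrib_right[symmetric] sum_distrib_left[symmetric] field_simps)
  also have "T = of_real (mean_cos \<xi> ^ k)" unfolding T_def by (rule Suc)
  finally show ?case by simp
qed

lemma walk_total: "(\<Sum>\<^sub>c z. walk k (z :: int^'n)) = 1"
proof -
  have "complex_of_real (\<Sum>\<^sub>c z. walk k (z :: int^'n)) = (\<Sum>\<^sub>c z. of_real (walk k (z::int^'n)) * lattice_char z 0)"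
    unfolding lattice_char_zero by simp
  also have "\<dots> = 1" unfolding walk_transform by (simp add: mean_cos_def)
  finally show ?thesis by (simp only: of_real_eq_1_iff)
qed

lemma abs_mean_cos_le: "\<bar>mean_cos (\<xi> :: real^'n)\<bar> \<le> 1"
proof -
  have "\<bar>\<Sum>j\<in>UNIV. cos (\<xi> $ j)\<bar> \<le> (\<Sum>j\<in>(UNIV::'n set). 1)" by (intro order_trans[OF sum_abs] sum_mono) simp
  then show ?thesis by (simp add: mean_cos_def divide_le_eq)
qed

lemma laplace_symbol_mean_cos: "laplace_symbol (\<xi> :: real^'n) = 2 * real CARD('n) * (1 - mean_cos \<xi>)"
  by (simp add: laplace_symbol_def mean_cos_def sum_subtractf sum_distrib_left[symmetric] right_diff_distrib)

text \<open>
  Since \<open>\<Phi> = 2d (1 - c)\<close> with the mean \<open>c\<close> of the cosines, the binomial series expands \<open>\<Phi>\<^sup>s\<close> in powers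
  of \<open>c\<close>. Each power has Fourier coefficients of total mass one, and the binomial coefficients are
  absolutely summable.
\<close>
lemma symbol_powr_absolutely_convergent:
  assumes s: "0 < s" "s < 1"
  shows "\<exists>F :: int^'n \<Rightarrow> complex. summable_c F \<and>
     (\<forall>\<xi>. (\<Sum>\<^sub>c z. F z * lattice_char z \<xi>) = of_real (laplace_symbol \<xi> powr s))"
proof -
  define c where "c = (2 * real CARD('n)) powr s"
  define f where "f k z = complex_of_real (c * alt_binomial s k * walk k (z :: int^'n))" for k z
  have fi: "summable_c (f k)" for k
    unfolding f_def by (intro integrable_of_real integrable_mult_right walk_integrable)
  have bi: "summable_c (\<lambda>k. \<bar>alt_binomial s k\<bar>)"
    using alt_binomial_summable[OF s] by (simp add: integrable_count_space_nat_iff)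
  have n: "(\<Sum>\<^sub>c z. norm (f k z)) = c * \<bar>alt_binomial s k\<bar>" for k
  proof -
    have "norm (f k z) = c * \<bar>alt_binomial s k\<bar> * walk k z" for z
      unfolding f_def norm_of_real using walk_nonneg[of k z] by (simp add: abs_mult c_def)
    then show ?thesis by (simp add: walk_total)
  qed
  have S: "summable_c (\<lambda>k. \<Sum>\<^sub>c z. norm (f k z))"
    unfolding n using bi by simp
  define F where "F z = (\<Sum>\<^sub>c k. f k z)" for z
  have Fi: "summable_c F" unfolding F_def
    by (rule count_space_Fubini(2)[OF sigma_finite_measure_count_space fi S])
  have "(\<Sum>\<^sub>c z. F z * lattice_char z \<xi>) = of_real (laplace_symbol \<xi> powr s)" for \<xi>
  proof -
    define g where "g k z = f k z * lattice_char z \<xi>" for k z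
    have gi: "summable_c (g k)" for k unfolding g_def by (rule integrable_mult_lattice_char[OF fi])
    have gS: "summable_c (\<lambda>k. \<Sum>\<^sub>c z. norm (g k z))"
      using S by (simp add: g_def norm_mult)
    have "(\<Sum>\<^sub>c z. F z * lattice_char z \<xi>) = (\<Sum>\<^sub>c z. (\<Sum>\<^sub>c k. g k z))"
      unfolding F_def g_def by simp
    also have "\<dots> = (\<Sum>\<^sub>c k. (\<Sum>\<^sub>c z. g k z))"
      by (rule count_space_Fubini(1)[OF sigma_finite_measure_count_space gi gS])
    also have "\<dots> = (\<Sum>\<^sub>c k. complex_of_real (c * (alt_binomial s k * mean_cos \<xi> ^ k)))"
    proof (intro Bochner_Integration.integral_cong refl)
      fix k
      have "(\<Sum>\<^sub>c z. g k z) = (\<Sum>\<^sub>c z. of_real (c * alt_binomial s k) * (of_real (walk k z) * lattice_char z \<xi>))"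
        by (simp add: g_def f_def mult_ac)
      also have "\<dots> = of_real (c * alt_binomial s k) * of_real (mean_cos \<xi> ^ k)" unfolding integral_mult_right_zero walk_transform ..
      finally show "(\<Sum>\<^sub>c z. g k z) = complex_of_real (c * (alt_binomial s k * mean_cos \<xi> ^ k))" by simp
    qed
    also have "\<dots> = of_real (c * (1 - mean_cos \<xi>) powr s)"
      unfolding integral_complex_of_real integral_mult_right_zero alt_binomial_integral[OF s abs_mean_cos_le] ..
    also have "c * (1 - mean_cos \<xi>) powr s = laplace_symbol \<xi> powr s"
      using abs_mean_cos_le[of \<xi>] by (simp add: c_def laplace_symbol_mean_cos powr_mult)
    finally show ?thesis .
  qed
  with Fi show ?thesis by blast
qed

section \<open>Tails of convolution powers\<close>
definition convolve :: "(int^'n \<Rightarrow> complex) \<Rightarrow> (int^'n \<Rightarrow> complex) \<Rightarrow> int^'n \<Rightarrow> complex" where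
  "convolve F G x = (\<Sum>\<^sub>c z. F z * G (x - z))"

lemma convolve_l1:
  fixes F G :: "int^'n \<Rightarrow> complex"
  assumes F: "summable_c F" and G: "summable_c G"
  shows "summable_c (convolve F G)"
    and "(\<Sum>\<^sub>c x. convolve F G x) = (\<Sum>\<^sub>c x. F x) * (\<Sum>\<^sub>c x. G x)"
    and "(\<Sum>\<^sub>c x. norm (convolve F G x)) \<le> (\<Sum>\<^sub>c x. norm (F x)) * (\<Sum>\<^sub>c x. norm (G x))"
proof -
  define f where "f z x = F z * G (x - z)" for z x
  have sh: "summable_c (\<lambda>x. G (x - z))" for z
    using integrable_bij_count_space[OF bij_shift(2)] G by blast
  have fi: "summable_c (f z)" for z unfolding f_def by (intro integrable_mult_right sh)
  have I: "(\<Sum>\<^sub>c x. G (x - z)) = (\<Sum>\<^sub>c x. G x)" for z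
    by (rule integral_bij_count_space[OF bij_shift(2)])
  have nI: "(\<Sum>\<^sub>c x. norm (G (x - z))) = (\<Sum>\<^sub>c x. norm (G x))" for z
    by (rule integral_bij_count_space[OF bij_shift(2), where f="\<lambda>x. norm (G x)"])
  have n: "(\<Sum>\<^sub>c x. norm (f z x)) = norm (F z) * (\<Sum>\<^sub>c x. norm (G x))" for z
    by (simp add: f_def norm_mult nI)
  have S: "summable_c (\<lambda>z. \<Sum>\<^sub>c x. norm (f z x))"
    unfolding n by (intro integrable_mult_left integrable_norm F)
  note Fub = count_space_Fubini[OF sigma_finite_measure_count_space fi S]
  have c: "convolve F G = (\<lambda>x. \<Sum>\<^sub>c z. f z x)" by (simp add: convolve_def f_def fun_eq_iff)
  show "summable_c (convolve F G)" unfolding c by (rule Fub(2))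
  show "(\<Sum>\<^sub>c x. convolve F G x) = (\<Sum>\<^sub>c x. F x) * (\<Sum>\<^sub>c x. G x)"
    unfolding c Fub(1) by (simp add: f_def[abs_def] I)
  show "(\<Sum>\<^sub>c x. norm (convolve F G x)) \<le> (\<Sum>\<^sub>c x. norm (F x)) * (\<Sum>\<^sub>c x. norm (G x))"
    using Fub(3) unfolding n by (simp add: c)
qed

lemma integrable_convolve_terms:
  fixes F G :: "int^'n \<Rightarrow> complex"
  assumes F: "summable_c F" and G: "\<And>x. norm (G x) \<le> B"
  shows "summable_c (\<lambda>z. F z * G (x - z))"
proof (rule Bochner_Integration.integrable_bound)
  show "summable_c (\<lambda>z. B * norm (F z))" by (intro integrable_mult_right integrable_norm F)
  show "AE z in count_space UNIV. norm (F z * G (x - z)) \<le> norm (B * norm (F z))"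
  proof (rule AE_I2)
    fix z
    have "norm (F z * G (x - z)) \<le> norm (F z) * B" unfolding norm_mult by (intro mult_left_mono G) auto
    then show "norm (F z * G (x - z)) \<le> norm (B * norm (F z))" by (simp add: mult.commute)
  qed
qed auto

lemma norm_le_integral_count_space:
  fixes G :: "'a::countable \<Rightarrow> complex"
  assumes "summable_c G" shows "norm (G x) \<le> (\<Sum>\<^sub>c x. norm (G x))"
proof -
  have "(\<Sum>\<^sub>c y. norm (G x) * indicator {x} y) \<le> (\<Sum>\<^sub>c y. norm (G y))"
  proof (rule integral_mono)
    show "summable_c (\<lambda>y. norm (G x) * indicator {x} y)"
      by (intro integrable_mult_right integrable_real_indicator) auto
  qed (use assms in \<open>auto simp: indicator_def\<close>)
  then show ?thesis by simp
qed

definition weight :: "real \<Rightarrow> int^'n \<Rightarrow> real" where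
  "weight \<alpha> x = lnorm x powr \<alpha>"

lemma weight_nonneg [simp]: "weight \<alpha> x \<ge> 0" by (simp add: weight_def)

lemma weight_le:
  assumes \<alpha>: "\<alpha> > 0" and l: "lnorm z \<le> lnorm (x - z)"
  shows "weight \<alpha> x \<le> 2 powr \<alpha> * weight \<alpha> (x - z)"
proof -
  have "lattice_embed x = lattice_embed z + lattice_embed (x - z)" by (simp add: lattice_embed_diff)
  then have "lnorm x \<le> lnorm z + lnorm (x - z)" by (metis norm_triangle_ineq)
  then have "lnorm x \<le> 2 * lnorm (x - z)" using l by simp
  then have "weight \<alpha> x \<le> (2 * lnorm (x - z)) powr \<alpha>" unfolding weight_def using \<alpha> by (intro powr_mono2) auto
  then show ?thesis by (simp add: weight_def powr_mult)
qed

lemma weight_le_sum: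
  assumes \<alpha>: "\<alpha> > 0" shows "weight \<alpha> x \<le> 2 powr \<alpha> * (weight \<alpha> z + weight \<alpha> (x - z))"
proof (cases "lnorm z \<le> lnorm (x - z)")
  case True
  then have "weight \<alpha> x \<le> 2 powr \<alpha> * weight \<alpha> (x - z)" by (rule weight_le[OF \<alpha>])
  also have "\<dots> \<le> 2 powr \<alpha> * (weight \<alpha> z + weight \<alpha> (x - z))" by (intro mult_left_mono) auto
  finally show ?thesis .
next
  case False
  then have "weight \<alpha> x \<le> 2 powr \<alpha> * weight \<alpha> (x - (x - z))" by (intro weight_le[OF \<alpha>]) simp
  also have "\<dots> \<le> 2 powr \<alpha> * (weight \<alpha> z + weight \<alpha> (x - z))" by (intro mult_left_mono) auto
  finally show ?thesis .
qed

text \<open>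
  One of \<open>|z|\<close> and \<open>|x - z|\<close> is at least \<open>|x|/2\<close>; the weight goes to that factor and the other one
  is summed.
\<close>
lemma convolve_weight_bound:
  fixes F G :: "int^'n \<Rightarrow> complex"
  assumes \<alpha>: "\<alpha> > 0" and F: "summable_c F" and G: "summable_c G"
    and wF: "\<And>x. weight \<alpha> x * norm (F x) \<le> SF" and wG: "\<And>x. weight \<alpha> x * norm (G x) \<le> SG"
  shows "weight \<alpha> x * norm (convolve F G x) \<le> 2 powr \<alpha> * ((\<Sum>\<^sub>c z. norm (F z)) * SG + (\<Sum>\<^sub>c z. norm (G z)) * SF)"
proof -
  have sh: "summable_c (\<lambda>z. norm (G (x - z)))"
    using integrable_bij_count_space[OF bij_shift(1), of "\<lambda>z. norm (G z)" x] G by auto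
  have I: "(\<Sum>\<^sub>c z. norm (G (x - z))) = (\<Sum>\<^sub>c z. norm (G z))"
    by (rule integral_bij_count_space[OF bij_shift(1), where f="\<lambda>x. norm (G x)"])
  have i: "summable_c (\<lambda>z. F z * G (x - z))"
    by (rule integrable_convolve_terms[OF F norm_le_integral_count_space[OF G]])
  have "weight \<alpha> x * norm (convolve F G x) \<le> weight \<alpha> x * (\<Sum>\<^sub>c z. norm (F z * G (x - z)))"
    unfolding convolve_def by (intro mult_left_mono integral_norm_bound) auto
  also have "\<dots> = (\<Sum>\<^sub>c z. weight \<alpha> x * norm (F z * G (x - z)))" by simp
  also have "\<dots> \<le> (\<Sum>\<^sub>c z. 2 powr \<alpha> * (norm (F z) * SG + norm (G (x - z)) * SF))"
  proof (rule integral_mono)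
    fix z
    have "weight \<alpha> x * norm (F z * G (x - z)) \<le> (2 powr \<alpha> * (weight \<alpha> z + weight \<alpha> (x - z))) * norm (F z * G (x - z))"
      by (intro mult_right_mono weight_le_sum[OF \<alpha>]) auto
    also have "\<dots> = 2 powr \<alpha> * (norm (F z) * (weight \<alpha> (x - z) * norm (G (x - z))) + norm (G (x - z)) * (weight \<alpha> z * norm (F z)))"
      by (simp add: norm_mult algebra_simps)
    also have "\<dots> \<le> 2 powr \<alpha> * (norm (F z) * SG + norm (G (x - z)) * SF)"
      by (intro mult_left_mono add_mono wF wG) auto
    finally show "weight \<alpha> x * norm (F z * G (x - z)) \<le> 2 powr \<alpha> * (norm (F z) * SG + norm (G (x - z)) * SF)" .
  qed (use i F sh in \<open>auto intro!: Bochner_Integration.integrable_add integrable_mult_right integrable_mult_left\<close>)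
  also have "\<dots> = 2 powr \<alpha> * ((\<Sum>\<^sub>c z. norm (F z)) * SG + (\<Sum>\<^sub>c z. norm (G z)) * SF)"
    unfolding integral_mult_right_zero using F sh I by (subst Bochner_Integration.integral_add) auto
  finally show ?thesis .
qed

text \<open>
  \<open>F(x) \<sim> a |x|\<^bsup>-\<alpha>\<^esup>\<close>, including the degenerate case \<open>a = 0\<close>, uniformly in the direction.
\<close>
definition tail_coefficient :: "real \<Rightarrow> (int^'n \<Rightarrow> complex) \<Rightarrow> complex \<Rightarrow> bool" where
  "tail_coefficient \<alpha> F a \<longleftrightarrow> (\<forall>X. filterlim (\<lambda>n. lnorm (X n)) at_top sequentially \<longrightarrow>
     (\<lambda>n. of_real (weight \<alpha> (X n)) * F (X n)) \<longlonglongrightarrow> a)"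

text \<open>
  The part of the convolution in which the argument of \<open>G\<close> is the larger one. There the weight at
  \<open>x\<close> is comparable with the weight at \<open>x - z\<close>, which gives the domination, and for fixed \<open>z\<close> the two
  weights are asymptotically equal. The predicate \<open>P\<close> may decide ties \<open>|z| = |x - z|\<close> either way, so
  that two such parts add up to the whole sum.
\<close>
lemma half_convolution_limit:
  fixes F G :: "int^'n \<Rightarrow> complex"
  assumes \<alpha>: "\<alpha> > 0" and F: "summable_c F"
    and wG: "\<And>x. weight \<alpha> x * norm (G x) \<le> SG" and lim: "tail_coefficient \<alpha> G b"
    and X: "filterlim (\<lambda>n. lnorm (X n)) at_top sequentially"
    and P1: "\<And>n z. P n z \<Longrightarrow> lnorm z \<le> lnorm (X n - z)"
    and P2: "\<And>n z. lnorm z < lnorm (X n - z) \<Longrightarrow> P n z"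
  shows "(\<lambda>n. \<Sum>\<^sub>c z. of_bool (P n z) * (of_real (weight \<alpha> (X n)) * (F z * G (X n - z)))) \<longlonglongrightarrow> b * (\<Sum>\<^sub>c z. F z)"
proof -
  have SG: "SG \<ge> 0" using wG[of 0] by (smt (verit) mult_nonneg_nonneg norm_ge_zero weight_nonneg)
  have "(\<lambda>n. \<Sum>\<^sub>c z. of_bool (P n z) * (of_real (weight \<alpha> (X n)) * (F z * G (X n - z)))) \<longlonglongrightarrow> (\<Sum>\<^sub>c z. b * F z)"
  proof (rule integral_dominated_convergence)
    show "summable_c (\<lambda>z. (2 powr \<alpha> * SG) * norm (F z))" by (intro integrable_mult_right integrable_norm F)
    show "AE z in count_space UNIV. norm (of_bool (P n z) * (of_real (weight \<alpha> (X n)) * (F z * G (X n - z)))) \<le> (2 powr \<alpha> * SG) * norm (F z)" for n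
    proof (rule AE_I2)
      fix z
      show "norm (of_bool (P n z) * (of_real (weight \<alpha> (X n)) * (F z * G (X n - z)))) \<le> (2 powr \<alpha> * SG) * norm (F z)"
      proof (cases "P n z")
        case True
        have "norm (of_bool (P n z) * (of_real (weight \<alpha> (X n)) * (F z * G (X n - z)))) = weight \<alpha> (X n) * (norm (F z) * norm (G (X n - z)))"
          using True by (simp add: norm_mult)
        also have "\<dots> \<le> (2 powr \<alpha> * weight \<alpha> (X n - z)) * (norm (F z) * norm (G (X n - z)))"
          by (intro mult_right_mono weight_le[OF \<alpha> P1[OF True]]) auto
        also have "\<dots> = (2 powr \<alpha> * norm (F z)) * (weight \<alpha> (X n - z) * norm (G (X n - z)))" by (simp add: mult_ac)
        also have "\<dots> \<le> (2 powr \<alpha> * norm (F z)) * SG" by (intro mult_left_mono wG) auto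
        finally show ?thesis by (simp add: mult_ac)
      qed (use SG in simp)
    qed
    show "AE z in count_space UNIV. (\<lambda>n. of_bool (P n z) * (of_real (weight \<alpha> (X n)) * (F z * G (X n - z)))) \<longlonglongrightarrow> b * F z"
    proof (rule AE_I2)
      fix z
      have shift: "lnorm (X n) - lnorm z \<le> lnorm (X n - z)" for n
        unfolding lattice_embed_diff by (rule norm_triangle_ineq2)
      have Xz: "filterlim (\<lambda>n. lnorm (X n - z)) at_top sequentially"
      proof (rule filterlim_at_top_mono)
        show "filterlim (\<lambda>n. - lnorm z + lnorm (X n)) at_top sequentially"
          by (rule filterlim_tendsto_add_at_top[OF tendsto_const X])
      qed (use shift in \<open>auto intro!: always_eventually simp: algebra_simps\<close>)
      have G1: "(\<lambda>n. of_real (weight \<alpha> (X n - z)) * G (X n - z)) \<longlonglongrightarrow> b"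
        by (rule lim[unfolded tail_coefficient_def, rule_format, OF Xz])
      have ratio: "(\<lambda>n. lnorm (X n) / lnorm (X n - z)) \<longlonglongrightarrow> 1"
      proof (rule LIM_zero_cancel, rule Lim_null_comparison)
        show "\<forall>\<^sub>F n in sequentially. norm (lnorm (X n) / lnorm (X n - z) - 1) \<le> lnorm z / lnorm (X n - z)"
          using filterlim_at_top_dense[THEN iffD1, OF Xz, rule_format, of 0]
        proof eventually_elim
          case (elim n)
          have "\<bar>lnorm (X n) - lnorm (X n - z)\<bar> \<le> lnorm z"
            using norm_triangle_ineq3[of "lattice_embed (X n)" "lattice_embed (X n - z)"] by (simp add: lattice_embed_diff)
          moreover have "lnorm (X n) / lnorm (X n - z) - 1 = (lnorm (X n) - lnorm (X n - z)) / lnorm (X n - z)"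
            using elim by (simp add: field_simps)
          ultimately show ?case by (simp add: divide_right_mono)
        qed
        show "(\<lambda>n. lnorm z / lnorm (X n - z)) \<longlonglongrightarrow> 0"
          by (rule real_tendsto_divide_at_top[OF tendsto_const Xz])
      qed
      have r2: "(\<lambda>n. (lnorm (X n) / lnorm (X n - z)) powr \<alpha>) \<longlonglongrightarrow> 1 powr \<alpha>"
        by (intro tendsto_powr ratio tendsto_const) simp
      have "(\<lambda>n. of_real ((lnorm (X n) / lnorm (X n - z)) powr \<alpha>) * F z * (of_real (weight \<alpha> (X n - z)) * G (X n - z))) \<longlonglongrightarrow> of_real (1 powr \<alpha>) * F z * b"
        by (intro tendsto_mult tendsto_of_real r2 tendsto_const G1)
      then have "(\<lambda>n. of_real ((lnorm (X n) / lnorm (X n - z)) powr \<alpha>) * F z * (of_real (weight \<alpha> (X n - z)) * G (X n - z))) \<longlonglongrightarrow> b * F z"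
        by (simp add: mult.commute)
      then show "(\<lambda>n. of_bool (P n z) * (of_real (weight \<alpha> (X n)) * (F z * G (X n - z)))) \<longlonglongrightarrow> b * F z"
      proof (rule Lim_transform_eventually)
        show "\<forall>\<^sub>F n in sequentially. of_real ((lnorm (X n) / lnorm (X n - z)) powr \<alpha>) * F z * (of_real (weight \<alpha> (X n - z)) * G (X n - z)) =
           of_bool (P n z) * (of_real (weight \<alpha> (X n)) * (F z * G (X n - z)))"
          using filterlim_at_top_dense[THEN iffD1, OF Xz, rule_format, of "lnorm z"]
        proof eventually_elim
          case (elim n)
          have "0 < lnorm (X n - z)" using elim norm_ge_zero[of "lattice_embed z"] by linarith
          then have "(lnorm (X n) / lnorm (X n - z)) powr \<alpha> * weight \<alpha> (X n - z) = weight \<alpha> (X n)"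
            unfolding weight_def by (subst powr_divide) auto
          then have "complex_of_real ((lnorm (X n) / lnorm (X n - z)) powr \<alpha>) * of_real (weight \<alpha> (X n - z)) = of_real (weight \<alpha> (X n))"
            by (metis of_real_mult)
          then show ?case using P2[OF elim] by (simp add: mult_ac)
        qed
      qed
    qed
  qed simp_all
  then show ?thesis unfolding integral_mult_right_zero .
qed

text \<open>
  Split the sum according to which argument is larger, and reflect the second part by
  \<open>z \<rightarrow> x - z\<close>.
\<close>
lemma tail_coefficient_convolve:
  fixes F G :: "int^'n \<Rightarrow> complex"
  assumes \<alpha>: "\<alpha> > 0" and F: "summable_c F" and G: "summable_c G"
    and wF: "\<And>x. weight \<alpha> x * norm (F x) \<le> SF" and wG: "\<And>x. weight \<alpha> x * norm (G x) \<le> SG"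
    and a: "tail_coefficient \<alpha> F a" and b: "tail_coefficient \<alpha> G b"
  shows "tail_coefficient \<alpha> (convolve F G) (a * (\<Sum>\<^sub>c z. G z) + b * (\<Sum>\<^sub>c z. F z))"
  unfolding tail_coefficient_def
proof (intro allI impI)
  fix X :: "nat \<Rightarrow> int^'n" assume X: "filterlim (\<lambda>n. lnorm (X n)) at_top sequentially"
  define P where "P n z \<longleftrightarrow> lnorm z \<le> lnorm (X n - z)" for n z
  define Q where "Q n z \<longleftrightarrow> lnorm z < lnorm (X n - z)" for n z
  define T where "T n z = of_real (weight \<alpha> (X n)) * (F z * G (X n - z))" for n z
  define U where "U n z = of_real (weight \<alpha> (X n)) * (G z * F (X n - z))" for n z
  have l1: "(\<lambda>n. \<Sum>\<^sub>c z. of_bool (P n z) * T n z) \<longlonglongrightarrow> b * (\<Sum>\<^sub>c z. F z)"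
    unfolding T_def by (rule half_convolution_limit[OF \<alpha> F wG b X]) (auto simp: P_def)
  have l2: "(\<lambda>n. \<Sum>\<^sub>c z. of_bool (Q n z) * U n z) \<longlonglongrightarrow> a * (\<Sum>\<^sub>c z. G z)"
    unfolding U_def by (rule half_convolution_limit[OF \<alpha> G wF a X]) (auto simp: Q_def)
  have Ti: "summable_c (T n)" for n
    unfolding T_def by (intro integrable_mult_right integrable_convolve_terms[OF F norm_le_integral_count_space[OF G]])
  have bi: "summable_c (\<lambda>z. of_bool (R z) * T n z)" for R n
    by (rule Bochner_Integration.integrable_bound[OF Ti[of n]]) (auto simp: norm_mult)
  have "of_real (weight \<alpha> (X n)) * convolve F G (X n) = (\<Sum>\<^sub>c z. of_bool (P n z) * T n z) + (\<Sum>\<^sub>c z. of_bool (Q n z) * U n z)" for n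
  proof -
    have "of_real (weight \<alpha> (X n)) * convolve F G (X n) = (\<Sum>\<^sub>c z. T n z)"
      by (simp add: convolve_def T_def)
    also have "\<dots> = (\<Sum>\<^sub>c z. of_bool (P n z) * T n z + of_bool (\<not> P n z) * T n z)"
      by (intro Bochner_Integration.integral_cong refl) auto
    also have "\<dots> = (\<Sum>\<^sub>c z. of_bool (P n z) * T n z) + (\<Sum>\<^sub>c z. of_bool (\<not> P n z) * T n z)"
      by (rule Bochner_Integration.integral_add[OF bi bi])
    also have "(\<Sum>\<^sub>c z. of_bool (\<not> P n z) * T n z) = (\<Sum>\<^sub>c z. of_bool (\<not> P n (X n - z)) * T n (X n - z))"
      by (rule integral_bij_count_space[OF bij_shift(1), symmetric, where f="\<lambda>z. of_bool (\<not> P n z) * T n z"])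
    also have "\<dots> = (\<Sum>\<^sub>c z. of_bool (Q n z) * U n z)"
      by (intro Bochner_Integration.integral_cong refl) (simp add: P_def Q_def T_def U_def not_le mult_ac)
    finally show ?thesis .
  qed
  with tendsto_add[OF l2 l1] show "(\<lambda>n. of_real (weight \<alpha> (X n)) * convolve F G (X n)) \<longlonglongrightarrow> a * (\<Sum>\<^sub>c z. G z) + b * (\<Sum>\<^sub>c z. F z)"
    by (simp add: add.commute)
qed

fun convolution_power :: "(int^'n \<Rightarrow> complex) \<Rightarrow> nat \<Rightarrow> int^'n \<Rightarrow> complex" where
  "convolution_power F 0 = (\<lambda>x. if x = 0 then 1 else 0)"
| "convolution_power F (Suc n) = convolve F (convolution_power F n)"

lemma convolution_power_1: "convolution_power F (Suc 0) = F"
proof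
  fix x
  have "F z * convolution_power F 0 (x - z) = indicator {x} z *\<^sub>R F x" for z
    by (auto simp: indicator_def)
  then have "convolution_power F (Suc 0) x = (\<Sum>\<^sub>c z. indicator {x} z *\<^sub>R F x)"
    by (simp only: convolution_power.simps(2) convolve_def)
  then show "convolution_power F (Suc 0) x = F x" by simp
qed

lemma convolution_power_l1:
  fixes F :: "int^'n \<Rightarrow> complex"
  assumes F: "summable_c F"
  shows "summable_c (convolution_power F n)"
    and "(\<Sum>\<^sub>c x. convolution_power F n x) = (\<Sum>\<^sub>c x. F x) ^ n"
    and "(\<Sum>\<^sub>c x. norm (convolution_power F n x)) \<le> (\<Sum>\<^sub>c x. norm (F x)) ^ n"
proof (induction n)
  case 0
  have e: "convolution_power F 0 = (\<lambda>x. complex_of_real (indicator {0} x))" by (auto simp: indicator_def fun_eq_iff)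
  show "summable_c (convolution_power F 0)"
    unfolding e by (intro integrable_of_real integrable_real_indicator) auto
  show "(\<Sum>\<^sub>c x. convolution_power F 0 x) = (\<Sum>\<^sub>c x. F x) ^ 0" unfolding e integral_complex_of_real by simp
  have "(\<Sum>\<^sub>c x. norm (convolution_power F 0 x)) = (\<Sum>\<^sub>c x. indicator {0::int^'n} x)"
    unfolding e by (intro Bochner_Integration.integral_cong refl) (simp add: indicator_def)
  then show "(\<Sum>\<^sub>c x. norm (convolution_power F 0 x)) \<le> (\<Sum>\<^sub>c x. norm (F x)) ^ 0" by simp
next
  case (Suc n)
  show "summable_c (convolution_power F (Suc n))" using convolve_l1(1)[OF F Suc(1)] by simp
  show "(\<Sum>\<^sub>c x. convolution_power F (Suc n) x) = (\<Sum>\<^sub>c x. F x) ^ Suc n" using convolve_l1(2)[OF F Suc(1)] Suc(2) by simp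
  have "(\<Sum>\<^sub>c x. norm (F x)) * (\<Sum>\<^sub>c x. norm (convolution_power F n x)) \<le> (\<Sum>\<^sub>c x. norm (F x)) * (\<Sum>\<^sub>c x. norm (F x)) ^ n"
    using Suc(3) by (intro mult_left_mono Bochner_Integration.integral_nonneg) auto
  with convolve_l1(3)[OF F Suc(1)]
  show "(\<Sum>\<^sub>c x. norm (convolution_power F (Suc n) x)) \<le> (\<Sum>\<^sub>c x. norm (F x)) ^ Suc n" by simp
qed

text \<open>
  The geometric growth is what the exponential series can absorb.
\<close>
lemma convolution_power_weight_bound:
  fixes F :: "int^'n \<Rightarrow> complex"
  assumes \<alpha>: "\<alpha> > 0" and F: "summable_c F" and wF: "\<And>x. weight \<alpha> x * norm (F x) \<le> S"
  shows "\<exists>M\<ge>0. \<forall>n x. weight \<alpha> x * norm (convolution_power F n x) \<le> M ^ n"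
proof -
  define \<Lambda> where "\<Lambda> = (\<Sum>\<^sub>c z. norm (F z))"
  have L: "\<Lambda> \<ge> 0" unfolding \<Lambda>_def by (intro Bochner_Integration.integral_nonneg) auto
  have S: "S \<ge> 0" using wF[of 0] by (smt (verit) mult_nonneg_nonneg norm_ge_zero weight_nonneg)
  define M where "M = 2 powr \<alpha> * (\<Lambda> + S)"
  have M: "M \<ge> 0" unfolding M_def using L S by simp
  have p: "2 powr \<alpha> \<ge> 1" using \<alpha> by (intro ge_one_powr_ge_zero) auto
  have LM: "\<Lambda> \<le> M"
  proof -
    have "1 * (\<Lambda> + S) \<le> M" unfolding M_def using p L S by (intro mult_right_mono) auto
    then show ?thesis using S by simp
  qed
  have "weight \<alpha> x * norm (convolution_power F n x) \<le> M ^ n" for n x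
  proof (induction n arbitrary: x)
    case 0
    then show ?case using \<alpha> by (auto simp: weight_def)
  next
    case (Suc n)
    have "weight \<alpha> x * norm (convolution_power F (Suc n) x) \<le> 2 powr \<alpha> * (\<Lambda> * M ^ n + (\<Sum>\<^sub>c z. norm (convolution_power F n z)) * S)"
      using convolve_weight_bound[OF \<alpha> F convolution_power_l1(1)[OF F] wF Suc, of x] by (simp add: \<Lambda>_def)
    also have "\<dots> \<le> 2 powr \<alpha> * (\<Lambda> * M ^ n + M ^ n * S)"
    proof -
      have "(\<Sum>\<^sub>c z. norm (convolution_power F n z)) \<le> \<Lambda> ^ n" unfolding \<Lambda>_def by (rule convolution_power_l1(3)[OF F])
      also have "\<dots> \<le> M ^ n" using LM L by (intro power_mono)
      finally show ?thesis using S by (intro mult_left_mono add_left_mono mult_right_mono) auto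
    qed
    also have "\<dots> = M ^ Suc n" by (simp add: M_def algebra_simps)
    finally show ?case .
  qed
  then show ?thesis using M by blast
qed

text \<open>
  In the product formula for tail coefficients every term carries a factor \<open>\<Sum> F = 0\<close>, except for the
  first power.
\<close>
lemma convolution_power_tail:
  fixes F :: "int^'n \<Rightarrow> complex"
  assumes \<alpha>: "\<alpha> > 0" and F: "summable_c F" and wF: "\<And>x. weight \<alpha> x * norm (F x) \<le> S"
    and a: "tail_coefficient \<alpha> F a" and z: "(\<Sum>\<^sub>c x. F x) = 0"
  shows "tail_coefficient \<alpha> (convolution_power F n) (if n = 1 then a else 0)"
proof -
  obtain M where M: "\<And>n x. weight \<alpha> x * norm (convolution_power F n x) \<le> M ^ n"
    using convolution_power_weight_bound[OF \<alpha> F wF] by blast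
  have *: "tail_coefficient \<alpha> (convolution_power F (Suc n)) (if n = 0 then a else 0)" for n
  proof (induction n)
    case 0
    then show ?case using a by (simp only: convolution_power_1) simp
  next
    case (Suc n)
    from tail_coefficient_convolve[OF \<alpha> F convolution_power_l1(1)[OF F] wF M a Suc]
    show ?case by (simp add: z convolution_power_l1(2)[OF F] del: convolution_power.simps) (simp only: convolution_power.simps)
  qed
  have "tail_coefficient \<alpha> (convolution_power F 0) 0"
    using \<alpha> by (auto simp: tail_coefficient_def weight_def intro!: tendsto_eventually always_eventually)
  then show ?thesis using *[of "n - 1"] by (cases n) auto
qed

section \<open>The fractional diffusion kernel\<close>

text \<open>
  Multiplication by an absolutely convergent Fourier series acts on coefficients as a convolution. Swapping the sum with the integral over the torus is all it takes.
\<close>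
lemma torus_integral_mult_series:
  fixes F :: "int^'n \<Rightarrow> complex" and g :: "real^'n \<Rightarrow> complex"
  assumes F: "summable_c F" and [measurable]: "g \<in> borel_measurable borel" and g: "\<And>\<xi>. norm (g \<xi>) \<le> B"
  shows "torus_integral (\<lambda>\<xi>. (\<Sum>\<^sub>c z. F z * lattice_char z \<xi>) * g \<xi>) x = (\<Sum>\<^sub>c z. F z * torus_integral g (x - z))"
proof -
  define f where "f z \<xi> = F z * (indicator period_box \<xi> *\<^sub>R (g \<xi> * wave (lattice_embed (x - z) \<bullet> \<xi>)))" for z \<xi>
  have gi: "integrable lborel (\<lambda>\<xi>. indicator period_box \<xi> *\<^sub>R (g \<xi> * wave (lattice_embed y \<bullet> \<xi>)))" for y :: "int^'n"
    using integrable_period_box[of "\<lambda>\<xi>. g \<xi> * wave (lattice_embed y \<bullet> \<xi>)" B] g by (simp add: set_integrable_def norm_mult)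
  have fi: "integrable lborel (f z)" for z unfolding f_def by (intro integrable_mult_right gi)
  have n: "(LBINT \<xi>. norm (f z \<xi>)) = norm (F z) * (LBINT \<xi>. indicator period_box \<xi> * norm (g \<xi>))" for z
    unfolding integral_mult_right_zero[symmetric] by (simp add: f_def norm_mult mult.left_commute)
  have S: "summable_c (\<lambda>z. LBINT \<xi>. norm (f z \<xi>))"
    unfolding n by (intro integrable_mult_left integrable_norm F)
  have split: "wave (lattice_embed (x - z) \<bullet> \<xi>) = lattice_char z \<xi> * wave (lattice_embed x \<bullet> \<xi>)" for z \<xi>
    unfolding lattice_char_def lattice_embed_diff inner_diff_left exp_add[symmetric] by (simp add: algebra_simps)
  have "torus_integral (\<lambda>\<xi>. (\<Sum>\<^sub>c z. F z * lattice_char z \<xi>) * g \<xi>) x = (LBINT \<xi>. (\<Sum>\<^sub>c z. f z \<xi>))"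
    unfolding torus_integral_def set_lebesgue_integral_def
  proof (intro Bochner_Integration.integral_cong refl)
    fix \<xi> :: "real^'n"
    have "(\<Sum>\<^sub>c z. f z \<xi>) = (\<Sum>\<^sub>c z. (F z * lattice_char z \<xi>) * (indicator period_box \<xi> *\<^sub>R (g \<xi> * wave (lattice_embed x \<bullet> \<xi>))))"
      unfolding f_def split by (simp add: mult_ac)
    also have "\<dots> = (\<Sum>\<^sub>c z. F z * lattice_char z \<xi>) * (indicator period_box \<xi> *\<^sub>R (g \<xi> * wave (lattice_embed x \<bullet> \<xi>)))"
      by (rule integral_mult_left_zero)
    finally show "indicator period_box \<xi> *\<^sub>R ((\<Sum>\<^sub>c z. F z * lattice_char z \<xi>) * g \<xi> * wave (lattice_embed x \<bullet> \<xi>)) = (\<Sum>\<^sub>c z. f z \<xi>)"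
      by (simp add: mult_ac)
  qed
  also have "\<dots> = (\<Sum>\<^sub>c z. (LBINT \<xi>. f z \<xi>))"
    by (rule count_space_Fubini(1)[OF sigma_finite_lborel fi S])
  also have "\<dots> = (\<Sum>\<^sub>c z. F z * torus_integral g (x - z))"
    unfolding f_def torus_integral_def set_lebesgue_integral_def integral_mult_right_zero ..
  finally show ?thesis .
qed

lemma torus_integral_symbol_power:
  fixes F :: "int^'n \<Rightarrow> complex"
  assumes F: "summable_c F" and s: "0 < s"
    and eq: "\<And>\<xi>. (\<Sum>\<^sub>c z. F z * lattice_char z \<xi>) = of_real (laplace_symbol \<xi> powr s)"
  shows "torus_integral (\<lambda>\<xi>. of_real ((laplace_symbol \<xi> powr s) ^ n)) x = of_real (2 * pi) ^ CARD('n) * convolution_power F n x"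
proof (induction n arbitrary: x)
  case 0
  show ?case by (simp add: torus_integral_one)
next
  case (Suc n)
  have b: "norm (complex_of_real ((laplace_symbol (\<xi>::real^'n) powr s) ^ n)) \<le> ((4 * real CARD('n)) powr s) ^ n" for \<xi>
  proof -
    have "laplace_symbol \<xi> powr s \<le> (4 * real CARD('n)) powr s" using s by (intro powr_mono2 laplace_symbol_nonneg laplace_symbol_le) auto
    then show ?thesis by (simp add: norm_power power_mono)
  qed
  have "torus_integral (\<lambda>\<xi>. of_real ((laplace_symbol \<xi> powr s) ^ Suc n)) x =
    torus_integral (\<lambda>\<xi>. (\<Sum>\<^sub>c z. F z * lattice_char z \<xi>) * of_real ((laplace_symbol \<xi> powr s) ^ n)) x"
    unfolding eq by simp
  also have "\<dots> = (\<Sum>\<^sub>c z. F z * torus_integral (\<lambda>\<xi>. of_real ((laplace_symbol \<xi> powr s) ^ n)) (x - z))"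
    by (rule torus_integral_mult_series[OF F _ b]) measurable
  also have "\<dots> = (\<Sum>\<^sub>c z. of_real (2 * pi) ^ CARD('n) * (F z * convolution_power F n (x - z)))"
    unfolding Suc by (simp add: mult_ac)
  finally show ?case by (simp add: convolve_def)
qed

lemma torus_integral_exp_series:
  fixes f :: "real^'n \<Rightarrow> real"
  assumes [measurable]: "f \<in> borel_measurable borel" and f: "\<And>\<xi>. \<bar>f \<xi>\<bar> \<le> B"
  shows "torus_integral (\<lambda>\<xi>. of_real (exp (c * f \<xi>))) x = (\<Sum>\<^sub>c n. of_real (c ^ n / fact n) * torus_integral (\<lambda>\<xi>. of_real (f \<xi> ^ n)) x)"
proof -
  define h where "h n \<xi> = of_real (c ^ n / fact n) * (indicator period_box \<xi> *\<^sub>R (of_real (f \<xi> ^ n) * wave (lattice_embed x \<bullet> \<xi>)))" for n \<xi>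
  have pw: "\<bar>f \<xi> ^ n\<bar> \<le> B ^ n" for \<xi> n unfolding power_abs by (intro power_mono f) simp
  have gi: "integrable lborel (\<lambda>\<xi>. indicator period_box \<xi> *\<^sub>R (complex_of_real (f \<xi> ^ n) * wave (lattice_embed x \<bullet> \<xi>)))" for n
    using integrable_period_box[of "\<lambda>\<xi>. complex_of_real (f \<xi> ^ n) * wave (lattice_embed x \<bullet> \<xi>)" "B ^ n"] pw
    by (simp only: set_integrable_def norm_mult norm_of_real norm_exp_i_times mult_1_right) simp
  have hi: "integrable lborel (h n)" for n unfolding h_def by (intro integrable_mult_right gi)
  define V where "V = measure lborel (period_box :: (real^'n) set)"
  have hn: "(LBINT \<xi>. norm (h n \<xi>)) \<le> V * (\<bar>c\<bar> * B) ^ n / fact n" for n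
  proof -
    have "(LBINT \<xi>. norm (h n \<xi>)) \<le> (LBINT \<xi>. indicator (period_box :: (real^'n) set) \<xi> * ((\<bar>c\<bar> * B) ^ n / fact n))"
    proof (rule integral_mono[OF integrable_norm[OF hi]])
      show "integrable lborel (\<lambda>\<xi>. indicator (period_box :: (real^'n) set) \<xi> * ((\<bar>c\<bar> * B) ^ n / fact n))"
        by (intro integrable_mult_left integrable_real_indicator) (auto simp only: sets_lborel borel_closed closed_cbox emeasure_lborel_cbox_finite)
      fix \<xi> :: "real^'n"
      have "norm (h n \<xi>) = indicator period_box \<xi> * (\<bar>c\<bar> ^ n / fact n * \<bar>f \<xi> ^ n\<bar>)"
        by (simp add: h_def norm_mult norm_divide norm_power power_abs)
      also have "\<dots> \<le> indicator period_box \<xi> * (\<bar>c\<bar> ^ n / fact n * B ^ n)" by (intro mult_left_mono pw) auto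
      finally show "norm (h n \<xi>) \<le> indicator period_box \<xi> * ((\<bar>c\<bar> * B) ^ n / fact n)" by (simp add: power_mult_distrib)
    qed
    then show ?thesis by (simp add: V_def)
  qed
  have S: "summable_c (\<lambda>n. LBINT \<xi>. norm (h n \<xi>))"
    unfolding integrable_count_space_nat_iff
  proof (rule summable_comparison_test')
    show "summable (\<lambda>n. V * ((\<bar>c\<bar> * B) ^ n / fact n))"
      using summable_mult[OF summable_exp_generic[of "\<bar>c\<bar> * B"]] by (simp add: field_simps)
    show "norm (norm (LBINT \<xi>. norm (h n \<xi>))) \<le> V * ((\<bar>c\<bar> * B) ^ n / fact n)" if "n \<ge> 0" for n
      using hn[of n] Bochner_Integration.integral_nonneg[of lborel "\<lambda>\<xi>. norm (h n \<xi>)"] by simp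
  qed
  have "torus_integral (\<lambda>\<xi>. of_real (exp (c * f \<xi>))) x = (LBINT \<xi>. (\<Sum>\<^sub>c n. h n \<xi>))"
    unfolding torus_integral_def set_lebesgue_integral_def
  proof (intro Bochner_Integration.integral_cong refl)
    fix \<xi> :: "real^'n"
    have ei: "summable_c (\<lambda>n. c ^ n / fact n * f \<xi> ^ n)"
      unfolding integrable_count_space_nat_iff
      using summable_norm_exp[of "c * f \<xi>"] by (simp add: field_simps power_mult_distrib)
    have "(\<Sum>\<^sub>c n. c ^ n / fact n * f \<xi> ^ n) = exp (c * f \<xi>)"
      unfolding integral_count_space_nat[OF ei] exp_def by (simp add: field_simps power_mult_distrib)
    then have "complex_of_real (exp (c * f \<xi>)) = (\<Sum>\<^sub>c n. of_real (c ^ n / fact n * f \<xi> ^ n))"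
      unfolding integral_complex_of_real by simp
    then have "indicator period_box \<xi> *\<^sub>R (of_real (exp (c * f \<xi>)) * wave (lattice_embed x \<bullet> \<xi>)) =
      (\<Sum>\<^sub>c n. of_real (c ^ n / fact n * f \<xi> ^ n)) * (indicator period_box \<xi> *\<^sub>R wave (lattice_embed x \<bullet> \<xi>))"
      by simp
    also have "\<dots> = (\<Sum>\<^sub>c n. of_real (c ^ n / fact n * f \<xi> ^ n) * (indicator period_box \<xi> *\<^sub>R wave (lattice_embed x \<bullet> \<xi>)))"
      by (rule integral_mult_left_zero[symmetric])
    also have "\<dots> = (\<Sum>\<^sub>c n. h n \<xi>)"
      by (intro Bochner_Integration.integral_cong refl) (simp add: h_def)
    finally show "indicator period_box \<xi> *\<^sub>R (of_real (exp (c * f \<xi>)) * wave (lattice_embed x \<bullet> \<xi>)) = (\<Sum>\<^sub>c n. h n \<xi>)" .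
  qed
  also have "\<dots> = (\<Sum>\<^sub>c n. (LBINT \<xi>. h n \<xi>))"
    by (rule count_space_Fubini(1)[OF sigma_finite_lborel hi S])
  also have "\<dots> = (\<Sum>\<^sub>c n. of_real (c ^ n / fact n) * torus_integral (\<lambda>\<xi>. of_real (f \<xi> ^ n)) x)"
    unfolding h_def torus_integral_def set_lebesgue_integral_def by (simp only: integral_mult_right_zero)
  finally show ?thesis .
qed

text \<open>
  Expand the exponential and pass to the limit term by term: the bound on the weighted convolution
  powers dominates the series, and only the term \<open>n = 1\<close> has a nonzero limit.
\<close>
lemma torus_integral_semigroup_tail:
  fixes X :: "nat \<Rightarrow> int^'n"
  assumes s: "0 < s" "s < 1" and X: "filterlim (\<lambda>n. lnorm (X n)) at_top sequentially"
  shows "(\<lambda>n. of_real (lnorm (X n) powr (real CARD('n) + 2 * s)) * torus_integral (\<lambda>\<xi>. of_real (exp (- t * laplace_symbol \<xi> powr s))) (X n))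
    \<longlonglongrightarrow> - of_real t * levy_amplitude TYPE('n) s"
proof -
  define \<alpha> where "\<alpha> = real CARD('n) + 2 * s"
  have \<alpha>: "\<alpha> > 0" using s by (simp add: \<alpha>_def)
  define K where "K = complex_of_real (2 * pi) ^ CARD('n)"
  have K: "K \<noteq> 0" "norm K > 0" by (simp_all add: K_def)
  obtain F :: "int^'n \<Rightarrow> complex" where F: "summable_c F"
    and eq: "\<And>\<xi>. (\<Sum>\<^sub>c z. F z * lattice_char z \<xi>) = of_real (laplace_symbol \<xi> powr s)"
    using symbol_powr_absolutely_convergent[OF s] by blast
  have tp: "torus_integral (\<lambda>\<xi>. of_real ((laplace_symbol \<xi> powr s) ^ n)) x = K * convolution_power F n x" for n x
    unfolding K_def by (rule torus_integral_symbol_power[OF F s(1) eq])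
  have t1: "symbol_coeff s x = K * F x" for x
    using tp[of 1 x] by (simp only: One_nat_def convolution_power_1 power_Suc0_right)
  have total: "(\<Sum>\<^sub>c z. F z) = 0"
    using eq[of 0] by (simp add: lattice_char_zero laplace_symbol_def)
  obtain C where C: "\<And>x::int^'n. weight \<alpha> x * norm (symbol_coeff s x) \<le> C"
    using torus_integral_symbol_powr_bound(1)[OF s, where 'n='n] unfolding weight_def \<alpha>_def by blast
  have wF: "weight \<alpha> x * norm (F x) \<le> C / norm K" for x
    using C[of x] K unfolding t1 norm_mult by (simp add: field_simps)
  have tail: "tail_coefficient \<alpha> F (levy_amplitude TYPE('n) s / K)"
    unfolding tail_coefficient_def
  proof (intro allI impI)
    fix Y :: "nat \<Rightarrow> int^'n" assume Y: "filterlim (\<lambda>n. lnorm (Y n)) at_top sequentially"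
    have "(\<lambda>n. of_real (weight \<alpha> (Y n)) * (K * F (Y n)) / K) \<longlonglongrightarrow> levy_amplitude TYPE('n) s / K"
      using torus_integral_symbol_powr_bound(2)[OF s Y] K unfolding t1 weight_def \<alpha>_def by (intro tendsto_divide tendsto_const) auto
    then show "(\<lambda>n. of_real (weight \<alpha> (Y n)) * F (Y n)) \<longlonglongrightarrow> levy_amplitude TYPE('n) s / K" using K by simp
  qed
  obtain M where M: "M \<ge> 0" "\<And>n x. weight \<alpha> x * norm (convolution_power F n x) \<le> M ^ n"
    using convolution_power_weight_bound[OF \<alpha> F wF] by blast
  define u where "u k n = complex_of_real ((- t) ^ n / fact n) * (K * (of_real (weight \<alpha> (X k)) * convolution_power F n (X k)))" for k n
  have "(\<lambda>k. \<Sum>\<^sub>c n. u k n) \<longlonglongrightarrow> (\<Sum>\<^sub>c n. of_real ((- t) ^ n / fact n) * (K * (if n = 1 then levy_amplitude TYPE('n) s / K else 0)))"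
  proof (rule integral_dominated_convergence)
    show "summable_c (\<lambda>n. norm K * ((\<bar>t\<bar> * M) ^ n / fact n))"
      unfolding integrable_count_space_nat_iff using M summable_mult[OF summable_exp_generic[of "\<bar>t\<bar> * M"]] by (simp add: field_simps norm_mult)
    show "AE n in count_space UNIV. (\<lambda>k. u k n) \<longlonglongrightarrow> of_real ((- t) ^ n / fact n) * (K * (if n = 1 then levy_amplitude TYPE('n) s / K else 0))"
    proof (rule AE_I2)
      fix n
      have "(\<lambda>k. of_real (weight \<alpha> (X k)) * convolution_power F n (X k)) \<longlonglongrightarrow> (if n = 1 then levy_amplitude TYPE('n) s / K else 0)"
        by (rule convolution_power_tail[OF \<alpha> F wF tail total, unfolded tail_coefficient_def, rule_format, OF X])
      then show "(\<lambda>k. u k n) \<longlonglongrightarrow> of_real ((- t) ^ n / fact n) * (K * (if n = 1 then levy_amplitude TYPE('n) s / K else 0))"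
        unfolding u_def by (intro tendsto_mult tendsto_const)
    qed
    show "AE n in count_space UNIV. norm (u k n) \<le> norm K * ((\<bar>t\<bar> * M) ^ n / fact n)" for k
    proof (rule AE_I2)
      fix n
      have "norm (u k n) = norm K * (\<bar>t\<bar> ^ n / fact n) * (weight \<alpha> (X k) * norm (convolution_power F n (X k)))"
        by (simp add: u_def norm_mult norm_divide norm_power)
      also have "\<dots> \<le> norm K * (\<bar>t\<bar> ^ n / fact n) * M ^ n" by (intro mult_left_mono M) auto
      finally show "norm (u k n) \<le> norm K * ((\<bar>t\<bar> * M) ^ n / fact n)" by (simp add: power_mult_distrib)
    qed
  qed auto
  moreover have "(\<Sum>\<^sub>c n. complex_of_real ((- t) ^ n / fact n) * (K * (if n = 1 then levy_amplitude TYPE('n) s / K else 0))) = - of_real t * levy_amplitude TYPE('n) s"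
  proof -
    have "complex_of_real ((- t) ^ n / fact n) * (K * (if n = 1 then levy_amplitude TYPE('n) s / K else 0)) = indicator {1} n *\<^sub>R (- of_real t * levy_amplitude TYPE('n) s)" for n :: nat
      using K by (auto simp: indicator_def)
    then show ?thesis by simp
  qed
  moreover have "of_real (lnorm (X k) powr (real CARD('n) + 2 * s)) * torus_integral (\<lambda>\<xi>. of_real (exp (- t * laplace_symbol \<xi> powr s))) (X k) = (\<Sum>\<^sub>c n. u k n)" for k
  proof -
    have "torus_integral (\<lambda>\<xi>. of_real (exp (- t * laplace_symbol \<xi> powr s))) (X k) = (\<Sum>\<^sub>c n. of_real ((- t) ^ n / fact n) * torus_integral (\<lambda>\<xi>. of_real ((laplace_symbol \<xi> powr s) ^ n)) (X k))"
    proof (rule torus_integral_exp_series)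
      show "\<bar>laplace_symbol \<xi> powr s\<bar> \<le> (4 * real CARD('n)) powr s" for \<xi> :: "real^'n"
        using s by (simp add: powr_mono2 laplace_symbol_nonneg laplace_symbol_le)
    qed measurable
    then have "of_real (weight \<alpha> (X k)) * torus_integral (\<lambda>\<xi>. of_real (exp (- t * laplace_symbol \<xi> powr s))) (X k) =
      (\<Sum>\<^sub>c n. of_real (weight \<alpha> (X k)) * (of_real ((- t) ^ n / fact n) * (K * convolution_power F n (X k))))"
      unfolding tp by (simp only: integral_mult_right_zero)
    also have "\<dots> = (\<Sum>\<^sub>c n. u k n)"
      by (intro Bochner_Integration.integral_cong refl) (simp only: u_def mult_ac)
    finally show ?thesis by (simp add: weight_def \<alpha>_def)
  qed
  ultimately show ?thesis by simp
qed

theorem proposition1p10: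
  fixes s :: real
  assumes "0 < s" and "s < 1"
  shows "\<exists>A :: complex.
           (\<forall>(\<phi> :: real ^ 'n \<Rightarrow> complex) \<omega>. radial_cutoff \<phi> \<longrightarrow> norm \<omega> = 1 \<longrightarrow>
              (cutoff_integral s \<phi> \<omega> \<longlongrightarrow> A) at_top) \<and>
           (\<forall>t > 0.
              ((\<lambda>(x :: int ^ 'n, y).
                  of_real (norm (lattice_embed (x - y)) powr (real CARD('n) + 2 * s)) *
                  frac_kernel s t x y)
                \<longlongrightarrow> - (of_real t / (2 * of_real pi) ^ CARD('n)) * A) at_infinite_distance)"
proof (intro exI[of _ "levy_amplitude TYPE('n) s"] conjI allI impI)
  fix \<phi> :: "real ^ 'n \<Rightarrow> complex" and \<omega> :: "real ^ 'n"
  assume \<phi>: "radial_cutoff \<phi>" and \<omega>: "norm \<omega> = 1"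
  have smooth: "smooth_compact_support \<phi>"
    using \<phi> unfolding radial_cutoff_def by blast
  have one: "\<phi> x = 1" if "norm x \<le> 1 / 2" for x
    using \<phi> that unfolding radial_cutoff_def by blast
  show "(cutoff_integral s \<phi> \<omega> \<longlongrightarrow> levy_amplitude TYPE('n) s) at_top"
    by (rule cutoff_integral_tendsto[OF smooth \<omega> one assms])
next
  fix t :: real
  show "((\<lambda>(x :: int ^ 'n, y). of_real (norm (lattice_embed (x - y)) powr (real CARD('n) + 2 * s)) * frac_kernel s t x y)
          \<longlongrightarrow> - (of_real t / (2 * of_real pi) ^ CARD('n)) * levy_amplitude TYPE('n) s) at_infinite_distance"
    unfolding at_infinite_distance_def
  proof (rule tendsto_filtercomap_at_top_sequentially)
    fix X :: "nat \<Rightarrow> (int^'n) \<times> (int^'n)"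
    define Y where "Y n = fst (X n) - snd (X n)" for n
    assume "filterlim (\<lambda>n. case X n of (x, y) \<Rightarrow> norm (lattice_embed (x - y))) at_top sequentially"
    then have Y: "filterlim (\<lambda>n. norm (lattice_embed (Y n))) at_top sequentially"
      by (simp add: Y_def case_prod_unfold)
    have "(case X n of (x, y) \<Rightarrow> of_real (norm (lattice_embed (x - y)) powr (real CARD('n) + 2 * s)) * frac_kernel s t x y) =
      1 / (2 * of_real pi) ^ CARD('n) * (of_real (norm (lattice_embed (Y n)) powr (real CARD('n) + 2 * s)) * torus_integral (\<lambda>\<xi>. of_real (exp (- t * laplace_symbol \<xi> powr s))) (Y n))" for n
      by (simp add: Y_def case_prod_unfold frac_kernel_def torus_integral_def)
    with tendsto_mult_left[OF torus_integral_semigroup_tail[OF assms Y, of t], of "1 / (2 * of_real pi) ^ CARD('n)"]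
    show "(\<lambda>n. case X n of (x, y) \<Rightarrow> of_real (norm (lattice_embed (x - y)) powr (real CARD('n) + 2 * s)) * frac_kernel s t x y)
      \<longlonglongrightarrow> - (of_real t / (2 * of_real pi) ^ CARD('n)) * levy_amplitude TYPE('n) s"
      by simp
  qed
qed

end
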